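(* Let $k$ be an algebraically closed field, let $C$ be a tilted $k$-algebra, let $E=\mathrm{Ext}^2_C(DC,C)$ and let $B=C\ltimes E$ be the trivial extension of $C$ by the $C$-$C$-bimodule $E$. Then there is a short exact sequence of vector spaces $$0\longrightarrow \mathrm{HH}^1(B,E)\xrightarrow{\ \iota\ }\mathrm{HH}^1(B)\xrightarrow{\ \varphi\ }\mathrm{HH}^1(C)\longrightarrow 0,$$ where $\iota$ is induced by the inclusion of $B$-$B$-bimodules $i\colon E\hookrightarrow B$, and $\varphi$ sends the class of a derivation $\delta\colon B\to B$ to the class of the derivation $p\,\delta\, q\colon C\to C$, with $p\colon B\to C$ the natural projection and $q\colon C\to B$ the natural inclusion.
   Context: A tilted $k$-algebra is an algebra of the form $C=\mathrm{End}_H(U)$, where $H$ is a finite-dimensional hereditary $k$-algebra and $U$ is a tilting $H$-module. $D=\mathrm{Hom}_k(-,k)$ is the standard duality, and $E=\mathrm{Ext}^2_C(DC,C)$ carries its natural $C$-$C$-bimodule structure. The trivial extension $B=C\ltimes E$ is the vector space $C\oplus E$ with multiplication $(c_1,e_1)(c_2,e_2)=(c_1c_2,\,c_1e_2+e_1c_2)$; it is called the relation-extension of $C$ and is a cluster-tilted algebra. The projection $p\colon B\to C$ and its right inverse $q\colon C\to B$, $q(c)=(c,0)$, are algebra morphisms; there is a short exact sequence of $B$-$B$-bimodules $0\to E\xrightarrow{i}B\xrightarrow{p}C\to 0$, where $C$ and $E$ are $B$-$B$-bimodules through $p$. For an algebra $A$ with enveloping algebra $A^e=A\otimes_k A^{op}$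 and an $A$-$A$-bimodule $X$, $\mathrm{HH}^n(A,X)=\mathrm{Ext}^n_{A^e}(A,X)$ and $\mathrm{HH}^n(A)=\mathrm{HH}^n(A,A)$; $\mathrm{HH}^1(A,X)$ is the space of derivations $A\to X$ modulo inner derivations. *)

theory Defs
  imports "HOL-Algebra.Algebra"
begin

section \<open>Algebras, modules and bimodules over a field\<close>

text \<open>
  A vector space over a field \<open>K\<close> is a \<^locale>\<open>module\<close> over \<open>K\<close>. An algebra is stored in the same
  record, with the (in general noncommutative) ring operations of the record in use; for vector
  spaces the fields \<^const>\<open>monoid.mult\<close> and \<^const>\<open>one\<close> carry no information.
  The library locale \<^locale>\<open>algebra\<close> is restricted to commutative algebras.
\<close>

locale k_algebra = K: field K + module K A + A: ring A for K and A (structure) +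
  assumes smult_mult_left:
      "\<lbrakk>r \<in> carrier K; x \<in> carrier A; y \<in> carrier A\<rbrakk>
        \<Longrightarrow> (r \<odot>\<^bsub>A\<^esub> x) \<otimes>\<^bsub>A\<^esub> y = r \<odot>\<^bsub>A\<^esub> (x \<otimes>\<^bsub>A\<^esub> y)"
    and smult_mult_right:
      "\<lbrakk>r \<in> carrier K; x \<in> carrier A; y \<in> carrier A\<rbrakk>
        \<Longrightarrow> x \<otimes>\<^bsub>A\<^esub> (r \<odot>\<^bsub>A\<^esub> y) = r \<odot>\<^bsub>A\<^esub> (x \<otimes>\<^bsub>A\<^esub> y)"

record ('k, 'm, 'a) rmod = "('k, 'm) module" +
  ract :: "'m \<Rightarrow> 'a \<Rightarrow> 'm" (infixl \<open>\<triangleleft>\<index>\<close> 70)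

record ('k, 'm, 'a) bimod = "('k, 'm, 'a) rmod" +
  lact :: "'a \<Rightarrow> 'm \<Rightarrow> 'm" (infixr \<open>\<triangleright>\<index>\<close> 70)

locale right_module = A: k_algebra K A + M: module K M
  for K :: "('k, 'r) ring_scheme" and A :: "('k, 'a, 's) module_scheme"
    and M :: "('k, 'm, 'a, 'z) rmod_scheme" (structure) +
  assumes ract_closed:
      "\<lbrakk>x \<in> carrier M; a \<in> carrier A\<rbrakk> \<Longrightarrow> x \<triangleleft>\<^bsub>M\<^esub> a \<in> carrier M"
    and ract_add_left:
      "\<lbrakk>x \<in> carrier M; y \<in> carrier M; a \<in> carrier A\<rbrakk>
        \<Longrightarrow> (x \<oplus>\<^bsub>M\<^esub> y) \<triangleleft>\<^bsub>M\<^esub> a = (x \<triangleleft>\<^bsub>M\<^esub> a) \<oplus>\<^bsub>M\<^esub> (y \<triangleleft>\<^bsub>M\<^esub> a)"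
    and ract_add_right:
      "\<lbrakk>x \<in> carrier M; a \<in> carrier A; b \<in> carrier A\<rbrakk>
        \<Longrightarrow> x \<triangleleft>\<^bsub>M\<^esub> (a \<oplus>\<^bsub>A\<^esub> b) = (x \<triangleleft>\<^bsub>M\<^esub> a) \<oplus>\<^bsub>M\<^esub> (x \<triangleleft>\<^bsub>M\<^esub> b)"
    and ract_assoc:
      "\<lbrakk>x \<in> carrier M; a \<in> carrier A; b \<in> carrier A\<rbrakk>
        \<Longrightarrow> x \<triangleleft>\<^bsub>M\<^esub> (a \<otimes>\<^bsub>A\<^esub> b) = (x \<triangleleft>\<^bsub>M\<^esub> a) \<triangleleft>\<^bsub>M\<^esub> b"
    and ract_one:
      "x \<in> carrier M \<Longrightarrow> x \<triangleleft>\<^bsub>M\<^esub> \<one>\<^bsub>A\<^esub> = x"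
    and ract_smult_left:
      "\<lbrakk>r \<in> carrier K; x \<in> carrier M; a \<in> carrier A\<rbrakk>
        \<Longrightarrow> (r \<odot>\<^bsub>M\<^esub> x) \<triangleleft>\<^bsub>M\<^esub> a = r \<odot>\<^bsub>M\<^esub> (x \<triangleleft>\<^bsub>M\<^esub> a)"
    and ract_smult_right:
      "\<lbrakk>r \<in> carrier K; x \<in> carrier M; a \<in> carrier A\<rbrakk>
        \<Longrightarrow> x \<triangleleft>\<^bsub>M\<^esub> (r \<odot>\<^bsub>A\<^esub> a) = r \<odot>\<^bsub>M\<^esub> (x \<triangleleft>\<^bsub>M\<^esub> a)"

definition finite_dim :: "('k, 'r) ring_scheme \<Rightarrow> ('k, 'v, 'z) module_scheme \<Rightarrow> bool" where
  "finite_dim K V \<longleftrightarrow>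
    (\<exists>S. finite S \<and> S \<subseteq> carrier V \<and>
      (\<forall>v\<in>carrier V. \<exists>c \<in> S \<rightarrow> carrier K. v = (\<Oplus>\<^bsub>V\<^esub>s\<in>S. c s \<odot>\<^bsub>V\<^esub> s)))"

definition lin_map :: "('k, 'r) ring_scheme \<Rightarrow> ('k, 'v, 'y) module_scheme \<Rightarrow>
    ('k, 'w, 'z) module_scheme \<Rightarrow> ('v \<Rightarrow> 'w) set" where
  "lin_map K V W = {f \<in> carrier V \<rightarrow> carrier W.
     (\<forall>x\<in>carrier V. \<forall>y\<in>carrier V. f (x \<oplus>\<^bsub>V\<^esub> y) = f x \<oplus>\<^bsub>W\<^esub> f y) \<and>
     (\<forall>r\<in>carrier K. \<forall>x\<in>carrier V. f (r \<odot>\<^bsub>V\<^esub> x) = r \<odot>\<^bsub>W\<^esub> f x)}"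

text \<open>Homomorphisms are extensional functions (equal to \<^const>\<open>undefined\<close> off the carrier), so that
  equality of homomorphisms is HOL equality.\<close>

definition rmod_hom :: "('k, 'r) ring_scheme \<Rightarrow> ('k, 'a, 's) module_scheme \<Rightarrow>
    ('k, 'm, 'a, 'y) rmod_scheme \<Rightarrow> ('k, 'n, 'a, 'z) rmod_scheme \<Rightarrow> ('m \<Rightarrow> 'n) set" where
  "rmod_hom K A M N = {f \<in> lin_map K M N \<inter> extensional (carrier M).
     \<forall>x\<in>carrier M. \<forall>a\<in>carrier A. f (x \<triangleleft>\<^bsub>M\<^esub> a) = f x \<triangleleft>\<^bsub>N\<^esub> a}"

text \<open>The exactness part of ``\<open>0 \<rightarrow> L \<rightarrow> M \<rightarrow> N \<rightarrow> 0\<close> is a short exact sequence''; it is always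
  used together with the requirement that \<open>f\<close> and \<open>g\<close> are homomorphisms of the relevant kind.\<close>

definition short_exact :: "('l, 'x) ring_scheme \<Rightarrow> ('m, 'y) ring_scheme \<Rightarrow> ('n, 'z) ring_scheme \<Rightarrow>
    ('l \<Rightarrow> 'm) \<Rightarrow> ('m \<Rightarrow> 'n) \<Rightarrow> bool" where
  "short_exact L M N f g \<longleftrightarrow>
     inj_on f (carrier L) \<and>
     f ` carrier L = {x \<in> carrier M. g x = \<zero>\<^bsub>N\<^esub>} \<and>
     g ` carrier M = carrier N"

text \<open>The set \<open>F\<close> of functions \<open>S \<rightarrow> W\<close> with pointwise operations.\<close>

definition fun_space :: "'s set \<Rightarrow> ('s \<Rightarrow> 'w) set \<Rightarrow> ('k, 'w, 'z) module_scheme \<Rightarrow>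
    ('k, 's \<Rightarrow> 'w) module" where
  "fun_space S F W =
     \<lparr>carrier = F, monoid.mult = undefined, one = undefined,
      ring.zero = (\<lambda>s\<in>S. \<zero>\<^bsub>W\<^esub>), ring.add = (\<lambda>f g. \<lambda>s\<in>S. f s \<oplus>\<^bsub>W\<^esub> g s),
      smult = (\<lambda>r f. \<lambda>s\<in>S. r \<odot>\<^bsub>W\<^esub> f s)\<rparr>"

text \<open>The quotient vector space \<open>V / W\<close>, whose elements are the cosets of the subspace \<open>W\<close>.
  \<open>coset_map V W f\<close> is the operation on cosets induced by \<open>f\<close>.\<close>

definition coset_map :: "('v, 'z) ring_scheme \<Rightarrow> 'v set \<Rightarrow> ('v \<Rightarrow> 'v) \<Rightarrow> 'v set \<Rightarrow> 'v set" where
  "coset_map V W f Y = (\<Union>x\<in>Y. W +>\<^bsub>V\<^esub> f x)"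

definition quot_space :: "('k, 'v, 'z) module_scheme \<Rightarrow> 'v set \<Rightarrow> ('k, 'v set) module" where
  "quot_space V W =
     \<lparr>carrier = a_rcosets\<^bsub>V\<^esub> W, monoid.mult = undefined, one = undefined,
      ring.zero = W, ring.add = set_add V,
      smult = (\<lambda>r. coset_map V W (\<lambda>x. r \<odot>\<^bsub>V\<^esub> x))\<rparr>"

definition base_space :: "('k, 'r) ring_scheme \<Rightarrow> ('k, 'k) module" where
  "base_space K =
     \<lparr>carrier = carrier K, monoid.mult = monoid.mult K, one = one K,
      ring.zero = ring.zero K, ring.add = ring.add K,
      smult = monoid.mult K\<rparr>"

definition reg_bimod :: "('k, 'a, 'z) module_scheme \<Rightarrow> ('k, 'a, 'a) bimod" where
  "reg_bimod A =
     \<lparr>carrier = carrier A, monoid.mult = monoid.mult A, one = one A,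
      ring.zero = ring.zero A, ring.add = ring.add A,
      smult = smult A, ract = monoid.mult A, lact = monoid.mult A\<rparr>"

text \<open>\<open>D Y = Hom\<^sub>k(Y, k)\<close> with \<open>(f \<triangleleft> a)(x) = f (a \<triangleright> x)\<close> and \<open>(a \<triangleright> f)(x) = f (x \<triangleleft> a)\<close>.\<close>

definition dual_bimod :: "('k, 'r) ring_scheme \<Rightarrow> ('k, 'm, 'a, 'z) bimod_scheme \<Rightarrow>
    ('k, 'm \<Rightarrow> 'k, 'a) bimod" where
  "dual_bimod K Y =
     module.extend
       (fun_space (carrier Y)
         (lin_map K Y (base_space K) \<inter> extensional (carrier Y)) (base_space K))
       \<lparr>ract = (\<lambda>f a. \<lambda>x\<in>carrier Y. f (a \<triangleright>\<^bsub>Y\<^esub> x)),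
        lact = (\<lambda>a f. \<lambda>x\<in>carrier Y. f (x \<triangleleft>\<^bsub>Y\<^esub> a))\<rparr>"

definition restrict_bimod :: "('b \<Rightarrow> 'a) \<Rightarrow> ('k, 'm, 'a) bimod \<Rightarrow> ('k, 'm, 'b) bimod" where
  "restrict_bimod h Y =
     \<lparr>carrier = carrier Y, monoid.mult = monoid.mult Y, one = one Y,
      ring.zero = ring.zero Y, ring.add = ring.add Y,
      smult = smult Y,
      ract = (\<lambda>x b. x \<triangleleft>\<^bsub>Y\<^esub> h b), lact = (\<lambda>b x. h b \<triangleright>\<^bsub>Y\<^esub> x)\<rparr>"


section \<open>Projective modules and Ext\<close>

definition power_mod :: "nat \<Rightarrow> ('k, 'm, 'a, 'z) rmod_scheme \<Rightarrow> ('k, nat \<Rightarrow> 'm, 'a) rmod" where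
  "power_mod n M =
     module.extend (fun_space {..<n} ({..<n} \<rightarrow>\<^sub>E carrier M) M)
       \<lparr>ract = (\<lambda>x a. \<lambda>i\<in>{..<n}. x i \<triangleleft>\<^bsub>M\<^esub> a)\<rparr>"

text \<open>\<open>Y \<in> add T\<close>: \<open>Y\<close> is isomorphic to a direct summand of some \<open>T\<^sup>n\<close>.\<close>

definition in_add :: "('k, 'r) ring_scheme \<Rightarrow> ('k, 'a, 's) module_scheme \<Rightarrow>
    ('k, 't, 'a, 'y) rmod_scheme \<Rightarrow> ('k, 'm, 'a, 'z) rmod_scheme \<Rightarrow> bool" where
  "in_add K A T Y \<longleftrightarrow> right_module K A Y \<and>
     (\<exists>n. \<exists>s \<in> rmod_hom K A Y (power_mod n T). \<exists>r \<in> rmod_hom K A (power_mod n T) Y.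
        \<forall>x\<in>carrier Y. r (s x) = x)"

text \<open>Modules are finitely generated throughout, so a projective module is a direct summand of a
  free module of finite rank.\<close>

definition projective :: "('k, 'r) ring_scheme \<Rightarrow> ('k, 'a, 's) module_scheme \<Rightarrow>
    ('k, 'm, 'a, 'z) rmod_scheme \<Rightarrow> bool" where
  "projective K A P \<longleftrightarrow> in_add K A (reg_bimod A) P"

text \<open>\<open>\<cdots> \<rightarrow> res_obj 1 \<rightarrow> res_obj 0 \<rightarrow> M \<rightarrow> 0\<close>, with \<open>res_diff n : res_obj (n+1) \<rightarrow> res_obj n\<close> and
  augmentation \<open>res_aug : res_obj 0 \<rightarrow> M\<close>.\<close>

record ('k, 'p, 'a, 'm) resolution =
  res_obj :: "nat \<Rightarrow> ('k, 'p, 'a) rmod"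
  res_diff :: "nat \<Rightarrow> 'p \<Rightarrow> 'p"
  res_aug :: "'p \<Rightarrow> 'm"

definition proj_resolution :: "('k, 'r) ring_scheme \<Rightarrow> ('k, 'a, 's) module_scheme \<Rightarrow>
    ('k, 'm, 'a, 'z) rmod_scheme \<Rightarrow> ('k, 'p, 'a, 'm) resolution \<Rightarrow> bool" where
  "proj_resolution K A M R \<longleftrightarrow>
     (\<forall>n. projective K A (res_obj R n)) \<and>
     (\<forall>n. res_diff R n \<in> rmod_hom K A (res_obj R (Suc n)) (res_obj R n)) \<and>
     res_aug R \<in> rmod_hom K A (res_obj R 0) M \<and>
     res_aug R ` carrier (res_obj R 0) = carrier M \<and>
     res_diff R 0 ` carrier (res_obj R 1) =
       {x \<in> carrier (res_obj R 0). res_aug R x = \<zero>\<^bsub>M\<^esub>} \<and>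
     (\<forall>n. res_diff R (Suc n) ` carrier (res_obj R (Suc (Suc n))) =
       {x \<in> carrier (res_obj R (Suc n)). res_diff R n x = \<zero>\<^bsub>res_obj R n\<^esub>})"

text \<open>Ext is computed from a chosen projective resolution. Every finitely generated projective
  module is isomorphic to a submodule of some \<open>A\<^sup>n\<close>, so resolutions carried by the type
  \<^typ>\<open>nat \<Rightarrow> 'a\<close> suffice.\<close>

definition the_resolution :: "('k, 'r) ring_scheme \<Rightarrow> ('k, 'a, 's) module_scheme \<Rightarrow>
    ('k, 'm, 'a, 'z) rmod_scheme \<Rightarrow> ('k, nat \<Rightarrow> 'a, 'a, 'm) resolution" where
  "the_resolution K A M = (SOME R. proj_resolution K A M R)"

definition Hom_cocycles :: "('k, 'r) ring_scheme \<Rightarrow> ('k, 'a, 's) module_scheme \<Rightarrow>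
    ('k, 'p, 'a, 'm) resolution \<Rightarrow> nat \<Rightarrow> ('k, 'n, 'a, 'z) rmod_scheme \<Rightarrow> ('p \<Rightarrow> 'n) set" where
  "Hom_cocycles K A R n N = {f \<in> rmod_hom K A (res_obj R n) N.
     \<forall>x\<in>carrier (res_obj R (Suc n)). f (res_diff R n x) = \<zero>\<^bsub>N\<^esub>}"

definition Hom_coboundaries :: "('k, 'r) ring_scheme \<Rightarrow> ('k, 'a, 's) module_scheme \<Rightarrow>
    ('k, 'p, 'a, 'm) resolution \<Rightarrow> nat \<Rightarrow> ('k, 'n, 'a, 'z) rmod_scheme \<Rightarrow> ('p \<Rightarrow> 'n) set" where
  "Hom_coboundaries K A R n N =
     (case n of
        0 \<Rightarrow> {\<lambda>x\<in>carrier (res_obj R 0). \<zero>\<^bsub>N\<^esub>}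
      | Suc m \<Rightarrow> (\<lambda>g. compose (carrier (res_obj R (Suc m))) g (res_diff R m)) `
                  rmod_hom K A (res_obj R m) N)"

definition Hom_cocycle_space :: "('k, 'r) ring_scheme \<Rightarrow> ('k, 'a, 's) module_scheme \<Rightarrow>
    ('k, 'p, 'a, 'm) resolution \<Rightarrow> nat \<Rightarrow> ('k, 'n, 'a, 'z) rmod_scheme \<Rightarrow>
    ('k, 'p \<Rightarrow> 'n) module" where
  "Hom_cocycle_space K A R n N =
     fun_space (carrier (res_obj R n)) (Hom_cocycles K A R n N) N"

definition Ext :: "('k, 'r) ring_scheme \<Rightarrow> ('k, 'a, 's) module_scheme \<Rightarrow> nat \<Rightarrow>
    ('k, 'm, 'a, 'y) rmod_scheme \<Rightarrow> ('k, 'n, 'a, 'z) rmod_scheme \<Rightarrow>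
    ('k, ((nat \<Rightarrow> 'a) \<Rightarrow> 'n) set) module" where
  "Ext K A n M N =
     (let R = the_resolution K A M
      in quot_space (Hom_cocycle_space K A R n N) (Hom_coboundaries K A R n N))"

text \<open>Chain endomorphisms \<open>l\<close> of the resolution lifting the endomorphism \<open>h\<close> of \<open>M\<close>.\<close>

definition chain_lift :: "('k, 'r) ring_scheme \<Rightarrow> ('k, 'a, 's) module_scheme \<Rightarrow>
    ('k, 'p, 'a, 'm) resolution \<Rightarrow> ('m \<Rightarrow> 'm) \<Rightarrow> (nat \<Rightarrow> 'p \<Rightarrow> 'p) \<Rightarrow> bool" where
  "chain_lift K A R h l \<longleftrightarrow>
     (\<forall>n. l n \<in> rmod_hom K A (res_obj R n) (res_obj R n)) \<and>
     (\<forall>x\<in>carrier (res_obj R 0). res_aug R (l 0 x) = h (res_aug R x)) \<and>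
     (\<forall>n. \<forall>x\<in>carrier (res_obj R (Suc n)). res_diff R n (l (Suc n) x) = l n (res_diff R n x))"

text \<open>For bimodules \<open>M\<close> and \<open>N\<close>, left multiplication by \<open>a\<close> is an endomorphism of the right
  modules \<open>M\<close> and \<open>N\<close>. By functoriality it acts on \<open>Ext\<^sup>n(M, N)\<close> covariantly through \<open>N\<close>, which
  gives the left action, and contravariantly through \<open>M\<close>, which gives the right action. On classes
  of cocycles the latter is precomposition with any lift to the resolution; the resulting class does
  not depend on the lift.\<close>

definition Ext_bimod :: "('k, 'r) ring_scheme \<Rightarrow> ('k, 'a, 's) module_scheme \<Rightarrow> nat \<Rightarrow>
    ('k, 'm, 'a, 'y) bimod_scheme \<Rightarrow> ('k, 'n, 'a, 'z) bimod_scheme \<Rightarrow>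
    ('k, ((nat \<Rightarrow> 'a) \<Rightarrow> 'n) set, 'a) bimod" where
  "Ext_bimod K A n M N =
     (let R = the_resolution K A M;
          P = carrier (res_obj R n);
          Z = Hom_cocycle_space K A R n N;
          W = Hom_coboundaries K A R n N
      in module.extend (Ext K A n M N)
           \<lparr>ract = (\<lambda>Y a.
               let l = (SOME l. chain_lift K A R (\<lambda>m. a \<triangleright>\<^bsub>M\<^esub> m) l)
               in coset_map Z W (\<lambda>f. compose P f (l n)) Y),
            lact = (\<lambda>a. coset_map Z W (\<lambda>f. compose P (\<lambda>y. a \<triangleright>\<^bsub>N\<^esub> y) f))\<rparr>)"


section \<open>Tilted algebras\<close>

text \<open>Every right ideal is projective.\<close>

definition hereditary :: "('k, 'r) ring_scheme \<Rightarrow> ('k, 'a, 's) module_scheme \<Rightarrow> bool" where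
  "hereditary K A \<longleftrightarrow>
     (\<forall>I. submodule I K A \<and> (\<forall>x\<in>I. \<forall>a\<in>carrier A. x \<otimes>\<^bsub>A\<^esub> a \<in> I) \<longrightarrow>
        projective K A ((reg_bimod A)\<lparr>carrier := I\<rparr>))"

text \<open>As above, \<^typ>\<open>nat \<Rightarrow> 'a\<close> is large enough to carry all finitely generated projectives, and
  likewise \<^typ>\<open>nat \<Rightarrow> 'u\<close> to carry all modules in \<open>add U\<close> in the definition of tilting.\<close>

definition proj_dim_le_1 :: "('k, 'r) ring_scheme \<Rightarrow> ('k, 'a, 's) module_scheme \<Rightarrow>
    ('k, 'm, 'a, 'z) rmod_scheme \<Rightarrow> bool" where
  "proj_dim_le_1 K A M \<longleftrightarrow>
     (\<exists>(P1 :: ('k, nat \<Rightarrow> 'a, 'a) rmod) (P0 :: ('k, nat \<Rightarrow> 'a, 'a) rmod).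
        projective K A P1 \<and> projective K A P0 \<and>
        (\<exists>f \<in> rmod_hom K A P1 P0. \<exists>g \<in> rmod_hom K A P0 M. short_exact P1 P0 M f g))"

definition tilting :: "('k, 'r) ring_scheme \<Rightarrow> ('k, 'a, 's) module_scheme \<Rightarrow>
    ('k, 'u, 'a, 'z) rmod_scheme \<Rightarrow> bool" where
  "tilting K A U \<longleftrightarrow>
     right_module K A U \<and> finite_dim K U \<and>
     proj_dim_le_1 K A U \<and>
     carrier (Ext K A 1 U U) = {\<zero>\<^bsub>Ext K A 1 U U\<^esub>} \<and>
     (\<exists>(T0 :: ('k, nat \<Rightarrow> 'u, 'a) rmod) (T1 :: ('k, nat \<Rightarrow> 'u, 'a) rmod).
        in_add K A U T0 \<and> in_add K A U T1 \<and>
        (\<exists>f \<in> rmod_hom K A (reg_bimod A) T0. \<exists>g \<in> rmod_hom K A T0 T1.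
           short_exact (reg_bimod A) T0 T1 f g))"

definition End_algebra :: "('k, 'r) ring_scheme \<Rightarrow> ('k, 'a, 's) module_scheme \<Rightarrow>
    ('k, 'u, 'a, 'z) rmod_scheme \<Rightarrow> ('k, 'u \<Rightarrow> 'u) module" where
  "End_algebra K A U =
     (fun_space (carrier U) (rmod_hom K A U U) U)
       \<lparr>monoid.mult := compose (carrier U), one := (\<lambda>x\<in>carrier U. x)\<rparr>"

text \<open>\<open>C\<close> is tilted when such \<open>H\<close> and \<open>U\<close> exist. They are kept as arguments since HOL cannot
  quantify existentially over the types carrying them; the product in \<open>End\<^sub>H(U)\<close> is composition of
  endomorphisms of the right module \<open>U\<close>.\<close>

definition tilted_by :: "('k, 'r) ring_scheme \<Rightarrow> ('k, 'c, 's) module_scheme \<Rightarrow>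
    ('k, 'h, 't) module_scheme \<Rightarrow> ('k, 'u, 'h, 'z) rmod_scheme \<Rightarrow> bool" where
  "tilted_by K C H U \<longleftrightarrow>
     k_algebra K C \<and>
     k_algebra K H \<and> finite_dim K H \<and> hereditary K H \<and> tilting K H U \<and>
     (\<exists>h \<in> ring_iso C (End_algebra K H U). h \<in> lin_map K C (End_algebra K H U))"


section \<open>Trivial extensions and first Hochschild cohomology\<close>

definition trivial_ext :: "('k, 'c, 's) module_scheme \<Rightarrow> ('k, 'e, 'c, 'z) bimod_scheme \<Rightarrow>
    ('k, 'c \<times> 'e) module" where
  "trivial_ext C E =
     \<lparr>carrier = carrier C \<times> carrier E,
      monoid.mult = (\<lambda>(c1, e1) (c2, e2). (c1 \<otimes>\<^bsub>C\<^esub> c2, (c1 \<triangleright>\<^bsub>E\<^esub> e2) \<oplus>\<^bsub>E\<^esub> (e1 \<triangleleft>\<^bsub>E\<^esub> c2))),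
      one = (\<one>\<^bsub>C\<^esub>, \<zero>\<^bsub>E\<^esub>),
      ring.zero = (\<zero>\<^bsub>C\<^esub>, \<zero>\<^bsub>E\<^esub>),
      ring.add = (\<lambda>(c1, e1) (c2, e2). (c1 \<oplus>\<^bsub>C\<^esub> c2, e1 \<oplus>\<^bsub>E\<^esub> e2)),
      smult = (\<lambda>r (c, e). (r \<odot>\<^bsub>C\<^esub> c, r \<odot>\<^bsub>E\<^esub> e))\<rparr>"

definition derivations :: "('k, 'r) ring_scheme \<Rightarrow> ('k, 'a, 's) module_scheme \<Rightarrow>
    ('k, 'x, 'a, 'z) bimod_scheme \<Rightarrow> ('a \<Rightarrow> 'x) set" where
  "derivations K A Y = {\<delta> \<in> lin_map K A Y \<inter> extensional (carrier A).
     \<forall>a\<in>carrier A. \<forall>b\<in>carrier A.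
       \<delta> (a \<otimes>\<^bsub>A\<^esub> b) = (a \<triangleright>\<^bsub>Y\<^esub> \<delta> b) \<oplus>\<^bsub>Y\<^esub> (\<delta> a \<triangleleft>\<^bsub>Y\<^esub> b)}"

definition inner_derivations :: "('k, 'a, 's) module_scheme \<Rightarrow>
    ('k, 'x, 'a, 'z) bimod_scheme \<Rightarrow> ('a \<Rightarrow> 'x) set" where
  "inner_derivations A Y =
     (\<lambda>x. \<lambda>a\<in>carrier A. (a \<triangleright>\<^bsub>Y\<^esub> x) \<ominus>\<^bsub>Y\<^esub> (x \<triangleleft>\<^bsub>Y\<^esub> a)) ` carrier Y"

definition derivation_space :: "('k, 'r) ring_scheme \<Rightarrow> ('k, 'a, 's) module_scheme \<Rightarrow>
    ('k, 'x, 'a, 'z) bimod_scheme \<Rightarrow> ('k, 'a \<Rightarrow> 'x) module" where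
  "derivation_space K A Y = fun_space (carrier A) (derivations K A Y) Y"

definition HH1 :: "('k, 'r) ring_scheme \<Rightarrow> ('k, 'a, 's) module_scheme \<Rightarrow>
    ('k, 'x, 'a, 'z) bimod_scheme \<Rightarrow> ('k, ('a \<Rightarrow> 'x) set) module" where
  "HH1 K A Y = quot_space (derivation_space K A Y) (inner_derivations A Y)"

definition HH1_class :: "('k, 'r) ring_scheme \<Rightarrow> ('k, 'a, 's) module_scheme \<Rightarrow>
    ('k, 'x, 'a, 'z) bimod_scheme \<Rightarrow> ('a \<Rightarrow> 'x) \<Rightarrow> ('a \<Rightarrow> 'x) set" where
  "HH1_class K A Y \<delta> = inner_derivations A Y +>\<^bsub>derivation_space K A Y\<^esub> \<delta>"

end

theory Submission
  imports Defs
begin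

text \<open>
  The sequence belongs to \<open>0 \<rightarrow> E \<rightarrow> B \<rightarrow> C \<rightarrow> 0\<close>. Injectivity of \<open>\<iota>\<close> holds because a central element
  \<open>c\<close> of \<open>C\<close> acts equally from both sides on \<open>E\<close>: left multiplication by \<open>c\<close> on \<open>DC\<close> is also right
  multiplication by \<open>c\<close>, which lifts to any resolution as right multiplication. For surjectivity of
  \<open>\<phi>\<close>, a derivation \<open>\<delta>\<close> of \<open>C\<close> induces the operator \<open>f \<mapsto> - f \<circ> \<delta>\<close> on \<open>DC\<close>, which satisfies a Leibniz
  rule; it lifts to a projective resolution and acts on \<open>E\<close>, and together with \<open>\<delta>\<close> it gives a
  derivation of \<open>B\<close>.

  Exactness in the middle follows from \<open>Hom\<^sub>C(E, C) = 0\<close> for left modules. If the syzygy \<open>\<Omega>\<close> in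
  \<open>\<Omega> \<rightarrow> P\<^sub>1 \<rightarrow> P\<^sub>0 \<rightarrow> DC\<close> is projective, then \<open>E\<close> is the cokernel of
  \<open>Hom(P\<^sub>1, C) \<rightarrow> Hom(\<Omega>, C)\<close>, and dualizing gives \<open>Hom\<^sub>C(E, C) = ker (\<Omega> \<rightarrow> P\<^sub>1) = 0\<close>. Second syzygies over
  \<open>C = End\<^sub>H(U)\<close> are projective already when \<open>H\<close> is hereditary and \<open>Ext\<^sup>1(U, U) = 0\<close>.
\<close>


text \<open>Why second syzygies over \<open>C\<close> are projective: a map between projective
  \<open>C\<close>-modules is Hom(U, -) of a map between summands of powers of U. Its kernel N is
  Hom(U, T), where T is the image in U^n of a map \<sigma> from U^q along which every map from U to
  T lifts. This lifting together with Ext^1(U, U) = 0 gives Ext^1(U, ker \<sigma>) = 0. As H is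
  hereditary, the inclusion of T into U^n induces a surjection from Ext^1(U^n, ker \<sigma>) onto
  Ext^1(T, ker \<sigma>), so the latter vanishes too. Hence \<sigma> splits over T, T is a summand
  of U^q, and N = Hom(U, T) is a summand of the free module Hom(U, U^q). Neither ker \<sigma> nor a
  long exact sequence is formed: the argument is unrolled into lifts and extensions along a
  projective module mapping onto U. For the same reason projectivity enters only through sums of
  rank one maps, along which lifts, connections and evaluation points are built one summand at a
  time.\<close>

lemma (in abelian_group) a_inv_zero: "\<ominus> \<zero> = \<zero>"
  by (rule minus_equality) simp_all

text \<open>Sorting a sum by commutativity does not put \<open>x\<close> next to its negative. These
  rules cancel the two across the summands between them, which makes \<open>ag_simps\<close> strong
  enough for the identities below.\<close>

lemma (in abelian_group) a_cancel:
  assumes "x \<in> carrier G" "y \<in> carrier G" "z \<in> carrier G"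
  shows "x \<oplus> (y \<oplus> \<ominus> x) = y"
    and "x \<oplus> (y \<oplus> (\<ominus> x \<oplus> z)) = y \<oplus> z"
    and "x \<oplus> (y \<oplus> (z \<oplus> \<ominus> x)) = y \<oplus> z"
proof -
  show "x \<oplus> (y \<oplus> \<ominus> x) = y"
    using assms by (simp add: a_lcomm[of x y] r_neg)
  show "x \<oplus> (y \<oplus> (\<ominus> x \<oplus> z)) = y \<oplus> z"
    using assms by (simp add: a_lcomm[of x y] r_neg2 r_neg1)
  show "x \<oplus> (y \<oplus> (z \<oplus> \<ominus> x)) = y \<oplus> z"
    using assms by (simp add: a_lcomm[of x y] a_lcomm[of x z] r_neg)
qed

lemmas (in abelian_group) ag_simps =
  a_inv_zero minus_eq minus_minus a_cancel minus_add a_assoc a_comm a_lcomm l_neg r_neg r_neg1 r_neg2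

section \<open>Linear maps between vector spaces\<close>

lemma lin_mapI:
  assumes "\<And>x. x \<in> carrier V \<Longrightarrow> f x \<in> carrier W"
    and "\<And>x y. x \<in> carrier V \<Longrightarrow> y \<in> carrier V \<Longrightarrow> f (x \<oplus>\<^bsub>V\<^esub> y) = f x \<oplus>\<^bsub>W\<^esub> f y"
    and "\<And>r x. r \<in> carrier K \<Longrightarrow> x \<in> carrier V \<Longrightarrow> f (r \<odot>\<^bsub>V\<^esub> x) = r \<odot>\<^bsub>W\<^esub> f x"
  shows "f \<in> lin_map K V W"
  using assms by (auto simp: lin_map_def)

lemma lin_mapD:
  assumes "f \<in> lin_map K V W"
  shows "x \<in> carrier V \<Longrightarrow> f x \<in> carrier W"
    and "x \<in> carrier V \<Longrightarrow> y \<in> carrier V \<Longrightarrow> f (x \<oplus>\<^bsub>V\<^esub> y) = f x \<oplus>\<^bsub>W\<^esub> f y"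
    and "r \<in> carrier K \<Longrightarrow> x \<in> carrier V \<Longrightarrow> f (r \<odot>\<^bsub>V\<^esub> x) = r \<odot>\<^bsub>W\<^esub> f x"
  using assms by (auto simp: lin_map_def)

lemma lin_map_group:
  assumes f: "f \<in> lin_map K V W" and V: "module K V" and W: "module K W"
  shows "f \<zero>\<^bsub>V\<^esub> = \<zero>\<^bsub>W\<^esub>"
    and "x \<in> carrier V \<Longrightarrow> f (\<ominus>\<^bsub>V\<^esub> x) = \<ominus>\<^bsub>W\<^esub> f x"
    and "x \<in> carrier V \<Longrightarrow> y \<in> carrier V \<Longrightarrow> f (x \<ominus>\<^bsub>V\<^esub> y) = f x \<ominus>\<^bsub>W\<^esub> f y"
proof -
  interpret V: module K V by fact
  interpret W: module K W by fact
  show 0: "f \<zero>\<^bsub>V\<^esub> = \<zero>\<^bsub>W\<^esub>"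
    using lin_mapD(3)[OF f, of "\<zero>\<^bsub>K\<^esub>" "\<zero>\<^bsub>V\<^esub>"] lin_mapD(1)[OF f, of "\<zero>\<^bsub>V\<^esub>"] by simp
  show m: "f (\<ominus>\<^bsub>V\<^esub> x) = \<ominus>\<^bsub>W\<^esub> f x" if "x \<in> carrier V" for x
    using lin_mapD(2)[OF f, of "\<ominus>\<^bsub>V\<^esub> x" x] lin_mapD(1)[OF f] 0 that
    by (simp add: V.M.l_neg W.M.minus_equality)
  show "f (x \<ominus>\<^bsub>V\<^esub> y) = f x \<ominus>\<^bsub>W\<^esub> f y" if "x \<in> carrier V" "y \<in> carrier V" for x y
    using that lin_mapD(2)[OF f] m by (simp add: V.M.minus_eq W.M.minus_eq)
qed

lemma lin_map_comp:
  assumes "f \<in> lin_map K V W" "g \<in> lin_map K W Y"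
  shows "(\<lambda>x. g (f x)) \<in> lin_map K V Y"
  using assms by (auto simp: lin_map_def Pi_iff)

section \<open>Quotient spaces\<close>

text \<open>The operation of \<open>coset_map\<close>, freed from the requirement that source and
  target have the same type: \<iota> and \<phi> go between different quotients.\<close>

definition quot_map :: "('w, 'z) ring_scheme \<Rightarrow> 'w set \<Rightarrow> ('v \<Rightarrow> 'w) \<Rightarrow> 'v set \<Rightarrow> 'w set" where
  "quot_map V W f Y = (\<Union>x\<in>Y. W +>\<^bsub>V\<^esub> f x)"

lemma coset_map_eq_quot_map: "coset_map = quot_map"
  by (intro ext) (simp add: coset_map_def quot_map_def)

lemma quot_space_simps [simp]:
  "carrier (quot_space V W) = a_rcosets\<^bsub>V\<^esub> W"
  "\<zero>\<^bsub>quot_space V W\<^esub> = W"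
  "x \<oplus>\<^bsub>quot_space V W\<^esub> y = x <+>\<^bsub>V\<^esub> y"
  "r \<odot>\<^bsub>quot_space V W\<^esub> x = quot_map V W (\<lambda>x. r \<odot>\<^bsub>V\<^esub> x) x"
  by (simp_all add: quot_space_def coset_map_eq_quot_map)

lemma submodule_abelian_subgroup:
  assumes "module K V" "submodule W K V"
  shows "abelian_subgroup W V"
proof -
  interpret V: module K V by fact
  interpret W: submodule W K V by fact
  show ?thesis
    by (intro abelian_subgroupI3 additive_subgroupI W.subgroup_axioms) unfold_locales
qed

lemma coset_eq_iff:
  assumes V: "module K V" and W: "submodule W K V" and x: "x \<in> carrier V" and y: "y \<in> carrier V"
  shows "W +>\<^bsub>V\<^esub> x = W +>\<^bsub>V\<^esub> y \<longleftrightarrow> x \<ominus>\<^bsub>V\<^esub> y \<in> W"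
proof -
  interpret V: module K V by (rule V)
  interpret W: submodule W K V by (rule W)
  interpret S: abelian_subgroup W V by (rule submodule_abelian_subgroup[OF V W])
  show ?thesis
proof
  assume "W +>\<^bsub>V\<^esub> x = W +>\<^bsub>V\<^esub> y"
  then show "x \<ominus>\<^bsub>V\<^esub> y \<in> W"
    using S.a_rcos_self[OF x] S.a_rcos_module_imp[OF y] x y by (auto simp: V.M.minus_eq)
next
  assume "x \<ominus>\<^bsub>V\<^esub> y \<in> W"
  then have "x \<in> W +>\<^bsub>V\<^esub> y"
    using x y by (intro S.a_rcos_module_rev) (auto simp: V.M.minus_eq)
  then show "W +>\<^bsub>V\<^esub> x = W +>\<^bsub>V\<^esub> y"
    using V.M.a_repr_independence[OF _ y] W.subgroup_axioms by simp
qed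
qed

context
  fixes K :: "('k, 'r) ring_scheme" and V :: "('k, 'v, 'z) module_scheme" and W :: "'v set"
  assumes V: "module K V" and W: "submodule W K V"
begin

interpretation V: module K V by (rule V)
interpretation W: submodule W K V by (rule W)
interpretation S: abelian_subgroup W V by (rule submodule_abelian_subgroup[OF V W])

lemma coset_zero: "x \<in> carrier V \<Longrightarrow> W +>\<^bsub>V\<^esub> x = W \<longleftrightarrow> x \<in> W"
  using coset_eq_iff[OF V W, of x "\<zero>\<^bsub>V\<^esub>"] W.subset by (simp add: V.M.minus_eq V.M.a_inv_zero)

lemma quot_carrier: "carrier (quot_space V W) = (\<lambda>x. W +>\<^bsub>V\<^esub> x) ` carrier V"
  by (auto simp: A_RCOSETS_def')

lemma coset_in: "x \<in> carrier V \<Longrightarrow> W +>\<^bsub>V\<^esub> x \<in> a_rcosets\<^bsub>V\<^esub> W"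
  by (auto simp: A_RCOSETS_def')

lemma coset_add:
  "x \<in> carrier V \<Longrightarrow> y \<in> carrier V \<Longrightarrow> (W +>\<^bsub>V\<^esub> x) <+>\<^bsub>V\<^esub> (W +>\<^bsub>V\<^esub> y) = W +>\<^bsub>V\<^esub> (x \<oplus>\<^bsub>V\<^esub> y)"
  by (rule S.a_rcos_sum)

text \<open>Elements of one coset differ by elements of \<open>W\<close>, which \<open>f\<close>
  sends into \<open>W'\<close>. So all cosets in the union defining \<open>quot_map\<close> are
  equal, and the union is not empty because \<open>x\<close> lies in its own coset.\<close>

lemma quot_map_coset:
  assumes V': "module K V'" and W': "submodule W' K V'"
    and f: "f \<in> lin_map K V V'" and fW: "f ` W \<subseteq> W'" and x: "x \<in> carrier V"
  shows "quot_map V' W' f (W +>\<^bsub>V\<^esub> x) = W' +>\<^bsub>V'\<^esub> f x"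
proof -
  interpret V': module K V' by fact
  interpret W': submodule W' K V' by fact
  interpret S': abelian_subgroup W' V' by (rule submodule_abelian_subgroup[OF V' W'])
  have "W' +>\<^bsub>V'\<^esub> f y = W' +>\<^bsub>V'\<^esub> f x" if y: "y \<in> W +>\<^bsub>V\<^esub> x" for y
  proof -
    obtain w where w: "w \<in> W" and yw: "y = w \<oplus>\<^bsub>V\<^esub> x" using y by (auto simp: a_r_coset_def')
    have wV: "w \<in> carrier V" using w W.subset by auto
    have "f w \<in> W'" using fW w by auto
    moreover have "f w \<in> carrier V'" "f x \<in> carrier V'" using lin_mapD(1)[OF f] wV x by auto
    moreover have "f y \<ominus>\<^bsub>V'\<^esub> f x = f w"
      using lin_mapD(2)[OF f wV x] calculation by (simp add: yw V'.M.ag_simps)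
    ultimately show ?thesis
      using coset_eq_iff[OF V' W', of "f y" "f x"] lin_mapD(1)[OF f] wV x by (simp add: yw)
  qed
  then have "quot_map V' W' f (W +>\<^bsub>V\<^esub> x) = (\<Union>y\<in>W +>\<^bsub>V\<^esub> x. W' +>\<^bsub>V'\<^esub> f x)"
    unfolding quot_map_def by (intro SUP_cong refl)
  then show ?thesis
    using S.a_rcos_self[OF x] by blast
qed

lemma smult_lin_map: "r \<in> carrier K \<Longrightarrow> (\<lambda>x. r \<odot>\<^bsub>V\<^esub> x) \<in> lin_map K V V"
  by (rule lin_mapI) (simp_all add: V.smult_r_distr V.smult_assoc1[symmetric] V.R.m_comm)

lemma coset_smult:
  assumes "r \<in> carrier K" "x \<in> carrier V"
  shows "quot_map V W (\<lambda>x. r \<odot>\<^bsub>V\<^esub> x) (W +>\<^bsub>V\<^esub> x) = W +>\<^bsub>V\<^esub> (r \<odot>\<^bsub>V\<^esub> x)"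
  using assms by (intro quot_map_coset[OF V W smult_lin_map]) auto

lemma quot_module: "module K (quot_space V W)"
proof (rule moduleI)
  show "cring K" by unfold_locales
  have zero: "W +>\<^bsub>V\<^esub> \<zero>\<^bsub>V\<^esub> = W" using coset_zero by auto
  note r = quot_carrier[simplified] coset_add coset_smult
  show "abelian_group (quot_space V W)"
  proof (rule abelian_groupI, goal_cases)
    case 1 then show ?case by (auto simp: r)
  next
    case 2 show ?case using zero by (auto simp: r)
  next
    case 3 then show ?case by (auto simp: r V.M.a_assoc)
  next
    case 4 then show ?case by (auto simp: r V.M.a_comm)
  next
    case (5 x)
    then obtain y where "y \<in> carrier V" "x = W +>\<^bsub>V\<^esub> y" by (auto simp: r)
    then show ?case using coset_add[of "\<zero>\<^bsub>V\<^esub>" y] zero by simp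
  next
    case (6 x)
    then obtain y where "y \<in> carrier V" "x = W +>\<^bsub>V\<^esub> y" by (auto simp: r)
    then show ?case
      using coset_add[of "\<ominus>\<^bsub>V\<^esub> y" y] zero
      by (intro bexI[of _ "W +>\<^bsub>V\<^esub> (\<ominus>\<^bsub>V\<^esub> y)"]) (simp_all add: coset_in V.M.l_neg)
  qed
qed (auto simp: quot_carrier[simplified] coset_add coset_smult
    V.smult_l_distr V.smult_r_distr V.smult_assoc1)

end

lemma quot_map_lin_map:
  assumes V: "module K V" and W: "submodule W K V"
    and V': "module K V'" and W': "submodule W' K V'"
    and f: "f \<in> lin_map K V V'" and fW: "f ` W \<subseteq> W'"
  shows "quot_map V' W' f \<in> lin_map K (quot_space V W) (quot_space V' W')"
  using lin_mapD[OF f]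
  by (intro lin_mapI)
    (auto simp: quot_carrier[OF V W, simplified] coset_in[OF V' W'] coset_add[OF V W] coset_add[OF V' W']
      coset_smult[OF V W] coset_smult[OF V' W'] quot_map_coset[OF V W V' W' f fW]
      module.smult_closed[OF V] abelian_monoid.a_closed[OF abelian_group.axioms(1)[OF module.axioms(2)[OF V]]])

text \<open>Negation is multiplication by the scalar -1, so closure under scalars provides
  it.\<close>

lemma (in module) submoduleI':
  assumes "W \<subseteq> carrier M" "\<zero>\<^bsub>M\<^esub> \<in> W"
    and "\<And>a b. a \<in> W \<Longrightarrow> b \<in> W \<Longrightarrow> a \<oplus>\<^bsub>M\<^esub> b \<in> W"
    and smult: "\<And>r a. r \<in> carrier R \<Longrightarrow> a \<in> W \<Longrightarrow> r \<odot>\<^bsub>M\<^esub> a \<in> W"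
  shows "submodule W R M"
proof (rule submoduleI)
  show "\<ominus>\<^bsub>M\<^esub> a \<in> W" if a: "a \<in> W" for a
  proof -
    have "(\<ominus> \<one>) \<odot>\<^bsub>M\<^esub> a = \<ominus>\<^bsub>M\<^esub> a" using a assms(1) by (auto simp: smult_l_minus)
    then show ?thesis using smult[of "\<ominus> \<one>" a] a by simp
  qed
qed (use assms in auto)

section \<open>Spaces of functions\<close>

lemma fun_space_simps [simp]:
  "carrier (fun_space S F W) = F"
  "\<zero>\<^bsub>fun_space S F W\<^esub> = (\<lambda>s\<in>S. \<zero>\<^bsub>W\<^esub>)"
  "f \<oplus>\<^bsub>fun_space S F W\<^esub> g = (\<lambda>s\<in>S. f s \<oplus>\<^bsub>W\<^esub> g s)"
  "r \<odot>\<^bsub>fun_space S F W\<^esub> f = (\<lambda>s\<in>S. r \<odot>\<^bsub>W\<^esub> f s)"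
  by (simp_all add: fun_space_def)

lemma fun_space_module:
  assumes W: "module K W" and F: "F \<subseteq> S \<rightarrow>\<^sub>E carrier W"
    and zero: "(\<lambda>s\<in>S. \<zero>\<^bsub>W\<^esub>) \<in> F"
    and add: "\<And>f g. f \<in> F \<Longrightarrow> g \<in> F \<Longrightarrow> (\<lambda>s\<in>S. f s \<oplus>\<^bsub>W\<^esub> g s) \<in> F"
    and smult: "\<And>r f. r \<in> carrier K \<Longrightarrow> f \<in> F \<Longrightarrow> (\<lambda>s\<in>S. r \<odot>\<^bsub>W\<^esub> f s) \<in> F"
  shows "module K (fun_space S F W)"
proof -
  interpret W: module K W by fact
  have F': "f s \<in> carrier W" "f \<in> extensional S" if "f \<in> F" "s \<in> S" for f s
    using that F by (auto simp: PiE_iff)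
  have ext: "f = g" if "f \<in> F" "g \<in> F" "\<And>s. s \<in> S \<Longrightarrow> f s = g s" for f g
    using that F by (intro extensionalityI[of f S g]) (auto simp: PiE_iff)
  show ?thesis
  proof (rule moduleI)
    show "cring K" by unfold_locales
    show "abelian_group (fun_space S F W)"
    proof (rule abelian_groupI)
      fix f assume f: "f \<in> carrier (fun_space S F W)"
      \<comment> \<open>The additive inverse is the multiple by -1, which lies in \<open>F\<close>
        by closure under scalars.\<close>
      define g where "g = (\<lambda>s\<in>S. (\<ominus>\<^bsub>K\<^esub> \<one>\<^bsub>K\<^esub>) \<odot>\<^bsub>W\<^esub> f s)"
      have g: "g \<in> F" using f smult by (simp add: g_def)
      have "(\<lambda>s\<in>S. g s \<oplus>\<^bsub>W\<^esub> f s) = (\<lambda>s\<in>S. \<zero>\<^bsub>W\<^esub>)"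
        using f by (intro restrict_ext) (simp add: g_def F' W.smult_l_minus W.M.l_neg)
      then show "\<exists>g\<in>carrier (fun_space S F W). g \<oplus>\<^bsub>fun_space S F W\<^esub> f = \<zero>\<^bsub>fun_space S F W\<^esub>"
        using g by auto
    next
      fix f assume f: "f \<in> carrier (fun_space S F W)"
      show "\<zero>\<^bsub>fun_space S F W\<^esub> \<oplus>\<^bsub>fun_space S F W\<^esub> f = f"
        using f add[OF zero, of f] by (intro ext) (simp_all only: fun_space_simps, simp_all add: F')
    qed (auto simp: add zero F' W.M.a_ac intro!: ext restrict_ext)
  qed (auto simp: add smult zero F' W.smult_l_distr W.smult_r_distr W.smult_assoc1 intro!: ext restrict_ext)
qed

lemma fun_space_minus:
  assumes W: "module K W" and V: "module K (fun_space S F W)" and F: "F \<subseteq> S \<rightarrow>\<^sub>E carrier W"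
    and f: "f \<in> F" and g: "g \<in> F"
  shows "f \<ominus>\<^bsub>fun_space S F W\<^esub> g = (\<lambda>s\<in>S. f s \<ominus>\<^bsub>W\<^esub> g s)"
proof -
  interpret W: module K W by fact
  interpret V: module K "fun_space S F W" by fact
  have *: "f s \<in> carrier W" "g s \<in> carrier W" if "s \<in> S" for s using that f g F by (auto simp: PiE_iff)
  have "\<ominus>\<^bsub>fun_space S F W\<^esub> g = (\<ominus>\<^bsub>K\<^esub> \<one>\<^bsub>K\<^esub>) \<odot>\<^bsub>fun_space S F W\<^esub> g"
    using V.smult_l_minus[of "\<one>\<^bsub>K\<^esub>" g] V.smult_one[of g] g by simp
  then show ?thesis
    using * by (auto simp: V.M.minus_eq W.M.minus_eq W.smult_l_minus intro!: restrict_ext)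
qed


section \<open>Right modules and bimodules\<close>

locale bimodule = right_module K A M
  for K :: "('k, 'r) ring_scheme" and A :: "('k, 'a, 's) module_scheme"
    and M :: "('k, 'm, 'a, 'z) bimod_scheme" (structure) +
  assumes lact_closed:
      "\<lbrakk>a \<in> carrier A; x \<in> carrier M\<rbrakk> \<Longrightarrow> a \<triangleright>\<^bsub>M\<^esub> x \<in> carrier M"
    and lact_add_right:
      "\<lbrakk>a \<in> carrier A; x \<in> carrier M; y \<in> carrier M\<rbrakk>
        \<Longrightarrow> a \<triangleright>\<^bsub>M\<^esub> (x \<oplus>\<^bsub>M\<^esub> y) = (a \<triangleright>\<^bsub>M\<^esub> x) \<oplus>\<^bsub>M\<^esub> (a \<triangleright>\<^bsub>M\<^esub> y)"
    and lact_add_left: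
      "\<lbrakk>a \<in> carrier A; b \<in> carrier A; x \<in> carrier M\<rbrakk>
        \<Longrightarrow> (a \<oplus>\<^bsub>A\<^esub> b) \<triangleright>\<^bsub>M\<^esub> x = (a \<triangleright>\<^bsub>M\<^esub> x) \<oplus>\<^bsub>M\<^esub> (b \<triangleright>\<^bsub>M\<^esub> x)"
    and lact_assoc:
      "\<lbrakk>a \<in> carrier A; b \<in> carrier A; x \<in> carrier M\<rbrakk>
        \<Longrightarrow> (a \<otimes>\<^bsub>A\<^esub> b) \<triangleright>\<^bsub>M\<^esub> x = a \<triangleright>\<^bsub>M\<^esub> (b \<triangleright>\<^bsub>M\<^esub> x)"
    and lact_one:
      "x \<in> carrier M \<Longrightarrow> \<one>\<^bsub>A\<^esub> \<triangleright>\<^bsub>M\<^esub> x = x"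
    and lact_smult_left:
      "\<lbrakk>r \<in> carrier K; a \<in> carrier A; x \<in> carrier M\<rbrakk>
        \<Longrightarrow> (r \<odot>\<^bsub>A\<^esub> a) \<triangleright>\<^bsub>M\<^esub> x = r \<odot>\<^bsub>M\<^esub> (a \<triangleright>\<^bsub>M\<^esub> x)"
    and lact_smult_right:
      "\<lbrakk>r \<in> carrier K; a \<in> carrier A; x \<in> carrier M\<rbrakk>
        \<Longrightarrow> a \<triangleright>\<^bsub>M\<^esub> (r \<odot>\<^bsub>M\<^esub> x) = r \<odot>\<^bsub>M\<^esub> (a \<triangleright>\<^bsub>M\<^esub> x)"
    and lact_ract:
      "\<lbrakk>a \<in> carrier A; x \<in> carrier M; b \<in> carrier A\<rbrakk>
        \<Longrightarrow> (a \<triangleright>\<^bsub>M\<^esub> x) \<triangleleft>\<^bsub>M\<^esub> b = a \<triangleright>\<^bsub>M\<^esub> (x \<triangleleft>\<^bsub>M\<^esub> b)"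

context right_module
begin

lemma ract_lin_map: "a \<in> carrier A \<Longrightarrow> (\<lambda>x. x \<triangleleft>\<^bsub>M\<^esub> a) \<in> lin_map K M M"
  by (rule lin_mapI) (simp_all add: ract_closed ract_add_left ract_smult_left)

lemma ract_lin_map_right: "x \<in> carrier M \<Longrightarrow> (\<lambda>a. x \<triangleleft>\<^bsub>M\<^esub> a) \<in> lin_map K A M"
  by (rule lin_mapI) (simp_all add: ract_closed ract_add_right ract_smult_right)

lemmas ract_group = lin_map_group[OF ract_lin_map M.module_axioms M.module_axioms]
  lin_map_group[OF ract_lin_map_right A.module_axioms M.module_axioms]

lemmas ract_simps = ract_closed ract_add_left ract_add_right ract_smult_left ract_smult_right ract_group

end

context bimodule
begin

lemma lact_lin_map: "a \<in> carrier A \<Longrightarrow> (\<lambda>x. a \<triangleright>\<^bsub>M\<^esub> x) \<in> lin_map K M M"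
  by (rule lin_mapI) (simp_all add: lact_closed lact_add_right lact_smult_right)

lemma lact_lin_map_left: "x \<in> carrier M \<Longrightarrow> (\<lambda>a. a \<triangleright>\<^bsub>M\<^esub> x) \<in> lin_map K A M"
  by (rule lin_mapI) (simp_all add: lact_closed lact_add_left lact_smult_left)

lemmas lact_group = lin_map_group[OF lact_lin_map M.module_axioms M.module_axioms]
  lin_map_group[OF lact_lin_map_left A.module_axioms M.module_axioms]

lemmas lact_simps = lact_closed lact_add_left lact_add_right lact_smult_left lact_smult_right lact_group

end

lemma reg_bimod_simps [simp]:
  "carrier (reg_bimod A) = carrier A"
  "\<zero>\<^bsub>reg_bimod A\<^esub> = \<zero>\<^bsub>A\<^esub>"
  "x \<oplus>\<^bsub>reg_bimod A\<^esub> y = x \<oplus>\<^bsub>A\<^esub> y"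
  "r \<odot>\<^bsub>reg_bimod A\<^esub> x = r \<odot>\<^bsub>A\<^esub> x"
  "x \<triangleleft>\<^bsub>reg_bimod A\<^esub> y = x \<otimes>\<^bsub>A\<^esub> y"
  "x \<triangleright>\<^bsub>reg_bimod A\<^esub> y = x \<otimes>\<^bsub>A\<^esub> y"
  by (simp_all add: reg_bimod_def)

text \<open>Negation is a description over carrier, addition and zero alone. Structures that share
  these, such as an algebra and its regular bimodule, therefore share it even when their record
  types differ.\<close>

lemma a_inv_cong:
  assumes "carrier G = carrier G'" "\<And>x y. x \<oplus>\<^bsub>G\<^esub> y = x \<oplus>\<^bsub>G'\<^esub> y" "\<zero>\<^bsub>G\<^esub> = \<zero>\<^bsub>G'\<^esub>"
  shows "\<ominus>\<^bsub>G\<^esub> x = \<ominus>\<^bsub>G'\<^esub> x" "x \<ominus>\<^bsub>G\<^esub> y = x \<ominus>\<^bsub>G'\<^esub> y"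
proof -
  show "\<ominus>\<^bsub>G\<^esub> x = \<ominus>\<^bsub>G'\<^esub> x" for x using assms by (simp add: a_inv_def m_inv_def)
  then show "x \<ominus>\<^bsub>G\<^esub> y = x \<ominus>\<^bsub>G'\<^esub> y" by (simp add: a_minus_def assms)
qed

lemma reg_bimod_minus [simp]:
  "\<ominus>\<^bsub>reg_bimod A\<^esub> x = \<ominus>\<^bsub>A\<^esub> x" "x \<ominus>\<^bsub>reg_bimod A\<^esub> y = x \<ominus>\<^bsub>A\<^esub> y"
  by (rule a_inv_cong; simp)+

lemma module_cong:
  assumes M: "module K M" and "carrier N = carrier M" "\<zero>\<^bsub>N\<^esub> = \<zero>\<^bsub>M\<^esub>"
    and "\<And>x y. x \<oplus>\<^bsub>N\<^esub> y = x \<oplus>\<^bsub>M\<^esub> y" "\<And>r x. r \<odot>\<^bsub>N\<^esub> x = r \<odot>\<^bsub>M\<^esub> x"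
  shows "module K N"
proof -
  interpret M: module K M by fact
  show ?thesis
  proof (rule moduleI)
    show "cring K" by unfold_locales
    show "abelian_group N"
      using M.M.l_neg by (intro abelian_groupI) (auto simp: assms M.M.a_ac)
  qed (auto simp: assms M.smult_l_distr M.smult_r_distr M.smult_assoc1)
qed

lemma (in k_algebra) bimodule_reg: "bimodule K A (reg_bimod A)"
proof -
  interpret R: module K "reg_bimod A" by (rule module_cong[OF module_axioms]) simp_all
  show ?thesis
    by unfold_locales
      (simp_all add: A.l_distr A.r_distr A.m_assoc smult_mult_left smult_mult_right)
qed

section \<open>First Hochschild cohomology\<close>

context bimodule
begin

abbreviation "Der \<equiv> derivations K A M"
abbreviation "DerS \<equiv> derivation_space K A M"

lemma derivationsI:
  assumes "\<delta> \<in> lin_map K A M" "\<delta> \<in> extensional (carrier A)"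
    and "\<And>a b. a \<in> carrier A \<Longrightarrow> b \<in> carrier A \<Longrightarrow>
      \<delta> (a \<otimes>\<^bsub>A\<^esub> b) = (a \<triangleright>\<^bsub>M\<^esub> \<delta> b) \<oplus>\<^bsub>M\<^esub> (\<delta> a \<triangleleft>\<^bsub>M\<^esub> b)"
  shows "\<delta> \<in> Der"
  using assms by (auto simp: derivations_def)

lemma derivationsD:
  assumes "\<delta> \<in> Der"
  shows "\<delta> \<in> lin_map K A M" "\<delta> \<in> extensional (carrier A)"
    and "a \<in> carrier A \<Longrightarrow> b \<in> carrier A \<Longrightarrow>
      \<delta> (a \<otimes>\<^bsub>A\<^esub> b) = (a \<triangleright>\<^bsub>M\<^esub> \<delta> b) \<oplus>\<^bsub>M\<^esub> (\<delta> a \<triangleleft>\<^bsub>M\<^esub> b)"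
  using assms by (auto simp: derivations_def)

lemma derivations_subset: "Der \<subseteq> carrier A \<rightarrow>\<^sub>E carrier M"
  by (auto simp: derivations_def lin_map_def PiE_iff extensional_def)

lemma derivation_space_module: "module K DerS"
  unfolding derivation_space_def
proof (rule fun_space_module[OF M.module_axioms derivations_subset])
  show "(\<lambda>a\<in>carrier A. \<zero>\<^bsub>M\<^esub>) \<in> Der"
    by (rule derivationsI) (auto intro!: lin_mapI simp: ract_simps lact_simps)
  show "(\<lambda>a\<in>carrier A. f a \<oplus>\<^bsub>M\<^esub> g a) \<in> Der" if f: "f \<in> Der" and g: "g \<in> Der" for f g
    by (rule derivationsI)
      (auto intro!: lin_mapI simp: ract_simps lact_simps lin_mapD[OF derivationsD(1)[OF f]]
        lin_mapD[OF derivationsD(1)[OF g]] derivationsD(3)[OF f] derivationsD(3)[OF g]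
        M.smult_r_distr M.M.a_ac)
  show "(\<lambda>a\<in>carrier A. r \<odot>\<^bsub>M\<^esub> f a) \<in> Der" if r: "r \<in> carrier K" and f: "f \<in> Der" for r f
    using r by (intro derivationsI)
      (auto intro!: lin_mapI simp: ract_simps lact_simps lin_mapD[OF derivationsD(1)[OF f]]
        derivationsD(3)[OF f] M.smult_r_distr M.smult_assoc1[symmetric] A.K.m_comm)
qed

lemma derivation_space_simps:
  "carrier DerS = Der"
  "\<zero>\<^bsub>DerS\<^esub> = (\<lambda>a\<in>carrier A. \<zero>\<^bsub>M\<^esub>)"
  "f \<oplus>\<^bsub>DerS\<^esub> g = (\<lambda>a\<in>carrier A. f a \<oplus>\<^bsub>M\<^esub> g a)"
  "r \<odot>\<^bsub>DerS\<^esub> f = (\<lambda>a\<in>carrier A. r \<odot>\<^bsub>M\<^esub> f a)"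
  by (simp_all add: derivation_space_def)

lemma derivation_space_minus:
  assumes "f \<in> Der" "g \<in> Der"
  shows "f \<ominus>\<^bsub>DerS\<^esub> g = (\<lambda>a\<in>carrier A. f a \<ominus>\<^bsub>M\<^esub> g a)"
  unfolding derivation_space_def
  by (rule fun_space_minus[OF M.module_axioms derivation_space_module[unfolded derivation_space_def]
        derivations_subset assms])

lemma derivations_closed:
  "f \<in> Der \<Longrightarrow> g \<in> Der \<Longrightarrow> (\<lambda>a\<in>carrier A. f a \<oplus>\<^bsub>M\<^esub> g a) \<in> Der"
  "f \<in> Der \<Longrightarrow> g \<in> Der \<Longrightarrow> (\<lambda>a\<in>carrier A. f a \<ominus>\<^bsub>M\<^esub> g a) \<in> Der"
proof -
  interpret D: module K DerS by (rule derivation_space_module)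
  show "f \<in> Der \<Longrightarrow> g \<in> Der \<Longrightarrow> (\<lambda>a\<in>carrier A. f a \<oplus>\<^bsub>M\<^esub> g a) \<in> Der"
    using D.M.a_closed[of f g] by (simp add: derivation_space_simps)
  show "f \<in> Der \<Longrightarrow> g \<in> Der \<Longrightarrow> (\<lambda>a\<in>carrier A. f a \<ominus>\<^bsub>M\<^esub> g a) \<in> Der"
    using D.M.minus_closed[of f g] by (simp add: derivation_space_simps derivation_space_minus)
qed

definition inner :: "'m \<Rightarrow> 'a \<Rightarrow> 'm" where
  "inner x = (\<lambda>a\<in>carrier A. (a \<triangleright>\<^bsub>M\<^esub> x) \<ominus>\<^bsub>M\<^esub> (x \<triangleleft>\<^bsub>M\<^esub> a))"

lemma inner_derivations_eq: "inner_derivations A M = inner ` carrier M"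
  by (auto simp: inner_derivations_def inner_def)

lemma inner_in_Der: "x \<in> carrier M \<Longrightarrow> inner x \<in> Der"
  unfolding inner_def
  by (rule derivationsI)
    (auto intro!: lin_mapI simp: ract_simps lact_simps M.M.ag_simps M.smult_r_distr M.smult_r_minus
      lact_assoc ract_assoc lact_ract)

lemma inner_submodule: "submodule (inner_derivations A M) K DerS"
proof -
  interpret D: module K DerS by (rule derivation_space_module)
  show ?thesis
    unfolding inner_derivations_eq
  proof (rule D.submoduleI', goal_cases)
    case 1 show ?case using inner_in_Der by (auto simp: derivation_space_simps)
  next
    case 2
    have "inner \<zero>\<^bsub>M\<^esub> = \<zero>\<^bsub>DerS\<^esub>"
      by (auto simp: inner_def derivation_space_simps ract_simps lact_simps M.M.ag_simps intro!: restrict_ext)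
    then show ?case by (metis M.M.zero_closed imageI)
  next
    case (3 a b)
    then obtain x y where x: "x \<in> carrier M" "a = inner x" and y: "y \<in> carrier M" "b = inner y" by auto
    have "a \<oplus>\<^bsub>DerS\<^esub> b = inner (x \<oplus>\<^bsub>M\<^esub> y)"
      using x y by (auto simp: inner_def derivation_space_simps ract_simps lact_simps M.M.ag_simps intro!: restrict_ext)
    then show ?case using x y by auto
  next
    case (4 r a)
    then obtain x where x: "x \<in> carrier M" "a = inner x" by auto
    have "r \<odot>\<^bsub>DerS\<^esub> a = inner (r \<odot>\<^bsub>M\<^esub> x)"
      using x 4 by (auto simp: inner_def derivation_space_simps ract_simps lact_simps M.M.minus_eq
          M.smult_r_distr M.smult_r_minus intro!: restrict_ext)
    then show ?case using x 4 by auto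
  qed
qed

lemma HH1_module: "module K (HH1 K A M)"
  unfolding HH1_def by (rule quot_module[OF derivation_space_module inner_submodule])

end


section \<open>Trivial extensions\<close>

lemma trivial_ext_simps [simp]:
  "carrier (trivial_ext C E) = carrier C \<times> carrier E"
  "x \<otimes>\<^bsub>trivial_ext C E\<^esub> y =
    (fst x \<otimes>\<^bsub>C\<^esub> fst y, (fst x \<triangleright>\<^bsub>E\<^esub> snd y) \<oplus>\<^bsub>E\<^esub> (snd x \<triangleleft>\<^bsub>E\<^esub> fst y))"
  "\<one>\<^bsub>trivial_ext C E\<^esub> = (\<one>\<^bsub>C\<^esub>, \<zero>\<^bsub>E\<^esub>)"
  "\<zero>\<^bsub>trivial_ext C E\<^esub> = (\<zero>\<^bsub>C\<^esub>, \<zero>\<^bsub>E\<^esub>)"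
  "x \<oplus>\<^bsub>trivial_ext C E\<^esub> y = (fst x \<oplus>\<^bsub>C\<^esub> fst y, snd x \<oplus>\<^bsub>E\<^esub> snd y)"
  "r \<odot>\<^bsub>trivial_ext C E\<^esub> x = (r \<odot>\<^bsub>C\<^esub> fst x, r \<odot>\<^bsub>E\<^esub> snd x)"
  by (simp_all add: trivial_ext_def case_prod_beta)

lemma restrict_bimod_simps [simp]:
  "carrier (restrict_bimod h M) = carrier M"
  "\<zero>\<^bsub>restrict_bimod h M\<^esub> = \<zero>\<^bsub>M\<^esub>"
  "x \<oplus>\<^bsub>restrict_bimod h M\<^esub> y = x \<oplus>\<^bsub>M\<^esub> y"
  "r \<odot>\<^bsub>restrict_bimod h M\<^esub> x = r \<odot>\<^bsub>M\<^esub> x"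
  "x \<triangleleft>\<^bsub>restrict_bimod h M\<^esub> b = x \<triangleleft>\<^bsub>M\<^esub> h b"
  "b \<triangleright>\<^bsub>restrict_bimod h M\<^esub> x = h b \<triangleright>\<^bsub>M\<^esub> x"
  by (simp_all add: restrict_bimod_def)

lemma restrict_bimod_minus [simp]:
  "\<ominus>\<^bsub>restrict_bimod h M\<^esub> x = \<ominus>\<^bsub>M\<^esub> x" "x \<ominus>\<^bsub>restrict_bimod h M\<^esub> y = x \<ominus>\<^bsub>M\<^esub> y"
  by (rule a_inv_cong; simp)+

context bimodule
begin

lemma trivial_ext_module: "module K (trivial_ext A M)"
proof (rule moduleI)
  show "cring K" by unfold_locales
  show "abelian_group (trivial_ext A M)"
  proof (rule abelian_groupI)
    fix x assume "x \<in> carrier (trivial_ext A M)"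
    then show "\<exists>y\<in>carrier (trivial_ext A M). y \<oplus>\<^bsub>trivial_ext A M\<^esub> x = \<zero>\<^bsub>trivial_ext A M\<^esub>"
      by (intro bexI[of _ "(\<ominus>\<^bsub>A\<^esub> fst x, \<ominus>\<^bsub>M\<^esub> snd x)"]) (auto simp: A.M.l_neg M.M.l_neg)
  qed (auto simp: A.M.a_ac M.M.a_ac)
qed (auto simp: A.smult_l_distr A.smult_r_distr M.smult_l_distr M.smult_r_distr
    A.smult_assoc1 M.smult_assoc1)

lemma trivial_ext_algebra: "k_algebra K (trivial_ext A M)"
proof -
  interpret T: module K "trivial_ext A M" by (rule trivial_ext_module)
  have "ring (trivial_ext A M)"
  proof (rule ringI)
    show "Group.monoid (trivial_ext A M)"
      by (rule monoidI)
        (auto simp: ract_simps lact_simps lact_one ract_one lact_assoc ract_assoc lact_ract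
          A.A.m_assoc M.M.a_ac)
  qed (auto simp: ract_simps lact_simps A.A.l_distr A.A.r_distr M.M.a_ac T.M.abelian_group_axioms)
  then interpret T: ring "trivial_ext A M" .
  show ?thesis
    by unfold_locales
      (auto simp: ract_simps lact_simps A.smult_mult_left A.smult_mult_right M.smult_r_distr)
qed

end

lemma bimodule_restrict_fst:
  assumes "bimodule K C (E :: ('k, 'e, 'c) bimod)"
  shows "bimodule K (trivial_ext C E) (restrict_bimod fst E)"
proof -
  interpret E: bimodule K C E by fact
  interpret B: k_algebra K "trivial_ext C E" by (rule E.trivial_ext_algebra)
  interpret R: module K "restrict_bimod fst E" by (rule module_cong[OF E.M.module_axioms]) simp_all
  show ?thesis
    by unfold_locales
      (auto simp: E.ract_simps E.lact_simps E.ract_assoc E.ract_one E.lact_assoc E.lact_one E.lact_ract)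
qed

section \<open>The exact sequence for a trivial extension\<close>

lemma (in abelian_group) diff_diff_cancel:
  "x \<in> carrier G \<Longrightarrow> y \<in> carrier G \<Longrightarrow> x \<ominus> (x \<ominus> y) = y"
  by (simp add: ag_simps)

lemma (in abelian_group) diff_eq_zero_iff:
  "x \<in> carrier G \<Longrightarrow> y \<in> carrier G \<Longrightarrow> x \<ominus> y = \<zero> \<longleftrightarrow> x = y"
  by (metis a_inv_closed minus_eq minus_equality minus_minus r_neg)

lemma short_exactI:
  assumes f: "f \<in> lin_map K L M" and L: "module K L" and M: "module K M"
    and ker: "\<And>x. x \<in> carrier L \<Longrightarrow> f x = \<zero>\<^bsub>M\<^esub> \<Longrightarrow> x = \<zero>\<^bsub>L\<^esub>"
    and ex1: "\<And>x. x \<in> carrier L \<Longrightarrow> g (f x) = \<zero>\<^bsub>N\<^esub>"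
    and ex2: "\<And>y. y \<in> carrier M \<Longrightarrow> g y = \<zero>\<^bsub>N\<^esub> \<Longrightarrow> \<exists>x\<in>carrier L. y = f x"
    and sur: "\<And>z. z \<in> carrier N \<Longrightarrow> \<exists>y\<in>carrier M. z = g y"
    and g: "g \<in> carrier M \<rightarrow> carrier N"
  shows "short_exact L M N f g"
proof -
  interpret L: module K L by fact
  interpret M: module K M by fact
  have "inj_on f (carrier L)"
  proof (rule inj_onI)
    fix x y assume xy: "x \<in> carrier L" "y \<in> carrier L" "f x = f y"
    then have "f (x \<ominus>\<^bsub>L\<^esub> y) = \<zero>\<^bsub>M\<^esub>"
      using lin_map_group(3)[OF f L M] lin_mapD(1)[OF f] by (simp add: M.M.minus_eq M.M.r_neg)
    then have "x \<ominus>\<^bsub>L\<^esub> y = \<zero>\<^bsub>L\<^esub>" using ker[of "x \<ominus>\<^bsub>L\<^esub> y"] xy by simp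
    then show "x = y" using xy by (simp add: L.M.diff_eq_zero_iff)
  qed
  then show ?thesis
    using lin_mapD(1)[OF f] ex1 ex2 sur g by (auto simp: short_exact_def image_iff)
qed

text \<open>Separates the computation with derivations from homological algebra. Each property of
  \<open>E\<close> serves one place of the sequence: \<open>central\<close> the injectivity of
  \<iota>, \<open>no_hom\<close> exactness in the middle, \<open>lift\<close> the surjectivity of
  \<phi>.\<close>

theorem trivial_ext_HH1_exact:
  fixes K :: "('k, 'r) ring_scheme" and C :: "('k, 'c, 's) module_scheme"
    and E :: "('k, 'e, 'c) bimod"
  defines "B \<equiv> trivial_ext C E" and "EB \<equiv> restrict_bimod fst E"
  assumes bim: "bimodule K C E"
    and central: "\<And>c e. \<lbrakk>c \<in> carrier C; \<forall>x\<in>carrier C. c \<otimes>\<^bsub>C\<^esub> x = x \<otimes>\<^bsub>C\<^esub> c; e \<in> carrier E\<rbrakk>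
      \<Longrightarrow> c \<triangleright>\<^bsub>E\<^esub> e = e \<triangleleft>\<^bsub>E\<^esub> c"
    and no_hom: "\<And>f e. \<lbrakk>f \<in> lin_map K E C;
        \<forall>c\<in>carrier C. \<forall>e\<in>carrier E. f (c \<triangleright>\<^bsub>E\<^esub> e) = c \<otimes>\<^bsub>C\<^esub> f e; e \<in> carrier E\<rbrakk> \<Longrightarrow> f e = \<zero>\<^bsub>C\<^esub>"
    and lift: "\<And>d. d \<in> derivations K C (reg_bimod C) \<Longrightarrow> \<exists>D\<in>lin_map K E E.
      \<forall>c\<in>carrier C. \<forall>e\<in>carrier E. D (c \<triangleright>\<^bsub>E\<^esub> e) = (c \<triangleright>\<^bsub>E\<^esub> D e) \<oplus>\<^bsub>E\<^esub> (d c \<triangleright>\<^bsub>E\<^esub> e) \<and>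
         D (e \<triangleleft>\<^bsub>E\<^esub> c) = (D e \<triangleleft>\<^bsub>E\<^esub> c) \<oplus>\<^bsub>E\<^esub> (e \<triangleleft>\<^bsub>E\<^esub> d c)"
  shows "module K (HH1 K B EB) \<and> module K (HH1 K B (reg_bimod B)) \<and> module K (HH1 K C (reg_bimod C)) \<and>
    (\<exists>\<iota> \<in> lin_map K (HH1 K B EB) (HH1 K B (reg_bimod B)).
     \<exists>\<phi> \<in> lin_map K (HH1 K B (reg_bimod B)) (HH1 K C (reg_bimod C)).
       (\<forall>\<delta> \<in> derivations K B EB.
          compose (carrier B) (\<lambda>e. (\<zero>\<^bsub>C\<^esub>, e)) \<delta> \<in> derivations K B (reg_bimod B) \<and>
          \<iota> (HH1_class K B EB \<delta>) =
            HH1_class K B (reg_bimod B) (compose (carrier B) (\<lambda>e. (\<zero>\<^bsub>C\<^esub>, e)) \<delta>)) \<and>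
       (\<forall>\<delta> \<in> derivations K B (reg_bimod B).
          (\<lambda>c\<in>carrier C. fst (\<delta> (c, \<zero>\<^bsub>E\<^esub>))) \<in> derivations K C (reg_bimod C) \<and>
          \<phi> (HH1_class K B (reg_bimod B) \<delta>) =
            HH1_class K C (reg_bimod C) (\<lambda>c\<in>carrier C. fst (\<delta> (c, \<zero>\<^bsub>E\<^esub>)))) \<and>
       short_exact (HH1 K B EB) (HH1 K B (reg_bimod B)) (HH1 K C (reg_bimod C)) \<iota> \<phi>)"
proof -
  interpret E: bimodule K C E by fact
  interpret B: k_algebra K B unfolding B_def by (rule E.trivial_ext_algebra)
  interpret EB: bimodule K B EB unfolding B_def EB_def by (rule bimodule_restrict_fst[OF bim])
  interpret BB: bimodule K B "reg_bimod B" by (rule B.bimodule_reg)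
  interpret CC: bimodule K C "reg_bimod C" by (rule E.A.bimodule_reg)
  let ?i = "\<lambda>\<delta> :: 'c \<times> 'e \<Rightarrow> 'e. compose (carrier B) (\<lambda>e. (\<zero>\<^bsub>C\<^esub>, e)) \<delta>"
  let ?p = "\<lambda>\<delta> :: 'c \<times> 'e \<Rightarrow> 'c \<times> 'e. (\<lambda>c\<in>carrier C. fst (\<delta> (c, \<zero>\<^bsub>E\<^esub>)))"
  note Bs [simp] = trivial_ext_simps[of C E, folded B_def]
  note EBs [simp] = restrict_bimod_simps[where h = "fst :: 'c \<times> 'e \<Rightarrow> 'c" and M = E, folded EB_def]
    restrict_bimod_minus[where h = "fst :: 'c \<times> 'e \<Rightarrow> 'c" and M = E, folded EB_def]
  note Es [simp] = E.ract_simps E.lact_simps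
  have Bminus [simp]: "x \<ominus>\<^bsub>B\<^esub> y = (fst x \<ominus>\<^bsub>C\<^esub> fst y, snd x \<ominus>\<^bsub>E\<^esub> snd y)"
    if "x \<in> carrier B" "y \<in> carrier B" for x y
  proof -
    have "\<ominus>\<^bsub>B\<^esub> y = (\<ominus>\<^bsub>C\<^esub> fst y, \<ominus>\<^bsub>E\<^esub> snd y)"
      using that by (intro B.M.minus_equality) (auto simp: E.A.M.l_neg E.M.M.l_neg)
    then show ?thesis using that by (simp add: B.M.minus_eq E.A.M.minus_eq E.M.M.minus_eq)
  qed
  have i_Der: "?i \<delta> \<in> BB.Der" if \<delta>: "\<delta> \<in> EB.Der" for \<delta>
    using lin_mapD[OF EB.derivationsD(1)[OF \<delta>]] EB.derivationsD(3)[OF \<delta>]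
    by (intro BB.derivationsI) (auto intro!: lin_mapI simp: compose_def)
  have i_lin: "?i \<in> lin_map K EB.DerS BB.DerS"
    using i_Der EB.derivation_space_module
    by (intro lin_mapI)
      (auto simp: EB.derivation_space_simps BB.derivation_space_simps compose_def fun_eq_iff)
  have i_inner: "?i ` inner_derivations B EB \<subseteq> inner_derivations B (reg_bimod B)"
  proof -
    have "?i (EB.inner e) = BB.inner (\<zero>\<^bsub>C\<^esub>, e)" if "e \<in> carrier E" for e
      using that by (auto simp: EB.inner_def BB.inner_def compose_def fun_eq_iff E.A.M.ag_simps)
    then show ?thesis by (auto simp: EB.inner_derivations_eq BB.inner_derivations_eq)
  qed
  have p_Der: "?p \<delta> \<in> CC.Der" if \<delta>: "\<delta> \<in> BB.Der" for \<delta>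
  proof -
    note l = lin_mapD[OF BB.derivationsD(1)[OF \<delta>], simplified] and m = BB.derivationsD(3)[OF \<delta>, simplified]
    show ?thesis
    proof (rule CC.derivationsI)
      show "?p \<delta> \<in> lin_map K C (reg_bimod C)"
      proof (rule lin_mapI)
        fix a b assume "a \<in> carrier C" "b \<in> carrier C"
        then show "?p \<delta> (a \<oplus>\<^bsub>C\<^esub> b) = ?p \<delta> a \<oplus>\<^bsub>reg_bimod C\<^esub> ?p \<delta> b"
          using l(2)[of "(a, \<zero>\<^bsub>E\<^esub>)" "(b, \<zero>\<^bsub>E\<^esub>)"] by simp
      next
        fix r a assume "r \<in> carrier K" "a \<in> carrier C"
        then show "?p \<delta> (r \<odot>\<^bsub>C\<^esub> a) = r \<odot>\<^bsub>reg_bimod C\<^esub> ?p \<delta> a"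
          using l(3)[of r "(a, \<zero>\<^bsub>E\<^esub>)"] by simp
      qed (use l(1) in \<open>auto simp: mem_Times_iff\<close>)
      fix a b assume "a \<in> carrier C" "b \<in> carrier C"
      then show "?p \<delta> (a \<otimes>\<^bsub>C\<^esub> b) =
          (a \<triangleright>\<^bsub>reg_bimod C\<^esub> ?p \<delta> b) \<oplus>\<^bsub>reg_bimod C\<^esub> (?p \<delta> a \<triangleleft>\<^bsub>reg_bimod C\<^esub> b)"
        using m[of "(a, \<zero>\<^bsub>E\<^esub>)" "(b, \<zero>\<^bsub>E\<^esub>)"] by simp
    qed simp
  qed
  have p_lin: "?p \<in> lin_map K BB.DerS CC.DerS"
    using p_Der
    by (intro lin_mapI)
      (auto simp: CC.derivation_space_simps BB.derivation_space_simps fun_eq_iff)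
  have p_inner: "?p ` inner_derivations B (reg_bimod B) \<subseteq> inner_derivations C (reg_bimod C)"
  proof -
    have "?p (BB.inner (c, e)) = CC.inner c" if "c \<in> carrier C" "e \<in> carrier E" for c e
      using that by (auto simp: CC.inner_def BB.inner_def fun_eq_iff)
    then show ?thesis by (auto simp: CC.inner_derivations_eq BB.inner_derivations_eq)
  qed
  define \<iota> where "\<iota> = quot_map BB.DerS (inner_derivations B (reg_bimod B)) ?i"
  define \<phi> where "\<phi> = quot_map CC.DerS (inner_derivations C (reg_bimod C)) ?p"
  note EBq = EB.derivation_space_module EB.inner_submodule
  note BBq = BB.derivation_space_module BB.inner_submodule
  note CCq = CC.derivation_space_module CC.inner_submodule
  have \<iota>_lin: "\<iota> \<in> lin_map K (HH1 K B EB) (HH1 K B (reg_bimod B))"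
    unfolding HH1_def \<iota>_def by (rule quot_map_lin_map[OF EBq BBq i_lin i_inner])
  have \<phi>_lin: "\<phi> \<in> lin_map K (HH1 K B (reg_bimod B)) (HH1 K C (reg_bimod C))"
    unfolding HH1_def \<phi>_def by (rule quot_map_lin_map[OF BBq CCq p_lin p_inner])
  have \<iota>: "\<iota> (HH1_class K B EB \<delta>) = HH1_class K B (reg_bimod B) (?i \<delta>)" if "\<delta> \<in> EB.Der" for \<delta>
    unfolding HH1_class_def \<iota>_def using that
    by (intro quot_map_coset[OF EBq BBq i_lin i_inner]) (simp add: EB.derivation_space_simps)
  have \<phi>: "\<phi> (HH1_class K B (reg_bimod B) \<delta>) = HH1_class K C (reg_bimod C) (?p \<delta>)" if "\<delta> \<in> BB.Der" for \<delta>
    unfolding HH1_class_def \<phi>_def using that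
    by (intro quot_map_coset[OF BBq CCq p_lin p_inner]) (simp add: BB.derivation_space_simps)
  have EBc: "x \<in> carrier (HH1 K B EB) \<longleftrightarrow> (\<exists>\<delta>\<in>EB.Der. x = HH1_class K B EB \<delta>)" for x
    unfolding HH1_def HH1_class_def quot_carrier[OF EBq] by (auto simp: EB.derivation_space_simps)
  have BBc: "x \<in> carrier (HH1 K B (reg_bimod B)) \<longleftrightarrow> (\<exists>\<delta>\<in>BB.Der. x = HH1_class K B (reg_bimod B) \<delta>)" for x
    unfolding HH1_def HH1_class_def quot_carrier[OF BBq] by (auto simp: BB.derivation_space_simps)
  have CCc: "x \<in> carrier (HH1 K C (reg_bimod C)) \<longleftrightarrow> (\<exists>\<delta>\<in>CC.Der. x = HH1_class K C (reg_bimod C) \<delta>)" for x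
    unfolding HH1_def HH1_class_def quot_carrier[OF CCq] by (auto simp: CC.derivation_space_simps)
  have EB0: "HH1_class K B EB \<delta> = \<zero>\<^bsub>HH1 K B EB\<^esub> \<longleftrightarrow> \<delta> \<in> inner_derivations B EB" if "\<delta> \<in> EB.Der" for \<delta>
    using coset_zero[OF EBq, of \<delta>] that by (simp add: HH1_def HH1_class_def EB.derivation_space_simps)
  have BB0: "HH1_class K B (reg_bimod B) \<delta> = \<zero>\<^bsub>HH1 K B (reg_bimod B)\<^esub> \<longleftrightarrow> \<delta> \<in> inner_derivations B (reg_bimod B)"
    if "\<delta> \<in> BB.Der" for \<delta>
    using coset_zero[OF BBq, of \<delta>] that by (simp add: HH1_def HH1_class_def BB.derivation_space_simps)
  have CC0: "HH1_class K C (reg_bimod C) \<delta> = \<zero>\<^bsub>HH1 K C (reg_bimod C)\<^esub> \<longleftrightarrow> \<delta> \<in> inner_derivations C (reg_bimod C)"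
    if "\<delta> \<in> CC.Der" for \<delta>
    using coset_zero[OF CCq, of \<delta>] that by (simp add: HH1_def HH1_class_def CC.derivation_space_simps)
  have "short_exact (HH1 K B EB) (HH1 K B (reg_bimod B)) (HH1 K C (reg_bimod C)) \<iota> \<phi>"
  proof (rule short_exactI[OF \<iota>_lin EB.HH1_module BB.HH1_module])
    fix x assume "x \<in> carrier (HH1 K B EB)" and 0: "\<iota> x = \<zero>\<^bsub>HH1 K B (reg_bimod B)\<^esub>"
    then obtain \<delta> where \<delta>: "\<delta> \<in> EB.Der" and x: "x = HH1_class K B EB \<delta>" by (auto simp: EBc)
    have "?i \<delta> \<in> inner_derivations B (reg_bimod B)" using BB0 i_Der[OF \<delta>] 0 \<iota>[OF \<delta>] x by simp
    then obtain c e where c: "c \<in> carrier C" and e: "e \<in> carrier E" and i: "?i \<delta> = BB.inner (c, e)"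
      by (auto simp: BB.inner_derivations_eq)
    \<comment> \<open>The first component says that \<open>c\<close> is central in \<open>C\<close>;
      the second expresses \<delta> through \<open>c\<close> and \<open>e\<close>.\<close>
    have i: "(\<zero>\<^bsub>C\<^esub>, \<delta> (x, y)) = (x \<otimes>\<^bsub>C\<^esub> c \<ominus>\<^bsub>C\<^esub> c \<otimes>\<^bsub>C\<^esub> x,
        (x \<triangleright>\<^bsub>E\<^esub> e \<oplus>\<^bsub>E\<^esub> y \<triangleleft>\<^bsub>E\<^esub> c) \<ominus>\<^bsub>E\<^esub> (c \<triangleright>\<^bsub>E\<^esub> y \<oplus>\<^bsub>E\<^esub> e \<triangleleft>\<^bsub>E\<^esub> x))"
      if "x \<in> carrier C" "y \<in> carrier E" for x y
      using fun_cong[OF i, of "(x, y)"] that c e by (simp add: compose_def BB.inner_def)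
    have cc: "c \<otimes>\<^bsub>C\<^esub> x = x \<otimes>\<^bsub>C\<^esub> c" if "x \<in> carrier C" for x
      using i[OF that E.M.M.zero_closed] that c E.A.M.diff_eq_zero_iff[of "x \<otimes>\<^bsub>C\<^esub> c" "c \<otimes>\<^bsub>C\<^esub> x"]
      by simp
    \<comment> \<open>The two terms containing \<open>c\<close> cancel, which leaves the inner
      derivation of \<open>e\<close>.\<close>
    have "\<delta> (x, y) = x \<triangleright>\<^bsub>E\<^esub> e \<ominus>\<^bsub>E\<^esub> e \<triangleleft>\<^bsub>E\<^esub> x" if "x \<in> carrier C" "y \<in> carrier E" for x y
    proof -
      have "c \<triangleright>\<^bsub>E\<^esub> y = y \<triangleleft>\<^bsub>E\<^esub> c" using c cc that by (intro central) auto
      then show ?thesis using i[OF that] that c e by (simp add: E.M.M.ag_simps)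
    qed
    then have "\<delta> = EB.inner e"
      using EB.derivationsD(2)[OF \<delta>] by (intro extensionalityI[of _ "carrier B"]) (auto simp: EB.inner_def)
    then show "x = \<zero>\<^bsub>HH1 K B EB\<^esub>"
      using EB0[OF \<delta>] x e by (simp add: EB.inner_derivations_eq)
  next
    fix x assume "x \<in> carrier (HH1 K B EB)"
    then obtain \<delta> where \<delta>: "\<delta> \<in> EB.Der" and x: "x = HH1_class K B EB \<delta>" by (auto simp: EBc)
    \<comment> \<open>The composite is the zero derivation, written as an inner one so that its
      class is seen to be zero.\<close>
    have "?p (?i \<delta>) = CC.inner \<zero>\<^bsub>C\<^esub>"
      by (auto simp: compose_def CC.inner_def fun_eq_iff E.A.M.ag_simps)
    then show "\<phi> (\<iota> x) = \<zero>\<^bsub>HH1 K C (reg_bimod C)\<^esub>"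
      using \<phi>[OF i_Der[OF \<delta>]] \<iota>[OF \<delta>] x CC0[OF p_Der[OF i_Der[OF \<delta>]]]
      by (auto simp: CC.inner_derivations_eq)
  next
    fix y assume "y \<in> carrier (HH1 K B (reg_bimod B))" and 0: "\<phi> y = \<zero>\<^bsub>HH1 K C (reg_bimod C)\<^esub>"
    then obtain \<delta> where \<delta>: "\<delta> \<in> BB.Der" and y: "y = HH1_class K B (reg_bimod B) \<delta>" by (auto simp: BBc)
    have "?p \<delta> \<in> inner_derivations C (reg_bimod C)" using CC0 p_Der[OF \<delta>] 0 \<phi>[OF \<delta>] y by simp
    then obtain c where c: "c \<in> carrier C" and pi: "?p \<delta> = CC.inner c"
      by (auto simp: CC.inner_derivations_eq)
    let ?c = "(c, \<zero>\<^bsub>E\<^esub>)"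
    have cB: "?c \<in> carrier (reg_bimod B)" using c by simp
    \<comment> \<open>Subtracting the inner derivation of \<open>(c, 0)\<close> keeps the class and
      makes the \<open>C\<close>-component vanish on \<open>C\<close>.\<close>
    define \<delta>' where "\<delta>' = (\<lambda>b\<in>carrier B. \<delta> b \<ominus>\<^bsub>reg_bimod B\<^esub> BB.inner ?c b)"
    have \<delta>': "\<delta>' \<in> BB.Der"
      unfolding \<delta>'_def by (rule BB.derivations_closed(2)[OF \<delta> BB.inner_in_Der[OF cB]])
    note \<delta>B = lin_mapD(1)[OF BB.derivationsD(1)[OF \<delta>], simplified]
    note \<delta>'l = lin_mapD[OF BB.derivationsD(1)[OF \<delta>'], simplified]
    note \<delta>'m = BB.derivationsD(3)[OF \<delta>', simplified]
    have z1: "fst (\<delta>' (a, \<zero>\<^bsub>E\<^esub>)) = \<zero>\<^bsub>C\<^esub>" if "a \<in> carrier C" for a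
      using fun_cong[OF pi, of a] that c \<delta>B[of "(a, \<zero>\<^bsub>E\<^esub>)"]
      by (simp add: \<delta>'_def CC.inner_def BB.inner_def mem_Times_iff E.A.M.r_neg E.A.M.minus_eq)
    \<comment> \<open>What is left of the \<open>C\<close>-component lives on \<open>E\<close>. It
      is left linear by the Leibniz rule for the product of \<open>(c, 0)\<close> and
      \<open>(0, e)\<close>: the term with \<delta>' \<open>(c, 0)\<close> has
      \<open>C\<close>-component zero since that of \<open>(0, e)\<close> is zero.\<close>
    define f where "f e = fst (\<delta>' (\<zero>\<^bsub>C\<^esub>, e))" for e
    have "f e = \<zero>\<^bsub>C\<^esub>" if "e \<in> carrier E" for e
    proof (rule no_hom[of f])
      show "f \<in> lin_map K E C"
      proof (rule lin_mapI)
        fix x y assume "x \<in> carrier E" "y \<in> carrier E"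
        then show "f (x \<oplus>\<^bsub>E\<^esub> y) = f x \<oplus>\<^bsub>C\<^esub> f y"
          using \<delta>'l(2)[of "(\<zero>\<^bsub>C\<^esub>, x)" "(\<zero>\<^bsub>C\<^esub>, y)"] by (simp add: f_def)
      next
        fix r x assume "r \<in> carrier K" "x \<in> carrier E"
        then show "f (r \<odot>\<^bsub>E\<^esub> x) = r \<odot>\<^bsub>C\<^esub> f x"
          using \<delta>'l(3)[of r "(\<zero>\<^bsub>C\<^esub>, x)"] by (simp add: f_def)
      qed (use \<delta>'l(1) in \<open>auto simp: f_def mem_Times_iff\<close>)
      show "\<forall>c\<in>carrier C. \<forall>e\<in>carrier E. f (c \<triangleright>\<^bsub>E\<^esub> e) = c \<otimes>\<^bsub>C\<^esub> f e"
      proof (intro ballI)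
        fix c e assume "c \<in> carrier C" "e \<in> carrier E"
        then show "f (c \<triangleright>\<^bsub>E\<^esub> e) = c \<otimes>\<^bsub>C\<^esub> f e"
          using \<delta>'m[of "(c, \<zero>\<^bsub>E\<^esub>)" "(\<zero>\<^bsub>C\<^esub>, e)"] \<delta>'l(1)[of "(\<zero>\<^bsub>C\<^esub>, e)"] \<delta>'l(1)[of "(c, \<zero>\<^bsub>E\<^esub>)"]
          by (simp add: f_def mem_Times_iff)
      qed
    qed fact
    then have z2: "fst (\<delta>' b) = \<zero>\<^bsub>C\<^esub>" if "b \<in> carrier B" for b
      using \<delta>'l(2)[of "(fst b, \<zero>\<^bsub>E\<^esub>)" "(\<zero>\<^bsub>C\<^esub>, snd b)"] z1[of "fst b"] that
      by (simp add: f_def mem_Times_iff)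
    define \<delta>'' where "\<delta>'' = (\<lambda>b\<in>carrier B. snd (\<delta>' b))"
    have \<delta>'': "\<delta>'' \<in> EB.Der"
      using \<delta>'l \<delta>'m z2
      by (intro EB.derivationsI) (auto intro!: lin_mapI simp: \<delta>''_def mem_Times_iff)
    have "?i \<delta>'' = \<delta>'"
      using BB.derivationsD(2)[OF \<delta>'] z2
      by (intro extensionalityI[of _ "carrier B"]) (auto simp: \<delta>''_def compose_def prod_eq_iff)
    moreover have "HH1_class K B (reg_bimod B) \<delta> = HH1_class K B (reg_bimod B) \<delta>'"
    proof -
      have "\<delta> \<ominus>\<^bsub>BB.DerS\<^esub> \<delta>' = BB.inner ?c"
        unfolding BB.derivation_space_minus[OF \<delta> \<delta>']
      proof (rule extensionalityI[of _ "carrier B"])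
        fix b assume b: "b \<in> carrier B"
        have "\<delta> b \<in> carrier (reg_bimod B)" "BB.inner ?c b \<in> carrier (reg_bimod B)"
          using b lin_mapD(1)[OF BB.derivationsD(1)[OF \<delta>]] lin_mapD(1)[OF BB.derivationsD(1)[OF BB.inner_in_Der[OF cB]]]
          by blast+
        then show "(\<lambda>a\<in>carrier B. \<delta> a \<ominus>\<^bsub>reg_bimod B\<^esub> \<delta>' a) b = BB.inner ?c b"
          unfolding \<delta>'_def restrict_apply'[OF b] by (rule BB.M.M.diff_diff_cancel)
      qed (simp_all add: BB.inner_def)
      then show ?thesis
        unfolding HH1_class_def using \<delta> \<delta>' cB
        by (subst coset_eq_iff[OF BBq]) (auto simp: BB.derivation_space_simps BB.inner_derivations_eq)
    qed
    ultimately show "\<exists>x\<in>carrier (HH1 K B EB). y = \<iota> x"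
      using \<iota>[OF \<delta>''] \<delta>'' y by (intro bexI[of _ "HH1_class K B EB \<delta>''"]) (auto simp: EBc)
  next
    fix z assume "z \<in> carrier (HH1 K C (reg_bimod C))"
    then obtain d where d: "d \<in> CC.Der" and z: "z = HH1_class K C (reg_bimod C) d" by (auto simp: CCc)
    obtain D where D: "D \<in> lin_map K E E" and
      D1: "\<And>c e. c \<in> carrier C \<Longrightarrow> e \<in> carrier E \<Longrightarrow> D (c \<triangleright>\<^bsub>E\<^esub> e) = (c \<triangleright>\<^bsub>E\<^esub> D e) \<oplus>\<^bsub>E\<^esub> (d c \<triangleright>\<^bsub>E\<^esub> e)" and
      D2: "\<And>c e. c \<in> carrier C \<Longrightarrow> e \<in> carrier E \<Longrightarrow> D (e \<triangleleft>\<^bsub>E\<^esub> c) = (D e \<triangleleft>\<^bsub>E\<^esub> c) \<oplus>\<^bsub>E\<^esub> (e \<triangleleft>\<^bsub>E\<^esub> d c)"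
      using lift[OF d] by blast
    \<comment> \<open>The two rules for \<open>D\<close> are what the \<open>E\<close>-component of
      the Leibniz rule asks for on the two terms of a product in \<open>B\<close>.\<close>
    define \<delta> where "\<delta> = (\<lambda>b\<in>carrier B. (d (fst b), D (snd b)))"
    note dl = lin_mapD[OF CC.derivationsD(1)[OF d], simplified] and Dl = lin_mapD[OF D]
    have \<delta>: "\<delta> \<in> BB.Der"
      using dl Dl D1 D2 CC.derivationsD(3)[OF d]
      by (intro BB.derivationsI) (auto intro!: lin_mapI simp: \<delta>_def mem_Times_iff E.M.M.a_ac)
    have "?p \<delta> = d"
      using CC.derivationsD(2)[OF d]
      by (intro extensionalityI[of _ "carrier C"]) (auto simp: \<delta>_def)
    then show "\<exists>y\<in>carrier (HH1 K B (reg_bimod B)). z = \<phi> y"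
      using \<phi>[OF \<delta>] \<delta> z by (intro bexI[of _ "HH1_class K B (reg_bimod B) \<delta>"]) (auto simp: BBc)
  next
    show "\<phi> \<in> carrier (HH1 K B (reg_bimod B)) \<rightarrow> carrier (HH1 K C (reg_bimod C))"
      using lin_mapD(1)[OF \<phi>_lin] by auto
  qed
  then show ?thesis
    by (intro conjI ballI bexI[of _ \<iota>] bexI[of _ \<phi>] EB.HH1_module BB.HH1_module CC.HH1_module
        \<iota>_lin \<phi>_lin i_Der p_Der \<iota> \<phi>)
qed

section \<open>Finitely generated projective modules\<close>

text \<open>\<open>rmod_hom\<close> without extensionality, so that composites and sums written as
  plain \<lambda>-terms stay inside; \<open>rlin_restrict\<close> leads back.\<close>

definition rlin :: "('k, 'r) ring_scheme \<Rightarrow> ('k, 'a, 's) module_scheme \<Rightarrow>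
    ('k, 'm, 'a, 'y) rmod_scheme \<Rightarrow> ('k, 'n, 'a, 'z) rmod_scheme \<Rightarrow> ('m \<Rightarrow> 'n) set" where
  "rlin K A M N = {f \<in> lin_map K M N. \<forall>x\<in>carrier M. \<forall>a\<in>carrier A. f (x \<triangleleft>\<^bsub>M\<^esub> a) = f x \<triangleleft>\<^bsub>N\<^esub> a}"

lemma rmod_hom_eq_rlin: "rmod_hom K A M N = rlin K A M N \<inter> extensional (carrier M)"
  by (auto simp: rmod_hom_def rlin_def)

lemma rlinD:
  assumes "f \<in> rlin K A M N"
  shows "f \<in> lin_map K M N"
    and "x \<in> carrier M \<Longrightarrow> f x \<in> carrier N"
    and "x \<in> carrier M \<Longrightarrow> y \<in> carrier M \<Longrightarrow> f (x \<oplus>\<^bsub>M\<^esub> y) = f x \<oplus>\<^bsub>N\<^esub> f y"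
    and "r \<in> carrier K \<Longrightarrow> x \<in> carrier M \<Longrightarrow> f (r \<odot>\<^bsub>M\<^esub> x) = r \<odot>\<^bsub>N\<^esub> f x"
    and "x \<in> carrier M \<Longrightarrow> a \<in> carrier A \<Longrightarrow> f (x \<triangleleft>\<^bsub>M\<^esub> a) = f x \<triangleleft>\<^bsub>N\<^esub> a"
  using assms by (auto simp: rlin_def lin_map_def)

lemma rlin_regD:
  assumes "f \<in> rlin K A M (reg_bimod A)"
  shows "x \<in> carrier M \<Longrightarrow> f x \<in> carrier A"
    and "x \<in> carrier M \<Longrightarrow> y \<in> carrier M \<Longrightarrow> f (x \<oplus>\<^bsub>M\<^esub> y) = f x \<oplus>\<^bsub>A\<^esub> f y"
    and "r \<in> carrier K \<Longrightarrow> x \<in> carrier M \<Longrightarrow> f (r \<odot>\<^bsub>M\<^esub> x) = r \<odot>\<^bsub>A\<^esub> f x"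
    and "x \<in> carrier M \<Longrightarrow> a \<in> carrier A \<Longrightarrow> f (x \<triangleleft>\<^bsub>M\<^esub> a) = f x \<otimes>\<^bsub>A\<^esub> a"
  using rlinD[OF assms] by simp_all

lemma (in right_module) smult_eq_ract:
  "r \<in> carrier K \<Longrightarrow> x \<in> carrier M \<Longrightarrow> r \<odot>\<^bsub>M\<^esub> x = x \<triangleleft>\<^bsub>M\<^esub> (r \<odot>\<^bsub>A\<^esub> \<one>\<^bsub>A\<^esub>)"
  by (simp add: ract_smult_right ract_one)

text \<open>A scalar \<open>r\<close> acts as right multiplication by \<open>r\<close> times the
  unit, so linearity over \<open>K\<close> follows from compatibility with \<open>A\<close>. For the
  same reason \<open>rsubmod\<close> need not mention scalars.\<close>

lemma rlinI:
  assumes M: "right_module K A M" and N: "right_module K A N"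
    and car: "\<And>x. x \<in> carrier M \<Longrightarrow> f x \<in> carrier N"
    and add: "\<And>x y. x \<in> carrier M \<Longrightarrow> y \<in> carrier M \<Longrightarrow> f (x \<oplus>\<^bsub>M\<^esub> y) = f x \<oplus>\<^bsub>N\<^esub> f y"
    and act: "\<And>x a. x \<in> carrier M \<Longrightarrow> a \<in> carrier A \<Longrightarrow> f (x \<triangleleft>\<^bsub>M\<^esub> a) = f x \<triangleleft>\<^bsub>N\<^esub> a"
  shows "f \<in> rlin K A M N"
proof -
  interpret M: right_module K A M by fact
  interpret N: right_module K A N by fact
  show ?thesis
    by (auto simp: rlin_def car add act M.smult_eq_ract N.smult_eq_ract intro!: lin_mapI)
qed

lemma rlin_group:
  assumes f: "f \<in> rlin K A M N" and M: "right_module K A M" and N: "right_module K A N"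
  shows "f \<zero>\<^bsub>M\<^esub> = \<zero>\<^bsub>N\<^esub>"
    and "x \<in> carrier M \<Longrightarrow> f (\<ominus>\<^bsub>M\<^esub> x) = \<ominus>\<^bsub>N\<^esub> f x"
    and "x \<in> carrier M \<Longrightarrow> y \<in> carrier M \<Longrightarrow> f (x \<ominus>\<^bsub>M\<^esub> y) = f x \<ominus>\<^bsub>N\<^esub> f y"
proof -
  interpret M: right_module K A M by fact
  interpret N: right_module K A N by fact
  note l = lin_map_group[OF rlinD(1)[OF f] M.M.module_axioms N.M.module_axioms]
  show "f \<zero>\<^bsub>M\<^esub> = \<zero>\<^bsub>N\<^esub>" by (rule l(1))
  show "x \<in> carrier M \<Longrightarrow> f (\<ominus>\<^bsub>M\<^esub> x) = \<ominus>\<^bsub>N\<^esub> f x" by (rule l(2))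
  show "x \<in> carrier M \<Longrightarrow> y \<in> carrier M \<Longrightarrow> f (x \<ominus>\<^bsub>M\<^esub> y) = f x \<ominus>\<^bsub>N\<^esub> f y" by (rule l(3))
qed

lemma rlin_comp:
  assumes "f \<in> rlin K A M N" "g \<in> rlin K A N L"
  shows "(\<lambda>x. g (f x)) \<in> rlin K A M L"
  using assms by (auto simp: rlin_def lin_map_def Pi_iff)

lemma rlin_id: "right_module K A M \<Longrightarrow> (\<lambda>x. x) \<in> rlin K A M M"
  by (auto simp: rlin_def lin_map_def)

lemma rlin_zero:
  assumes "right_module K A M" "right_module K A N"
  shows "(\<lambda>x. \<zero>\<^bsub>N\<^esub>) \<in> rlin K A M N"
proof -
  interpret N: right_module K A N by fact
  show ?thesis using assms by (intro rlinI) (auto simp: N.ract_simps)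
qed

lemma rlin_add:
  assumes "f \<in> rlin K A M N" "g \<in> rlin K A M N" "right_module K A M" "right_module K A N"
  shows "(\<lambda>x. f x \<oplus>\<^bsub>N\<^esub> g x) \<in> rlin K A M N"
proof -
  interpret N: right_module K A N by fact
  show ?thesis
    using assms rlinD[OF assms(1)] rlinD[OF assms(2)]
    by (intro rlinI) (auto simp: N.ract_simps N.M.M.a_ac)
qed

lemma rlin_diff:
  assumes "f \<in> rlin K A M N" "g \<in> rlin K A M N" "right_module K A M" "right_module K A N"
  shows "(\<lambda>x. f x \<ominus>\<^bsub>N\<^esub> g x) \<in> rlin K A M N"
proof -
  interpret N: right_module K A N by fact
  show ?thesis
    using assms rlinD[OF assms(1)] rlinD[OF assms(2)]
    by (intro rlinI) (auto simp: N.ract_simps N.M.M.ag_simps)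
qed

lemma rlin_cong:
  assumes f: "f \<in> rlin K A M N" and M: "right_module K A M" and eq: "\<And>x. x \<in> carrier M \<Longrightarrow> g x = f x"
  shows "g \<in> rlin K A M N"
proof -
  interpret M: right_module K A M by fact
  show ?thesis
    using rlinD[OF f] by (auto simp: rlin_def eq M.ract_simps intro!: lin_mapI)
qed

lemma rlin_restrict: "f \<in> rlin K A M N \<Longrightarrow> right_module K A M \<Longrightarrow> restrict f (carrier M) \<in> rmod_hom K A M N"
  by (auto simp: rmod_hom_eq_rlin intro: rlin_cong)

section \<open>Submodules, kernels and images\<close>

definition rsubmod :: "('k, 'a, 's) module_scheme \<Rightarrow> ('k, 'm, 'a, 'z) rmod_scheme \<Rightarrow> 'm set \<Rightarrow> bool" where
  "rsubmod A M W \<longleftrightarrow> W \<subseteq> carrier M \<and> \<zero>\<^bsub>M\<^esub> \<in> W \<and>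
     (\<forall>x\<in>W. \<forall>y\<in>W. x \<oplus>\<^bsub>M\<^esub> y \<in> W) \<and> (\<forall>x\<in>W. \<forall>a\<in>carrier A. x \<triangleleft>\<^bsub>M\<^esub> a \<in> W)"

lemma (in right_module) rsubmod_submodule:
  assumes "rsubmod A M W"
  shows "submodule W K M"
  using assms by (intro M.submoduleI') (auto simp: rsubmod_def smult_eq_ract)

lemma (in right_module) right_module_sub:
  assumes W: "rsubmod A M W"
  shows "right_module K A (M\<lparr>carrier := W\<rparr>)"
proof -
  interpret W: module K "M\<lparr>carrier := W\<rparr>"
    by (rule submodule.submodule_is_module[OF rsubmod_submodule[OF W] M.module_axioms])
  have "x \<in> carrier M" if "x \<in> W" for x using that W by (auto simp: rsubmod_def)
  then show ?thesis
    using W by unfold_locales (auto simp: rsubmod_def ract_simps ract_assoc ract_one)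
qed

lemma rlin_incl: "W \<subseteq> carrier M \<Longrightarrow> (\<lambda>x. x) \<in> rlin K A (M\<lparr>carrier := W\<rparr>) M"
  by (auto simp: rlin_def lin_map_def)

lemma rlin_corestrict:
  "f \<in> rlin K A N M \<Longrightarrow> (\<And>x. x \<in> carrier N \<Longrightarrow> f x \<in> W) \<Longrightarrow> f \<in> rlin K A N (M\<lparr>carrier := W\<rparr>)"
  by (auto simp: rlin_def lin_map_def)

lemma rlin_sub:
  "f \<in> rlin K A M N \<Longrightarrow> W \<subseteq> carrier M \<Longrightarrow> f \<in> rlin K A (M\<lparr>carrier := W\<rparr>) N"
  by (auto simp: rlin_def lin_map_def subset_iff)

lemma rsubmod_ker:
  assumes f: "f \<in> rlin K A M N" and M: "right_module K A M" and N: "right_module K A N"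
  shows "rsubmod A M {x \<in> carrier M. f x = \<zero>\<^bsub>N\<^esub>}"
proof -
  interpret M: right_module K A M by fact
  interpret N: right_module K A N by fact
  show ?thesis
    using rlinD[OF f] rlin_group[OF f M N] by (auto simp: rsubmod_def M.ract_simps N.ract_simps)
qed

lemma rsubmod_image:
  assumes f: "f \<in> rlin K A M N" and M: "right_module K A M" and N: "right_module K A N"
  shows "rsubmod A N (f ` carrier M)"
proof -
  interpret M: right_module K A M by fact
  note [simp] = rlinD(3,5)[OF f, symmetric] rlinD(2)[OF f]
  show ?thesis
    using rlin_group(1)[OF f M N, symmetric] by (auto simp: rsubmod_def M.ract_simps)
qed

text \<open>A finitely generated module is projective iff its identity is a sum of maps
  \<open>y \<mapsto> p \<triangleleft> \<phi> y\<close> (dual basis lemma). The inductive form replaces dual bases by rule induction.\<close>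

inductive_set finrank :: "('k, 'r) ring_scheme \<Rightarrow> ('k, 'a, 's) module_scheme \<Rightarrow>
    ('k, 'm, 'a, 'y) rmod_scheme \<Rightarrow> ('k, 'n, 'a, 'z) rmod_scheme \<Rightarrow> ('m \<Rightarrow> 'n) set"
  for K :: "('k, 'r) ring_scheme" and A :: "('k, 'a, 's) module_scheme"
    and P :: "('k, 'm, 'a, 'y) rmod_scheme" and M :: "('k, 'n, 'a, 'z) rmod_scheme" where
  finrank_zero: "(\<forall>y\<in>carrier P. f y = \<zero>\<^bsub>M\<^esub>) \<Longrightarrow> f \<in> finrank K A P M"
| finrank_step: "f \<in> finrank K A P M \<Longrightarrow> p \<in> carrier M \<Longrightarrow> \<phi> \<in> rlin K A P (reg_bimod A) \<Longrightarrow>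
    (\<forall>y\<in>carrier P. g y = f y \<oplus>\<^bsub>M\<^esub> (p \<triangleleft>\<^bsub>M\<^esub> \<phi> y)) \<Longrightarrow> g \<in> finrank K A P M"

lemma finrank_rlin:
  assumes P: "right_module K A P" and M: "right_module K A M" and f: "f \<in> finrank K A P M"
  shows "f \<in> rlin K A P M"
  using f
proof induction
  case (finrank_zero f)
  then show ?case using rlin_cong[OF rlin_zero[OF P M] P] by blast
next
  case (finrank_step f p \<phi> g)
  interpret M: right_module K A M by fact
  have "(\<lambda>y. p \<triangleleft>\<^bsub>M\<^esub> \<phi> y) \<in> rlin K A P M"
    using finrank_step(2) by (intro rlinI P M) (auto simp: M.ract_simps M.ract_assoc rlin_regD[OF finrank_step(3)])
  from rlin_add[OF finrank_step.IH this P M] show ?case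
    by (rule rlin_cong[OF _ P]) (rule finrank_step(4)[rule_format])
qed

lemma finrank_cong:
  assumes "f \<in> finrank K A P M" "\<And>y. y \<in> carrier P \<Longrightarrow> g y = f y"
  shows "g \<in> finrank K A P M"
  using assms
proof (induction arbitrary: g)
  case (finrank_zero f)
  then show ?case by (intro finrank.finrank_zero) auto
next
  case (finrank_step f p \<phi> h)
  then show ?case by (intro finrank.finrank_step[OF finrank_step(1-3)]) simp
qed

lemma finrank_single:
  assumes M: "right_module K A M" and "p \<in> carrier M" "\<phi> \<in> rlin K A P (reg_bimod A)"
  shows "(\<lambda>y. p \<triangleleft>\<^bsub>M\<^esub> \<phi> y) \<in> finrank K A P M"
proof -
  interpret M: right_module K A M by fact
  have "\<forall>y\<in>carrier P. p \<triangleleft>\<^bsub>M\<^esub> \<phi> y = \<zero>\<^bsub>M\<^esub> \<oplus>\<^bsub>M\<^esub> (p \<triangleleft>\<^bsub>M\<^esub> \<phi> y)"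
    using rlin_regD(1)[OF assms(3)] assms(2) by (simp add: M.ract_closed)
  then show ?thesis
    by (intro finrank_step[where f = "\<lambda>_. \<zero>\<^bsub>M\<^esub>", OF finrank_zero assms(2,3)]) simp_all
qed

lemma finrank_add:
  assumes P: "right_module K A P" and M: "right_module K A M"
    and f: "f \<in> finrank K A P M" and g: "g \<in> finrank K A P M"
  shows "(\<lambda>y. f y \<oplus>\<^bsub>M\<^esub> g y) \<in> finrank K A P M"
  using g
proof induction
  interpret M: right_module K A M by fact
  {
    case (finrank_zero g)
    then show ?case
      using rlinD(2)[OF finrank_rlin[OF P M f]] by (intro finrank_cong[OF f]) auto
  next
    case (finrank_step g p \<phi> h)
    have "\<forall>y\<in>carrier P. f y \<oplus>\<^bsub>M\<^esub> h y = (f y \<oplus>\<^bsub>M\<^esub> g y) \<oplus>\<^bsub>M\<^esub> (p \<triangleleft>\<^bsub>M\<^esub> \<phi> y)"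
      using rlinD(2)[OF finrank_rlin[OF P M f]] rlinD(2)[OF finrank_rlin[OF P M finrank_step(1)]]
        rlin_regD(1)[OF finrank_step(3)] finrank_step(2,4)
      by (auto simp: M.M.M.a_assoc M.ract_simps)
    then show ?case
      using finrank_step by (intro finrank.finrank_step[OF finrank_step.IH, where p = p and \<phi> = \<phi>]) auto
  }
qed

lemma finrank_comp_left:
  assumes P: "right_module K A P" and M: "right_module K A M" and N: "right_module K A N"
    and f: "f \<in> finrank K A P M" and h: "h \<in> rlin K A M N"
  shows "(\<lambda>y. h (f y)) \<in> finrank K A P N"
  using f
proof induction
  case (finrank_zero f)
  then show ?case using rlin_group(1)[OF h M N] by (intro finrank.finrank_zero) auto
next
  case (finrank_step f p \<phi> g)
  interpret M: right_module K A M by fact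
  show ?case
    using finrank_step rlinD[OF h] rlin_regD(1)[OF finrank_step(3)] rlinD(2)[OF finrank_rlin[OF P M finrank_step(1)]]
    by (intro finrank.finrank_step[OF finrank_step.IH, where p = "h p" and \<phi> = \<phi>]) (auto simp: M.ract_simps)
qed

lemma finrank_comp_right:
  assumes f: "f \<in> finrank K A P M" and h: "h \<in> rlin K A Q P"
  shows "(\<lambda>y. f (h y)) \<in> finrank K A Q M"
  using f
proof induction
  case (finrank_zero f)
  then show ?case using rlinD(2)[OF h] by (intro finrank.finrank_zero) auto
next
  case (finrank_step f p \<phi> g)
  show ?case
    using finrank_step rlinD(2)[OF h] rlin_comp[OF h finrank_step(3)]
    by (intro finrank.finrank_step[OF finrank_step.IH, where p = p and \<phi> = "\<lambda>y. \<phi> (h y)"]) auto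
qed

text \<open>Lifts one summand at a time: for the summand of \<open>p\<close> and \<phi>, a preimage
  \<open>q\<close> of \<open>h p\<close> under \<open>g\<close> replaces \<open>p\<close>, and
  \<phi> stays. Projectivity is the case where \<open>f\<close> is the identity of \<open>P\<close>;
  a general \<open>f\<close> is what the induction runs over.\<close>

lemma finrank_lift:
  assumes P: "right_module K A P" and P': "right_module K A P'" and M: "right_module K A M"
    and N: "right_module K A N"
    and f: "f \<in> finrank K A P P'" and h: "h \<in> rlin K A P' N" and g: "g \<in> rlin K A M N"
    and im: "h ` carrier P' \<subseteq> g ` carrier M"
  shows "\<exists>f'\<in>finrank K A P M. \<forall>y\<in>carrier P. g (f' y) = h (f y)"
  using f
proof induction
  case (finrank_zero f)
  then show ?case
    using rlin_group(1)[OF h P' N] rlin_group(1)[OF g M N]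
    by (intro bexI[of _ "\<lambda>_. \<zero>\<^bsub>M\<^esub>"] finrank.finrank_zero) auto
next
  case (finrank_step f p \<phi> e)
  interpret M: right_module K A M by fact
  interpret P': right_module K A P' by fact
  obtain f' where f': "f' \<in> finrank K A P M" "\<forall>y\<in>carrier P. g (f' y) = h (f y)"
    using finrank_step.IH by blast
  obtain q where q: "q \<in> carrier M" "g q = h p" using im finrank_step(2) by (metis image_iff image_subset_iff)
  let ?f = "\<lambda>y. f' y \<oplus>\<^bsub>M\<^esub> (q \<triangleleft>\<^bsub>M\<^esub> \<phi> y)"
  have "?f \<in> finrank K A P M"
    using finrank_step q by (intro finrank.finrank_step[OF f'(1), where p = q and \<phi> = \<phi>]) auto
  moreover have "g (?f y) = h (e y)" if y: "y \<in> carrier P" for y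
  proof -
    have c: "f' y \<in> carrier M" "f y \<in> carrier P'" "\<phi> y \<in> carrier A"
      using y rlinD(2)[OF finrank_rlin[OF P M f'(1)]] rlinD(2)[OF finrank_rlin[OF P P' finrank_step(1)]]
        rlin_regD(1)[OF finrank_step(3)] by auto
    have "g (?f y) = g (f' y) \<oplus>\<^bsub>N\<^esub> (g q \<triangleleft>\<^bsub>N\<^esub> \<phi> y)"
      using c q(1) rlinD(3,5)[OF g] by (simp add: M.ract_closed)
    also have "\<dots> = h (f y) \<oplus>\<^bsub>N\<^esub> h (p \<triangleleft>\<^bsub>P'\<^esub> \<phi> y)"
      using c q(2) f'(2) y rlinD(5)[OF h finrank_step(2)] by simp
    also have "\<dots> = h (e y)"
      using c y finrank_step(2,4) rlinD(3)[OF h] by (simp add: P'.ract_closed)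
    finally show ?thesis .
  qed
  ultimately show ?case by (intro bexI[of _ ?f] ballI)
qed

definition fg_projective :: "('k, 'r) ring_scheme \<Rightarrow> ('k, 'a, 's) module_scheme \<Rightarrow>
    ('k, 'm, 'a, 'y) rmod_scheme \<Rightarrow> bool" where
  "fg_projective K A P \<longleftrightarrow> right_module K A P \<and> (\<lambda>y. y) \<in> finrank K A P P"

lemma fg_projective_lift:
  assumes P: "fg_projective K A P" and M: "right_module K A M" and N: "right_module K A N"
    and h: "h \<in> rlin K A P N" and g: "g \<in> rlin K A M N" and im: "h ` carrier P \<subseteq> g ` carrier M"
  obtains f where "f \<in> rlin K A P M" "\<And>y. y \<in> carrier P \<Longrightarrow> g (f y) = h y"
proof -
  have P': "right_module K A P" "(\<lambda>y. y) \<in> finrank K A P P" using P by (auto simp: fg_projective_def)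
  show ?thesis
    using finrank_lift[OF P'(1) P'(1) M N P'(2) h g im] finrank_rlin[OF P'(1) M] that by blast
qed

lemma fg_projective_retract:
  assumes P: "fg_projective K A P" and Q: "right_module K A Q"
    and s: "s \<in> rlin K A Q P" and r: "r \<in> rlin K A P Q" and rs: "\<And>y. y \<in> carrier Q \<Longrightarrow> r (s y) = y"
  shows "fg_projective K A Q"
proof -
  have P': "right_module K A P" "(\<lambda>y. y) \<in> finrank K A P P" using P by (auto simp: fg_projective_def)
  have "(\<lambda>y. r (s y)) \<in> finrank K A Q Q"
    using finrank_comp_right[OF finrank_comp_left[OF P'(1) P'(1) Q P'(2) r] s] .
  then show ?thesis using Q rs by (auto simp: fg_projective_def intro: finrank_cong)
qed

text \<open>Collects the functionals of a finite rank expression for \<open>f\<close>. When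
  \<open>f\<close> is the identity, they separate the points of \<open>P\<close>.\<close>

lemma fg_projective_functionals:
  assumes P: "right_module K A P" and M: "right_module K A M" and f: "f \<in> finrank K A P M"
  shows "\<exists>\<Phi>. finite \<Phi> \<and> \<Phi> \<subseteq> rlin K A P (reg_bimod A) \<and>
    (\<forall>y\<in>carrier P. (\<forall>\<phi>\<in>\<Phi>. \<phi> y = \<zero>\<^bsub>A\<^esub>) \<longrightarrow> f y = \<zero>\<^bsub>M\<^esub>)"
  using f
proof induction
  case (finrank_zero f)
  then show ?case by (intro exI[of _ "{}"]) auto
next
  case (finrank_step f p \<phi> g)
  interpret M: right_module K A M by fact
  obtain \<Phi> where "finite \<Phi>" "\<Phi> \<subseteq> rlin K A P (reg_bimod A)"
    "\<forall>y\<in>carrier P. (\<forall>\<phi>\<in>\<Phi>. \<phi> y = \<zero>\<^bsub>A\<^esub>) \<longrightarrow> f y = \<zero>\<^bsub>M\<^esub>"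
    using finrank_step.IH by blast
  then show ?case
    using finrank_step by (intro exI[of _ "insert \<phi> \<Phi>"]) (auto simp: M.ract_simps)
qed

text \<open>Unlike \<^const>\<open>finsum\<close>, this sum does not depend on the carrier, so that it can be compared
  between a module and its submodules.\<close>

fun nsum :: "('m, 'z) ring_scheme \<Rightarrow> (nat \<Rightarrow> 'm) \<Rightarrow> nat \<Rightarrow> 'm" where
  "nsum M f 0 = \<zero>\<^bsub>M\<^esub>"
| "nsum M f (Suc n) = nsum M f n \<oplus>\<^bsub>M\<^esub> f n"

lemma (in abelian_group) nsum_closed: "(\<And>i. i < n \<Longrightarrow> f i \<in> carrier G) \<Longrightarrow> nsum G f n \<in> carrier G"
  by (induction n) auto

lemma nsum_cong: "(\<And>i. i < n \<Longrightarrow> f i = g i) \<Longrightarrow> nsum M f n = nsum M g n"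
  by (induction n) auto

lemma nsum_hom:
  assumes "abelian_group M" and "\<And>x y. x \<in> carrier M \<Longrightarrow> y \<in> carrier M \<Longrightarrow> h (x \<oplus>\<^bsub>M\<^esub> y) = h x \<oplus>\<^bsub>N\<^esub> h y"
    and "h \<zero>\<^bsub>M\<^esub> = \<zero>\<^bsub>N\<^esub>" and "\<And>i. i < n \<Longrightarrow> f i \<in> carrier M"
  shows "h (nsum M f n) = nsum N (\<lambda>i. h (f i)) n"
  using assms(4) by (induction n) (auto simp: assms(2,3) abelian_group.nsum_closed[OF assms(1)])

lemma nsum_carrier_update [simp]: "nsum (M\<lparr>carrier := W\<rparr>) f n = nsum M f n"
  by (induction n) auto

text \<open>Returns from rule induction to an explicit dual basis, for the places that need
  coordinates.\<close>

lemma finrank_nsum_form: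
  assumes "f \<in> finrank K A P M"
  shows "\<exists>n p \<phi>. (\<forall>j<n. p j \<in> carrier M \<and> \<phi> j \<in> rlin K A P (reg_bimod A)) \<and>
    (\<forall>y\<in>carrier P. f y = nsum M (\<lambda>j. p j \<triangleleft>\<^bsub>M\<^esub> \<phi> j y) (n::nat))"
  using assms
proof induction
  case (finrank_zero f)
  then show ?case by (intro exI[of _ 0]) auto
next
  case (finrank_step f p \<phi> g)
  then obtain n p' \<phi>' where *: "\<forall>j<n. p' j \<in> carrier M \<and> \<phi>' j \<in> rlin K A P (reg_bimod A)"
    "\<forall>y\<in>carrier P. f y = nsum M (\<lambda>j. p' j \<triangleleft>\<^bsub>M\<^esub> \<phi>' j y) n" by blast
  have "nsum M (\<lambda>j. (p'(n := p)) j \<triangleleft>\<^bsub>M\<^esub> (\<phi>'(n := \<phi>)) j y) (Suc n) =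
      nsum M (\<lambda>j. p' j \<triangleleft>\<^bsub>M\<^esub> \<phi>' j y) n \<oplus>\<^bsub>M\<^esub> (p \<triangleleft>\<^bsub>M\<^esub> \<phi> y)" for y
    by (simp cong: nsum_cong)
  with * finrank_step(2-4) show ?case
    by (intro exI[of _ "Suc n"] exI[of _ "p'(n := p)"] exI[of _ "\<phi>'(n := \<phi>)"])
      (simp add: less_Suc_eq del: nsum.simps)
qed

lemma finrank_nsum:
  assumes "\<And>j. j < n \<Longrightarrow> p j \<in> carrier M" "\<And>j. j < n \<Longrightarrow> \<phi> j \<in> rlin K A P (reg_bimod A)"
  shows "(\<lambda>y. nsum M (\<lambda>j. p j \<triangleleft>\<^bsub>M\<^esub> \<phi> j y) n) \<in> finrank K A P M"
  using assms
proof (induction n)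
  case 0
  then show ?case by (intro finrank_zero) simp
next
  case (Suc n)
  have "(\<lambda>y. nsum M (\<lambda>j. p j \<triangleleft>\<^bsub>M\<^esub> \<phi> j y) n) \<in> finrank K A P M"
    using Suc by simp
  then show ?case
    by (rule finrank_step[of _ _ _ _ _ "p n" "\<phi> n"]) (use Suc.prems in auto)
qed

section \<open>Powers of a module and free modules\<close>

lemma power_mod_simps [simp]:
  "carrier (power_mod n M) = {..<n} \<rightarrow>\<^sub>E carrier M"
  "\<zero>\<^bsub>power_mod n M\<^esub> = (\<lambda>i\<in>{..<n}. \<zero>\<^bsub>M\<^esub>)"
  "x \<oplus>\<^bsub>power_mod n M\<^esub> y = (\<lambda>i\<in>{..<n}. x i \<oplus>\<^bsub>M\<^esub> y i)"
  "r \<odot>\<^bsub>power_mod n M\<^esub> x = (\<lambda>i\<in>{..<n}. r \<odot>\<^bsub>M\<^esub> x i)"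
  "x \<triangleleft>\<^bsub>power_mod n M\<^esub> a = (\<lambda>i\<in>{..<n}. x i \<triangleleft>\<^bsub>M\<^esub> a)"
  by (simp_all add: power_mod_def fun_space_def module.defs rmod.defs)

lemma power_mod_ext:
  assumes "x \<in> carrier (power_mod n M)" "y \<in> carrier (power_mod n M)" "\<And>i. i < n \<Longrightarrow> x i = y i"
  shows "x = y"
  using assms by (auto intro: PiE_ext)

lemma power_mod_right_module:
  assumes "right_module K A M"
  shows "right_module K A (power_mod n M)"
proof -
  interpret M: right_module K A M by fact
  have "module K (fun_space {..<n} ({..<n} \<rightarrow>\<^sub>E carrier M) M)"
    by (rule fun_space_module[OF M.M.module_axioms]) (auto simp: PiE_iff)
  then have "module K (power_mod n M)"
    by (rule module_cong) simp_all
  then interpret P: module K "power_mod n M" .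
  show ?thesis
    by unfold_locales
      (auto simp: PiE_iff M.ract_simps M.ract_assoc M.ract_one extensional_def fun_eq_iff intro!: restrict_ext)
qed

lemma power_mod_coord: "i < n \<Longrightarrow> (\<lambda>x. x i) \<in> rlin K A (power_mod n M) M"
  by (auto simp: rlin_def lin_map_def PiE_iff)

lemma power_mod_tuple:
  assumes "\<And>i. i < n \<Longrightarrow> f i \<in> rlin K A N M"
  shows "(\<lambda>y. \<lambda>i\<in>{..<n}. f i y) \<in> rlin K A N (power_mod n M)"
  using rlinD[OF assms] by (auto simp: rlin_def lin_map_def intro!: restrict_ext)

lemma (in k_algebra) reg_right_module: "right_module K A (reg_bimod A)"
  by (rule bimodule.axioms(1)[OF bimodule_reg])

lemma (in k_algebra) free_fg_projective: "fg_projective K A (power_mod n (reg_bimod A))"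
proof -
  let ?F = "power_mod n (reg_bimod A)"
  interpret F: right_module K A ?F by (rule power_mod_right_module[OF reg_right_module])
  \<comment> \<open>Truncation to the first \<open>k\<close> coordinates; passing to
    \<open>Suc k\<close> adds one rank one map, the unit vector at \<open>k\<close> times the
    coordinate functional at \<open>k\<close>.\<close>
  have "(\<lambda>x. \<lambda>i\<in>{..<n}. if i < k then x i else \<zero>\<^bsub>A\<^esub>) \<in> finrank K A ?F ?F" if "k \<le> n" for k
    using that
  proof (induction k)
    case 0
    then show ?case by (intro finrank_zero) (simp add: restrict_def fun_eq_iff)
  next
    case (Suc k)
    show ?case
    proof (rule finrank_step)
      show "(\<lambda>x. \<lambda>i\<in>{..<n}. if i < k then x i else \<zero>\<^bsub>A\<^esub>) \<in> finrank K A ?F ?F"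
        using Suc.prems by (intro Suc.IH) simp
      show "(\<lambda>i\<in>{..<n}. if i = k then \<one>\<^bsub>A\<^esub> else \<zero>\<^bsub>A\<^esub>) \<in> carrier ?F" by auto
      show "(\<lambda>x. x k) \<in> rlin K A ?F (reg_bimod A)" using Suc by (intro power_mod_coord) simp
      show "\<forall>x\<in>carrier ?F. (\<lambda>i\<in>{..<n}. if i < Suc k then x i else \<zero>\<^bsub>A\<^esub>) =
          (\<lambda>i\<in>{..<n}. if i < k then x i else \<zero>\<^bsub>A\<^esub>) \<oplus>\<^bsub>?F\<^esub>
          ((\<lambda>i\<in>{..<n}. if i = k then \<one>\<^bsub>A\<^esub> else \<zero>\<^bsub>A\<^esub>) \<triangleleft>\<^bsub>?F\<^esub> x k)"
      proof
        fix x assume x: "x \<in> carrier ?F"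
        have "(if i < Suc k then x i else \<zero>\<^bsub>A\<^esub>) =
            (if i < k then x i else \<zero>\<^bsub>A\<^esub>) \<oplus>\<^bsub>A\<^esub> (if i = k then \<one>\<^bsub>A\<^esub> else \<zero>\<^bsub>A\<^esub>) \<otimes>\<^bsub>A\<^esub> x k" if "i < n" for i
        proof -
          have "x i \<in> carrier A" "x k \<in> carrier A" using x that Suc.prems by (simp_all add: PiE_iff)
          then show ?thesis by (cases "i < k"; cases "i = k") simp_all
        qed
        then show "(\<lambda>i\<in>{..<n}. if i < Suc k then x i else \<zero>\<^bsub>A\<^esub>) =
          (\<lambda>i\<in>{..<n}. if i < k then x i else \<zero>\<^bsub>A\<^esub>) \<oplus>\<^bsub>?F\<^esub>
          ((\<lambda>i\<in>{..<n}. if i = k then \<one>\<^bsub>A\<^esub> else \<zero>\<^bsub>A\<^esub>) \<triangleleft>\<^bsub>?F\<^esub> x k)"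
          by (simp add: restrict_def fun_eq_iff)
      qed
    qed
  qed
  from this[OF order_refl] have "(\<lambda>x. x) \<in> finrank K A ?F ?F"
    by (rule finrank_cong) (simp add: PiE_iff extensional_def fun_eq_iff)
  then show ?thesis
    unfolding fg_projective_def using F.right_module_axioms by simp
qed

lemma (in k_algebra) projective_fg_projective:
  assumes "projective K A P"
  shows "fg_projective K A P"
proof -
  obtain n s r where P: "right_module K A P" and s: "s \<in> rmod_hom K A P (power_mod n (reg_bimod A))"
    and r: "r \<in> rmod_hom K A (power_mod n (reg_bimod A)) P" and rs: "\<forall>x\<in>carrier P. r (s x) = x"
    using assms by (auto simp: projective_def in_add_def)
  show ?thesis
    using fg_projective_retract[OF free_fg_projective P, of s n r] s r rs by (auto simp: rmod_hom_eq_rlin)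
qed

lemma (in k_algebra) free_projective: "projective K A (power_mod n (reg_bimod A))"
proof -
  let ?F = "power_mod n (reg_bimod A)"
  have F: "right_module K A ?F" by (rule power_mod_right_module[OF reg_right_module])
  have "restrict (\<lambda>x. x) (carrier ?F) \<in> rmod_hom K A ?F ?F"
    by (rule rlin_restrict[OF rlin_id[OF F] F])
  then show ?thesis
    unfolding projective_def in_add_def using F
    by (intro conjI exI[of _ n] bexI[of _ "restrict (\<lambda>x. x) (carrier ?F)"]) auto
qed

text \<open>Kaplansky's argument that submodules of free modules over a hereditary algebra are projective,
  for modules embedded by finitely many functionals. It also applies to vector spaces, all ideals
  of a field being trivial.\<close>

lemma fg_projective_by_functionals:
  assumes A: "k_algebra K A"
    and ideals: "\<And>I. rsubmod A (reg_bimod A) I \<Longrightarrow> fg_projective K A ((reg_bimod A)\<lparr>carrier := I\<rparr>)"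
    and "finite \<Phi>" "right_module K A M" "\<Phi> \<subseteq> rlin K A M (reg_bimod A)"
    and "\<And>x. x \<in> carrier M \<Longrightarrow> \<forall>\<phi>\<in>\<Phi>. \<phi> x = \<zero>\<^bsub>A\<^esub> \<Longrightarrow> x = \<zero>\<^bsub>M\<^esub>"
  shows "fg_projective K A M"
  using assms(3-)
proof (induction \<Phi> arbitrary: M rule: finite_induct)
  case empty
  then show ?case by (auto simp: fg_projective_def intro: finrank_zero)
next
  case (insert \<phi> \<Phi>)
  interpret A: k_algebra K A by fact
  interpret M: right_module K A M by fact
  have R: "right_module K A (reg_bimod A)" by (rule A.reg_right_module)
  have \<phi>: "\<phi> \<in> rlin K A M (reg_bimod A)" using insert by auto
  define I where "I = \<phi> ` carrier M"
  define W where "W = {x \<in> carrier M. \<phi> x = \<zero>\<^bsub>A\<^esub>}"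
  let ?M = "M\<lparr>carrier := W\<rparr>" and ?I = "(reg_bimod A)\<lparr>carrier := I\<rparr>"
  have W: "rsubmod A M W" unfolding W_def using rsubmod_ker[OF \<phi> M.right_module_axioms R] by simp
  have I: "rsubmod A (reg_bimod A) I" unfolding I_def by (rule rsubmod_image[OF \<phi> M.right_module_axioms R])
  have M': "right_module K A ?M" by (rule M.right_module_sub[OF W])
  have "fg_projective K A ?M"
  proof (rule insert.IH[OF M'])
    show "\<Phi> \<subseteq> rlin K A ?M (reg_bimod A)"
      using insert.prems(2) by (auto intro!: rlin_sub simp: W_def)
    show "x = \<zero>\<^bsub>?M\<^esub>" if "x \<in> carrier ?M" "\<forall>\<phi>\<in>\<Phi>. \<phi> x = \<zero>\<^bsub>A\<^esub>" for x
      using that insert.prems(3)[of x] by (auto simp: W_def)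
  qed
  then have idW: "(\<lambda>y. y) \<in> finrank K A ?M ?M" by (simp add: fg_projective_def)
  have I': "right_module K A ?I" "(\<lambda>y. y) \<in> finrank K A ?I ?I"
    using ideals[OF I] by (auto simp: fg_projective_def)
  have IA: "I \<subseteq> carrier (reg_bimod A)" using I by (simp add: rsubmod_def)
  \<comment> \<open>A section of \<phi> onto its image, the ideal \<open>I\<close>, which is
    projective.\<close>
  obtain s where s: "s \<in> finrank K A ?I M" and \<phi>s: "\<And>a. a \<in> I \<Longrightarrow> \<phi> (s a) = a"
    using finrank_lift[OF I'(1) I'(1) M.right_module_axioms R I'(2) rlin_incl[OF IA] \<phi>] by (auto simp: I_def)
  have \<phi>I: "\<phi> \<in> rlin K A M ?I" by (rule rlin_corestrict[OF \<phi>]) (simp add: I_def)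
  have s\<phi>: "(\<lambda>y. s (\<phi> y)) \<in> finrank K A M M" by (rule finrank_comp_right[OF s \<phi>I])
  note sl = finrank_rlin[OF M.right_module_axioms M.right_module_axioms s\<phi>]
  have "(\<lambda>y. y \<ominus>\<^bsub>M\<^esub> s (\<phi> y)) \<in> rlin K A M M"
    by (rule rlin_diff[OF rlin_id sl]) (rule M.right_module_axioms)+
  then have e: "(\<lambda>y. y \<ominus>\<^bsub>M\<^esub> s (\<phi> y)) \<in> rlin K A M ?M"
  proof (rule rlin_corestrict)
    fix y assume y: "y \<in> carrier M"
    have "\<phi> (y \<ominus>\<^bsub>M\<^esub> s (\<phi> y)) = \<zero>\<^bsub>A\<^esub>"
      using y rlinD(2)[OF sl] rlin_group(3)[OF \<phi> M.right_module_axioms R, of y "s (\<phi> y)"] \<phi>s[of "\<phi> y"]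
        rlin_regD(1)[OF \<phi>] by (simp add: I_def A.M.r_neg A.M.minus_eq)
    then show "y \<ominus>\<^bsub>M\<^esub> s (\<phi> y) \<in> W" using y rlinD(2)[OF sl] by (simp add: W_def)
  qed
  have WM: "W \<subseteq> carrier M" by (auto simp: W_def)
  have "(\<lambda>y. y \<ominus>\<^bsub>M\<^esub> s (\<phi> y)) \<in> finrank K A M M"
    by (rule finrank_comp_left[OF M.right_module_axioms M' M.right_module_axioms
          finrank_comp_right[OF idW e] rlin_incl[OF WM]])
  \<comment> \<open>The identity of \<open>M\<close> is the projection through \<open>I\<close> plus
    the projection onto the kernel \<open>W\<close>. Both have finite rank, the first through
    \<open>I\<close> and the second through \<open>W\<close>, where one functional fewer is
    needed.\<close>
  from finrank_add[OF M.right_module_axioms M.right_module_axioms s\<phi> this]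
  have "(\<lambda>y. s (\<phi> y) \<oplus>\<^bsub>M\<^esub> (y \<ominus>\<^bsub>M\<^esub> s (\<phi> y))) \<in> finrank K A M M" .
  then have "(\<lambda>y. y) \<in> finrank K A M M"
    by (rule finrank_cong) (use rlinD(2)[OF sl] in \<open>simp add: M.M.M.ag_simps\<close>)
  then show ?case by (simp add: fg_projective_def M.right_module_axioms)
qed

lemma (in k_algebra) hereditary_ideal:
  assumes "hereditary K A" "rsubmod A (reg_bimod A) I"
  shows "fg_projective K A ((reg_bimod A)\<lparr>carrier := I\<rparr>)"
proof -
  interpret R: right_module K A "reg_bimod A" by (rule reg_right_module)
  have "submodule I K A"
    using submodule.smult_closed[OF R.rsubmod_submodule[OF assms(2)]] assms(2)
    by (intro submoduleI') (auto simp: rsubmod_def)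
  then have "projective K A ((reg_bimod A)\<lparr>carrier := I\<rparr>)"
    using assms by (auto simp: hereditary_def rsubmod_def)
  then show ?thesis by (rule projective_fg_projective)
qed

section \<open>Finite-dimensional spaces and projective resolutions\<close>

lemma base_space_simps [simp]:
  "carrier (base_space K) = carrier K"
  "\<zero>\<^bsub>base_space K\<^esub> = \<zero>\<^bsub>K\<^esub>"
  "\<one>\<^bsub>base_space K\<^esub> = \<one>\<^bsub>K\<^esub>"
  "x \<oplus>\<^bsub>base_space K\<^esub> y = x \<oplus>\<^bsub>K\<^esub> y"
  "x \<otimes>\<^bsub>base_space K\<^esub> y = x \<otimes>\<^bsub>K\<^esub> y"
  "r \<odot>\<^bsub>base_space K\<^esub> x = r \<otimes>\<^bsub>K\<^esub> x"
  by (simp_all add: base_space_def)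

lemma base_space_module:
  assumes "cring K"
  shows "module K (base_space K)"
proof -
  interpret cring K by fact
  show ?thesis
  proof (rule moduleI)
    show "cring K" by (rule is_cring)
    show "abelian_group (base_space K)"
      by (rule abelian_groupI) (auto simp: a_ac intro: bexI[of _ "\<ominus>\<^bsub>K\<^esub> x" for x] l_neg)
  qed (auto simp: l_distr r_distr m_assoc)
qed

lemma base_space_algebra:
  assumes "field K"
  shows "k_algebra K (base_space K)"
proof -
  interpret K: field K by fact
  interpret M: module K "base_space K" by (rule base_space_module) unfold_locales
  have "ring (base_space K)"
    by (intro ringI M.M.abelian_group_axioms monoidI) (auto simp: K.l_distr K.r_distr K.m_assoc)
  then interpret R: ring "base_space K" .
  show ?thesis by unfold_locales (auto simp: K.m_ac)
qed

text \<open>A vector space as a right module over its own field, so that the dual basis lemma also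
  yields coordinates on vector spaces.\<close>

definition vmod :: "('k, 'v, 'z) module_scheme \<Rightarrow> ('k, 'v, 'k) rmod" where
  "vmod V = \<lparr>carrier = carrier V, monoid.mult = monoid.mult V, one = one V, ring.zero = ring.zero V,
     ring.add = ring.add V, smult = smult V, ract = (\<lambda>x r. r \<odot>\<^bsub>V\<^esub> x)\<rparr>"

lemma vmod_simps [simp]:
  "carrier (vmod V) = carrier V" "\<zero>\<^bsub>vmod V\<^esub> = \<zero>\<^bsub>V\<^esub>" "x \<oplus>\<^bsub>vmod V\<^esub> y = x \<oplus>\<^bsub>V\<^esub> y"
  "r \<odot>\<^bsub>vmod V\<^esub> x = r \<odot>\<^bsub>V\<^esub> x" "x \<triangleleft>\<^bsub>vmod V\<^esub> r = r \<odot>\<^bsub>V\<^esub> x"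
  by (simp_all add: vmod_def)

lemma nsum_vmod [simp]: "nsum (vmod V) f n = nsum V f n"
  by (induction n) auto

lemma vmod_right_module:
  assumes "field K" "module K V"
  shows "right_module K (base_space K) (vmod V)"
proof -
  interpret B: k_algebra K "base_space K" by (rule base_space_algebra) fact
  interpret V: module K V by fact
  interpret W: module K "vmod V" by (rule module_cong[OF V.module_axioms]) simp_all
  have *: "x \<otimes>\<^bsub>K\<^esub> y = y \<otimes>\<^bsub>K\<^esub> x" if "x \<in> carrier K" "y \<in> carrier K" for x y
    using that by (rule B.K.m_comm)
  show ?thesis
    by unfold_locales (auto simp: V.smult_l_distr V.smult_r_distr V.smult_assoc1[symmetric] *)
qed

lemma rlin_vmod:
  assumes "f \<in> rlin K (base_space K) (vmod V) (reg_bimod (base_space K))"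
  shows "f \<in> lin_map K V (base_space K)"
  using rlinD[OF assms] by (auto intro!: lin_mapI)

text \<open>Finite dimension, in the dual form that passes to subspaces without choosing bases.\<close>

definition fin_functionals :: "('k, 'r) ring_scheme \<Rightarrow> ('k, 'v, 'z) module_scheme \<Rightarrow> bool" where
  "fin_functionals K V \<longleftrightarrow> (\<exists>\<Phi>. finite \<Phi> \<and> \<Phi> \<subseteq> lin_map K V (base_space K) \<and>
     (\<forall>x\<in>carrier V. (\<forall>\<phi>\<in>\<Phi>. \<phi> x = \<zero>\<^bsub>K\<^esub>) \<longrightarrow> x = \<zero>\<^bsub>V\<^esub>))"

text \<open>Separating functionals on \<open>W\<close>, pulled back along finitely many jointly
  injective maps, separate the points of \<open>V\<close>. Applied to inclusions, coordinates of
  powers and evaluations.\<close>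

lemma fin_functionals_joint:
  assumes W: "fin_functionals K W" and T: "finite T" "T \<subseteq> lin_map K V W"
    and inj: "\<And>x. x \<in> carrier V \<Longrightarrow> \<forall>t\<in>T. t x = \<zero>\<^bsub>W\<^esub> \<Longrightarrow> x = \<zero>\<^bsub>V\<^esub>"
  shows "fin_functionals K V"
proof -
  obtain \<Phi> where \<Phi>: "finite \<Phi>" "\<Phi> \<subseteq> lin_map K W (base_space K)"
    "\<forall>x\<in>carrier W. (\<forall>\<phi>\<in>\<Phi>. \<phi> x = \<zero>\<^bsub>K\<^esub>) \<longrightarrow> x = \<zero>\<^bsub>W\<^esub>"
    using W by (auto simp: fin_functionals_def)
  let ?\<Psi> = "(\<lambda>(\<phi>, t). \<lambda>x. \<phi> (t x)) ` (\<Phi> \<times> T)"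
  have "x = \<zero>\<^bsub>V\<^esub>" if x: "x \<in> carrier V" and 0: "\<forall>\<psi>\<in>?\<Psi>. \<psi> x = \<zero>\<^bsub>K\<^esub>" for x
  proof (rule inj[OF x], intro ballI)
    fix t assume t: "t \<in> T"
    have "t x \<in> carrier W" using T(2) t x by (auto dest: lin_mapD(1))
    moreover have "\<forall>\<phi>\<in>\<Phi>. \<phi> (t x) = \<zero>\<^bsub>K\<^esub>" using 0 t by force
    ultimately show "t x = \<zero>\<^bsub>W\<^esub>" using \<Phi>(3) by blast
  qed
  moreover have "?\<Psi> \<subseteq> lin_map K V (base_space K)"
  proof -
    have "(\<lambda>x. \<phi> (t x)) \<in> lin_map K V (base_space K)" if "\<phi> \<in> \<Phi>" "t \<in> T" for \<phi> t
      by (rule lin_map_comp[OF subsetD[OF T(2) that(2)] subsetD[OF \<Phi>(2) that(1)]])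
    then show ?thesis by (auto simp del: split_paired_All)
  qed
  moreover have "finite ?\<Psi>" using \<Phi>(1) T(1) by simp
  ultimately show ?thesis unfolding fin_functionals_def by (intro exI[of _ ?\<Psi>] conjI ballI impI)
qed

lemma fin_functionals_base:
  assumes "cring K"
  shows "fin_functionals K (base_space K)"
  unfolding fin_functionals_def
  by (intro exI[of _ "{\<lambda>x. x}"]) (auto intro: lin_mapI)

lemma fin_functionals_inj:
  assumes W: "fin_functionals K W" and t: "t \<in> lin_map K V W"
    and inj: "\<And>x. x \<in> carrier V \<Longrightarrow> t x = \<zero>\<^bsub>W\<^esub> \<Longrightarrow> x = \<zero>\<^bsub>V\<^esub>"
  shows "fin_functionals K V"
  by (rule fin_functionals_joint[OF W, of "{t}"]) (simp_all add: t inj)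

lemma fin_functionals_sub:
  assumes V: "fin_functionals K V" and W: "W \<subseteq> carrier V"
  shows "fin_functionals K (V\<lparr>carrier := W\<rparr>)"
proof (rule fin_functionals_inj[OF V, of "\<lambda>x. x"])
  show "(\<lambda>x. x) \<in> lin_map K (V\<lparr>carrier := W\<rparr>) V" using W by (intro lin_mapI) auto
qed simp

lemma fin_functionals_power:
  assumes M: "fin_functionals K M"
  shows "fin_functionals K (power_mod n M)"
proof (rule fin_functionals_joint[OF M, of "(\<lambda>i. \<lambda>x. x i) ` {..<n}"])
  show "(\<lambda>i x. x i) ` {..<n} \<subseteq> lin_map K (power_mod n M) M"
    by (auto intro!: lin_mapI)
  show "x = \<zero>\<^bsub>power_mod n M\<^esub>"
    if "x \<in> carrier (power_mod n M)" "\<forall>t\<in>(\<lambda>i x. x i) ` {..<n}. t x = \<zero>\<^bsub>M\<^esub>" for x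
    using that by (simp add: PiE_iff extensional_def fun_eq_iff)
qed simp

text \<open>Turns separating functionals into a finite expansion with coordinate functionals.
  Independence of the vectors \<open>v j\<close> is not claimed; the expansion is what later
  arguments use.\<close>

lemma fin_functionals_basis:
  assumes K: "field K" and V: "module K V" and fd: "fin_functionals K V"
  obtains n v t where "\<And>j. j < n \<Longrightarrow> v j \<in> carrier V" "\<And>j. j < n \<Longrightarrow> t j \<in> lin_map K V (base_space K)"
    "\<And>x. x \<in> carrier V \<Longrightarrow> x = nsum V (\<lambda>j. t j x \<odot>\<^bsub>V\<^esub> v j) (n::nat)"
proof -
  interpret K: field K by fact
  let ?A = "base_space K"
  interpret A: k_algebra K ?A by (rule base_space_algebra[OF K])
  have Vm: "right_module K ?A (vmod V)" by (rule vmod_right_module[OF K V])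
  obtain \<Phi> where \<Phi>: "finite \<Phi>" "\<Phi> \<subseteq> lin_map K V ?A"
    "\<forall>x\<in>carrier V. (\<forall>\<phi>\<in>\<Phi>. \<phi> x = \<zero>\<^bsub>K\<^esub>) \<longrightarrow> x = \<zero>\<^bsub>V\<^esub>"
    using fd by (auto simp: fin_functionals_def)
  have "fg_projective K ?A (vmod V)"
  proof (rule fg_projective_by_functionals[OF A.k_algebra_axioms _ \<Phi>(1) Vm])
    fix I assume I: "rsubmod ?A (reg_bimod ?A) I"
    interpret R: right_module K ?A "reg_bimod ?A" by (rule A.reg_right_module)
    have Im: "right_module K ?A ((reg_bimod ?A)\<lparr>carrier := I\<rparr>)" by (rule R.right_module_sub[OF I])
    show "fg_projective K ?A ((reg_bimod ?A)\<lparr>carrier := I\<rparr>)"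
    proof (cases "I \<subseteq> {\<zero>\<^bsub>K\<^esub>}")
      case True
      have "(\<lambda>y. y) \<in> finrank K ?A ((reg_bimod ?A)\<lparr>carrier := I\<rparr>) ((reg_bimod ?A)\<lparr>carrier := I\<rparr>)"
        by (rule finrank_zero) (use True in auto)
      then show ?thesis using Im by (simp add: fg_projective_def)
    next
      case False
      \<comment> \<open>A nonzero element of \<open>I\<close> is a unit, so \<open>I\<close>
        contains 1, and 1 with the inclusion functional is a dual basis of \<open>I\<close>.\<close>
      then obtain a where a: "a \<in> I" "a \<noteq> \<zero>\<^bsub>K\<^esub>" "a \<in> carrier K" using I by (auto simp: rsubmod_def)
      then have u: "a \<in> Units K" by (simp add: K.field_Units)
      have "\<forall>x\<in>I. \<forall>b\<in>carrier K. x \<otimes>\<^bsub>K\<^esub> b \<in> I" using I by (simp add: rsubmod_def)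
      then have "a \<otimes>\<^bsub>K\<^esub> inv\<^bsub>K\<^esub> a \<in> I" using a(1) K.Units_inv_closed[OF u] by (elim ballE) auto
      then have 1: "\<one>\<^bsub>K\<^esub> \<in> I" using K.Units_r_inv[OF u] by simp
      have IK: "I \<subseteq> carrier K" using I by (auto simp: rsubmod_def)
      have "(\<lambda>x. x) \<in> rlin K ?A ((reg_bimod ?A)\<lparr>carrier := I\<rparr>) (reg_bimod ?A)"
        using IK by (intro rlin_incl) simp
      from finrank_single[OF Im _ this, of "\<one>\<^bsub>K\<^esub>"] 1
      have "(\<lambda>y. \<one>\<^bsub>K\<^esub> \<otimes>\<^bsub>K\<^esub> y) \<in> finrank K ?A ((reg_bimod ?A)\<lparr>carrier := I\<rparr>) ((reg_bimod ?A)\<lparr>carrier := I\<rparr>)"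
        by simp
      then have "(\<lambda>y. y) \<in> finrank K ?A ((reg_bimod ?A)\<lparr>carrier := I\<rparr>) ((reg_bimod ?A)\<lparr>carrier := I\<rparr>)"
        by (rule finrank_cong) (use IK in auto)
      then show ?thesis using Im by (simp add: fg_projective_def)
    qed
  next
    show "\<Phi> \<subseteq> rlin K ?A (vmod V) (reg_bimod ?A)"
    proof
      fix \<phi> assume "\<phi> \<in> \<Phi>"
      then have \<phi>: "\<phi> \<in> lin_map K V ?A" using \<Phi>(2) by auto
      show "\<phi> \<in> rlin K ?A (vmod V) (reg_bimod ?A)"
        using lin_mapD[OF \<phi>] by (intro rlinI[OF Vm A.reg_right_module]) (auto simp: K.m_comm)
    qed
  qed (use \<Phi>(3) in auto)
  then have "(\<lambda>y. y) \<in> finrank K ?A (vmod V) (vmod V)" by (simp add: fg_projective_def)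
  from finrank_nsum_form[OF this] obtain n p \<phi> where
    *: "\<forall>j<n. p j \<in> carrier V \<and> \<phi> j \<in> rlin K ?A (vmod V) (reg_bimod ?A)"
    "\<forall>y\<in>carrier V. y = nsum V (\<lambda>j. \<phi> j y \<odot>\<^bsub>V\<^esub> p j) (n::nat)" by auto
  then show ?thesis using that[of n p \<phi>] rlin_vmod by blast
qed

text \<open>\<open>W'\<close> is the direct sum of \<open>W\<close> and the line through
  \<open>s\<close>. The functionals on \<open>W\<close> composed with the projection, together with
  the coordinate on the line, separate its points.\<close>

lemma fin_functionals_extend:
  assumes K: "field K" and V: "module K V" and W: "submodule W K V" and s: "s \<in> carrier V" "s \<notin> W"
    and fd: "fin_functionals K (V\<lparr>carrier := W\<rparr>)"
  defines "W' \<equiv> {w \<oplus>\<^bsub>V\<^esub> r \<odot>\<^bsub>V\<^esub> s | w r. w \<in> W \<and> r \<in> carrier K}"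
  shows "submodule W' K V" "fin_functionals K (V\<lparr>carrier := W'\<rparr>)"
proof -
  interpret K: field K by fact
  interpret V: module K V by fact
  note We = V.submoduleE[OF W]
  have W0: "\<zero>\<^bsub>V\<^esub> \<in> W" using subgroup.one_closed[OF submodule.axioms(1)[OF W]] by simp
  have Wc: "w \<in> carrier V" if "w \<in> W" for w using We(1) that by auto
  have add: "(w \<oplus>\<^bsub>V\<^esub> r \<odot>\<^bsub>V\<^esub> s) \<oplus>\<^bsub>V\<^esub> (w' \<oplus>\<^bsub>V\<^esub> r' \<odot>\<^bsub>V\<^esub> s) = (w \<oplus>\<^bsub>V\<^esub> w') \<oplus>\<^bsub>V\<^esub> (r \<oplus>\<^bsub>K\<^esub> r') \<odot>\<^bsub>V\<^esub> s"
    if "w \<in> W" "w' \<in> W" "r \<in> carrier K" "r' \<in> carrier K" for w w' r r'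
    using that s(1) by (simp add: Wc V.smult_l_distr V.M.a_ac)
  have smult: "c \<odot>\<^bsub>V\<^esub> (w \<oplus>\<^bsub>V\<^esub> r \<odot>\<^bsub>V\<^esub> s) = c \<odot>\<^bsub>V\<^esub> w \<oplus>\<^bsub>V\<^esub> (c \<otimes>\<^bsub>K\<^esub> r) \<odot>\<^bsub>V\<^esub> s"
    if "w \<in> W" "r \<in> carrier K" "c \<in> carrier K" for w r c
    using that s(1) by (simp add: Wc V.smult_r_distr V.smult_assoc1)
  show sub: "submodule W' K V"
  proof (rule V.submoduleI')
    show "W' \<subseteq> carrier V" using s Wc by (auto simp: W'_def)
    show "\<zero>\<^bsub>V\<^esub> \<in> W'" unfolding W'_def using W0 s(1)
      by (auto intro!: exI[of _ "\<zero>\<^bsub>V\<^esub>"] exI[of _ "\<zero>\<^bsub>K\<^esub>"])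
    show "a \<oplus>\<^bsub>V\<^esub> b \<in> W'" if "a \<in> W'" "b \<in> W'" for a b
      using that We(5) add unfolding W'_def by (smt (verit) K.a_closed mem_Collect_eq)
    show "r \<odot>\<^bsub>V\<^esub> a \<in> W'" if "r \<in> carrier K" "a \<in> W'" for r a
      using that We(4) smult unfolding W'_def by (smt (verit) K.m_closed mem_Collect_eq)
  qed
  \<comment> \<open>The sum is direct: if the two coefficients differed, dividing by their
    difference would put \<open>s\<close> into \<open>W\<close>.\<close>
  have uniq: "w = w' \<and> r = r'"
    if "w \<oplus>\<^bsub>V\<^esub> r \<odot>\<^bsub>V\<^esub> s = w' \<oplus>\<^bsub>V\<^esub> r' \<odot>\<^bsub>V\<^esub> s" "w \<in> W" "w' \<in> W" "r \<in> carrier K" "r' \<in> carrier K" for w w' r r'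
  proof -
    have eq: "(r \<ominus>\<^bsub>K\<^esub> r') \<odot>\<^bsub>V\<^esub> s = w' \<ominus>\<^bsub>V\<^esub> w"
    proof -
      have "w \<oplus>\<^bsub>V\<^esub> r \<odot>\<^bsub>V\<^esub> s \<ominus>\<^bsub>V\<^esub> (w \<oplus>\<^bsub>V\<^esub> r' \<odot>\<^bsub>V\<^esub> s) = w' \<oplus>\<^bsub>V\<^esub> r' \<odot>\<^bsub>V\<^esub> s \<ominus>\<^bsub>V\<^esub> (w \<oplus>\<^bsub>V\<^esub> r' \<odot>\<^bsub>V\<^esub> s)"
        using that(1) by simp
      then show ?thesis using that(2-) s(1)
        by (simp add: Wc V.M.ag_simps K.minus_eq V.smult_l_distr V.smult_l_minus)
    qed
    have "r = r'"
    proof (rule ccontr)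
      assume "r \<noteq> r'"
      then have d: "r \<ominus>\<^bsub>K\<^esub> r' \<in> Units K" using that(4,5) by (auto simp: K.field_Units)
      have "w' \<ominus>\<^bsub>V\<^esub> w \<in> W" using that(2,3) We(3,5) by (auto simp: V.M.minus_eq)
      then have "inv\<^bsub>K\<^esub> (r \<ominus>\<^bsub>K\<^esub> r') \<odot>\<^bsub>V\<^esub> ((r \<ominus>\<^bsub>K\<^esub> r') \<odot>\<^bsub>V\<^esub> s) \<in> W"
        using d We(4) by (auto simp: eq)
      then show False
        using d s that(4,5) by (simp add: V.smult_assoc1[symmetric])
    qed
    then show ?thesis using that s(1) by (simp add: Wc)
  qed
  define \<rho> where "\<rho> x = (THE r. \<exists>w\<in>W. r \<in> carrier K \<and> x = w \<oplus>\<^bsub>V\<^esub> r \<odot>\<^bsub>V\<^esub> s)" for x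
  define \<pi> where "\<pi> x = (THE w. \<exists>r\<in>carrier K. w \<in> W \<and> x = w \<oplus>\<^bsub>V\<^esub> r \<odot>\<^bsub>V\<^esub> s)" for x
  have \<rho>: "\<rho> (w \<oplus>\<^bsub>V\<^esub> r \<odot>\<^bsub>V\<^esub> s) = r" and \<pi>: "\<pi> (w \<oplus>\<^bsub>V\<^esub> r \<odot>\<^bsub>V\<^esub> s) = w"
    if "w \<in> W" "r \<in> carrier K" for w r
    unfolding \<rho>_def \<pi>_def using that uniq by (auto intro!: the_equality)
  let ?W = "V\<lparr>carrier := W\<rparr>" and ?W' = "V\<lparr>carrier := W'\<rparr>"
  obtain \<Phi> where \<Phi>: "finite \<Phi>" "\<Phi> \<subseteq> lin_map K ?W (base_space K)"
    "\<forall>x\<in>W. (\<forall>\<phi>\<in>\<Phi>. \<phi> x = \<zero>\<^bsub>K\<^esub>) \<longrightarrow> x = \<zero>\<^bsub>V\<^esub>"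
    using fd by (auto simp: fin_functionals_def)
  let ?\<Psi> = "insert \<rho> ((\<lambda>\<phi> x. \<phi> (\<pi> x)) ` \<Phi>)"
  have \<rho>l: "\<rho> \<in> lin_map K ?W' (base_space K)"
    by (rule lin_mapI) (auto simp: W'_def \<rho> add smult We)
  have \<pi>l: "\<pi> \<in> lin_map K ?W' ?W"
    by (rule lin_mapI) (auto simp: W'_def \<pi> add smult We)
  have "?\<Psi> \<subseteq> lin_map K ?W' (base_space K)"
    using \<rho>l lin_map_comp[OF \<pi>l] \<Phi>(2) by auto
  moreover have "x = \<zero>\<^bsub>V\<^esub>" if x: "x \<in> W'" and 0: "\<forall>\<psi>\<in>?\<Psi>. \<psi> x = \<zero>\<^bsub>K\<^esub>" for x
  proof -
    obtain w r where w: "w \<in> W" "r \<in> carrier K" "x = w \<oplus>\<^bsub>V\<^esub> r \<odot>\<^bsub>V\<^esub> s" using x by (auto simp: W'_def)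
    then have "r = \<zero>\<^bsub>K\<^esub>" using 0 \<rho> by auto
    moreover have "w = \<zero>\<^bsub>V\<^esub>" using 0 w \<pi> \<Phi>(3) by auto
    ultimately show ?thesis using w s by simp
  qed
  ultimately show "fin_functionals K ?W'"
    unfolding fin_functionals_def using \<Phi>(1) by (intro exI[of _ ?\<Psi>]) auto
qed

lemma finite_dim_fin_functionals:
  assumes K: "field K" and V: "module K V" and fd: "finite_dim K V"
  shows "fin_functionals K V"
proof -
  interpret V: module K V by fact
  obtain S where S: "finite S" "S \<subseteq> carrier V"
    "\<forall>v\<in>carrier V. \<exists>c\<in>S \<rightarrow> carrier K. v = (\<Oplus>\<^bsub>V\<^esub>s\<in>S. c s \<odot>\<^bsub>V\<^esub> s)"
    using fd by (auto simp: finite_dim_def)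
  \<comment> \<open>Some subspace containing \<open>S\<close> is enough, so the step may keep
    \<open>W\<close> when the new vector already lies in it, and no basis has to be extracted from
    \<open>S\<close>.\<close>
  have "\<exists>W. submodule W K V \<and> S \<subseteq> W \<and> fin_functionals K (V\<lparr>carrier := W\<rparr>)"
    using S(1,2)
  proof (induction S rule: finite_induct)
    case empty
    have "submodule {\<zero>\<^bsub>V\<^esub>} K V" by (rule V.submoduleI') auto
    moreover have "fin_functionals K (V\<lparr>carrier := {\<zero>\<^bsub>V\<^esub>}\<rparr>)"
      by (auto simp: fin_functionals_def intro: exI[of _ "{}"])
    ultimately show ?case by blast
  next
    case (insert s S)
    then obtain W where W: "submodule W K V" "S \<subseteq> W" "fin_functionals K (V\<lparr>carrier := W\<rparr>)" by auto
    show ?case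
    proof (cases "s \<in> W")
      case True
      then show ?thesis using W by blast
    next
      case False
      let ?W' = "{w \<oplus>\<^bsub>V\<^esub> r \<odot>\<^bsub>V\<^esub> s | w r. w \<in> W \<and> r \<in> carrier K}"
      have s: "s \<in> carrier V" using insert.prems by simp
      have W0: "\<zero>\<^bsub>V\<^esub> \<in> W" using subgroup.one_closed[OF submodule.axioms(1)[OF W(1)]] by simp
      have "W \<subseteq> ?W'"
      proof
        fix w assume "w \<in> W"
        then show "w \<in> ?W'" using V.submoduleE(1)[OF W(1)] s
          by (auto intro!: exI[of _ w] exI[of _ "\<zero>\<^bsub>K\<^esub>"])
      qed
      moreover have "s \<in> ?W'"
        using W0 s by (auto intro!: exI[of _ "\<zero>\<^bsub>V\<^esub>"] exI[of _ "\<one>\<^bsub>K\<^esub>"])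
      ultimately show ?thesis
        using fin_functionals_extend[OF K V W(1) s False W(3)] W(2) by (intro exI[of _ ?W']) auto
    qed
  qed
  then obtain W where W: "submodule W K V" "S \<subseteq> W" "fin_functionals K (V\<lparr>carrier := W\<rparr>)" by auto
  have W0: "\<zero>\<^bsub>V\<^esub> \<in> W" using subgroup.one_closed[OF submodule.axioms(1)[OF W(1)]] by simp
  have "(\<Oplus>\<^bsub>V\<^esub>s\<in>T. c s \<odot>\<^bsub>V\<^esub> s) \<in> W" if "T \<subseteq> S" "c \<in> S \<rightarrow> carrier K" for c T
    using finite_subset[OF that(1) S(1)] that
  proof (induction T rule: finite_induct)
    case (insert s T)
    have "(\<lambda>s. c s \<odot>\<^bsub>V\<^esub> s) \<in> T \<rightarrow> carrier V" "c s \<odot>\<^bsub>V\<^esub> s \<in> carrier V"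
      using insert.prems S(2) by (auto simp: Pi_iff subset_iff)
    moreover have "c s \<odot>\<^bsub>V\<^esub> s \<in> W" using insert.prems W(1,2) by (auto intro!: V.submoduleE(4))
    ultimately show ?case
      using insert V.submoduleE(5)[OF W(1)] by (simp add: V.M.finsum_insert)
  qed (use W0 in simp)
  then have *: "(\<Oplus>\<^bsub>V\<^esub>s\<in>S. c s \<odot>\<^bsub>V\<^esub> s) \<in> W" if "c \<in> S \<rightarrow> carrier K" for c
    using that by simp
  have "carrier V \<subseteq> W"
  proof
    fix v assume "v \<in> carrier V"
    then show "v \<in> W" using S(3) * by force
  qed
  then show ?thesis
    by (intro fin_functionals_inj[OF W(3), of "\<lambda>x. x" V] lin_mapI) auto
qed

section \<open>Free covers, resolutions and factoring through surjections\<close>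

lemma (in right_module) free_cover:
  assumes "fin_functionals K M"
  obtains n g where "g \<in> rlin K A (power_mod n (reg_bimod A)) M"
    "g ` carrier (power_mod n (reg_bimod A)) = carrier M"
proof -
  obtain n v t where v: "\<And>j. j < n \<Longrightarrow> v j \<in> carrier M"
    and t: "\<And>j. j < n \<Longrightarrow> t j \<in> lin_map K M (base_space K)"
    and x: "\<And>x. x \<in> carrier M \<Longrightarrow> x = nsum M (\<lambda>j. t j x \<odot>\<^bsub>M\<^esub> v j) (n::nat)"
    using fin_functionals_basis[OF A.K.field_axioms M.module_axioms assms] by blast
  let ?F = "power_mod n (reg_bimod A)"
  define g where "g a = nsum M (\<lambda>j. v j \<triangleleft>\<^bsub>M\<^esub> a j) n" for a
  have F: "right_module K A ?F" by (rule power_mod_right_module[OF A.reg_right_module])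
  have "g \<in> finrank K A ?F M"
    unfolding g_def by (rule finrank_nsum[OF v]) (auto intro: power_mod_coord)
  then have g: "g \<in> rlin K A ?F M" by (rule finrank_rlin[OF F right_module_axioms])
  have "y \<in> g ` carrier ?F" if y: "y \<in> carrier M" for y
  proof (rule image_eqI)
    have ty: "t j y \<in> carrier K" if "j < n" for j using lin_mapD(1)[OF t[OF that] y] by simp
    \<comment> \<open>The coordinates of \<open>y\<close> over \<open>K\<close>, carried into
      \<open>A\<close> as multiples of the unit: vectors that span over \<open>K\<close> also
      generate over \<open>A\<close>.\<close>
    let ?a = "\<lambda>j\<in>{..<n}. t j y \<odot>\<^bsub>A\<^esub> \<one>\<^bsub>A\<^esub>"
    show "?a \<in> carrier ?F" using ty by auto
    have "nsum M (\<lambda>j. t j y \<odot>\<^bsub>M\<^esub> v j) n = g ?a"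
      unfolding g_def using ty v by (intro nsum_cong) (simp add: smult_eq_ract)
    then show "y = g ?a" using x[OF y] by simp
  qed
  then have "g ` carrier ?F = carrier M" using rlinD(2)[OF g] by blast
  with g show ?thesis using that by blast
qed

lemma (in right_module) free_cover_sub:
  assumes "fin_functionals K M" "rsubmod A M W"
  obtains n g where "g \<in> rlin K A (power_mod n (reg_bimod A)) M"
    "g ` carrier (power_mod n (reg_bimod A)) = W"
proof -
  have W: "W \<subseteq> carrier M" using assms(2) by (simp add: rsubmod_def)
  interpret W: right_module K A "M\<lparr>carrier := W\<rparr>" by (rule right_module_sub[OF assms(2)])
  obtain n g where g: "g \<in> rlin K A (power_mod n (reg_bimod A)) (M\<lparr>carrier := W\<rparr>)"
    "g ` carrier (power_mod n (reg_bimod A)) = carrier (M\<lparr>carrier := W\<rparr>)"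
    by (rule W.free_cover[OF fin_functionals_sub[OF assms(1) W]])
  show ?thesis
    by (rule that[OF rlin_comp[OF g(1) rlin_incl[OF W]]]) (use g(2) in simp)
qed

text \<open>All terms are taken free, so a term is given by its rank. Finite dimension makes every
  kernel the image of a free module of finite rank, and dependent choice strings the covers
  together.\<close>

lemma proj_resolution_exists:
  fixes K :: "('k, 'r) ring_scheme" and A :: "('k, 'a, 's) module_scheme"
    and M :: "('k, 'm, 'a, 'z) rmod_scheme"
  assumes A: "k_algebra K A" and M: "right_module K A M"
    and fA: "fin_functionals K A" and fM: "fin_functionals K M"
  shows "\<exists>R :: ('k, nat \<Rightarrow> 'a, 'a, 'm) resolution. proj_resolution K A M R"
proof -
  interpret A: k_algebra K A by fact
  interpret M: right_module K A M by fact
  define F where "F n = power_mod n (reg_bimod A)" for n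
  have F: "right_module K A (F n)" for n
    unfolding F_def by (rule power_mod_right_module[OF A.reg_right_module])
  have "fin_functionals K (reg_bimod A)"
    by (rule fin_functionals_inj[OF fA, of "\<lambda>x. x"]) (auto intro: lin_mapI)
  then have fF: "fin_functionals K (F n)" for n
    unfolding F_def by (rule fin_functionals_power)
  obtain n0 aug where aug: "aug \<in> rlin K A (F n0) M" "aug ` carrier (F n0) = carrier M"
    by (rule M.free_cover[OF fM, folded F_def])
  \<comment> \<open>A state \<open>(n, n', d)\<close> records a differential \<open>d\<close> from
    \<open>F n'\<close> to \<open>F n\<close>. At index 0 it must cover the kernel of the
    augmentation; \<open>Q\<close> makes the next state end where this one begins and cover the
    kernel of its differential.\<close>
  define P where "P i s \<longleftrightarrow> (case s of (n, n', d) \<Rightarrow> d \<in> rlin K A (F n') (F n) \<and>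
      (i = 0 \<longrightarrow> n = n0 \<and> d ` carrier (F n') = {x \<in> carrier (F n0). aug x = \<zero>\<^bsub>M\<^esub>}))"
    for i :: nat and s :: "nat \<times> nat \<times> ((nat \<Rightarrow> 'a) \<Rightarrow> nat \<Rightarrow> 'a)"
  define Q where "Q s s' \<longleftrightarrow> fst s' = fst (snd s) \<and>
      snd (snd s') ` carrier (F (fst (snd s'))) = {x \<in> carrier (F (fst s')). snd (snd s) x = \<zero>\<^bsub>F (fst s)\<^esub>}"
    for s s' :: "nat \<times> nat \<times> ((nat \<Rightarrow> 'a) \<Rightarrow> nat \<Rightarrow> 'a)"
  have "\<exists>f. \<forall>i. P i (f i) \<and> Q (f i) (f (Suc i))"
  proof (rule dependent_nat_choice)
    interpret F0: right_module K A "F n0" by (rule F)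
    obtain n d where "d \<in> rlin K A (F n) (F n0)" "d ` carrier (F n) = {x \<in> carrier (F n0). aug x = \<zero>\<^bsub>M\<^esub>}"
      by (rule F0.free_cover_sub[OF fF rsubmod_ker[OF aug(1) F M], folded F_def])
    then have "P 0 (n0, n, d)" by (simp add: P_def)
    then show "\<exists>s. P 0 s" ..
  next
    fix s i assume "P i s"
    then obtain n n' d where s: "s = (n, n', d)" and d: "d \<in> rlin K A (F n') (F n)"
      by (auto simp: P_def split: prod.splits)
    interpret F0: right_module K A "F n'" by (rule F)
    obtain m e where "e \<in> rlin K A (F m) (F n')" "e ` carrier (F m) = {x \<in> carrier (F n'). d x = \<zero>\<^bsub>F n\<^esub>}"
      by (rule F0.free_cover_sub[OF fF rsubmod_ker[OF d F F], folded F_def])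
    then have "P (Suc i) (n', m, e) \<and> Q s (n', m, e)" by (simp add: P_def Q_def s)
    then show "\<exists>s'. P (Suc i) s' \<and> Q s s'" ..
  qed
  then obtain f where f: "\<And>i. P i (f i)" "\<And>i. Q (f i) (f (Suc i))" by blast
  define N where "N i = fst (f i)" for i
  define d where "d i = snd (snd (f i))" for i
  have NS: "fst (snd (f i)) = N (Suc i)" for i using f(2)[of i] by (simp add: Q_def N_def)
  have d: "d i \<in> rlin K A (F (N (Suc i))) (F (N i))" for i
    using f(1)[of i] NS[of i] by (simp add: P_def N_def d_def split: prod.splits)
  have N0: "N 0 = n0" and im0: "d 0 ` carrier (F (N (Suc 0))) = {x \<in> carrier (F n0). aug x = \<zero>\<^bsub>M\<^esub>}"
    using f(1)[of 0] NS[of 0] by (simp_all add: P_def N_def d_def split: prod.splits)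
  have im: "d (Suc i) ` carrier (F (N (Suc (Suc i)))) = {x \<in> carrier (F (N (Suc i))). d i x = \<zero>\<^bsub>F (N i)\<^esub>}" for i
    using f(2)[of i] NS[of "Suc i"] by (simp add: Q_def N_def d_def)
  define R :: "('k, nat \<Rightarrow> 'a, 'a, 'm) resolution" where
    "R = \<lparr>res_obj = \<lambda>i. F (N i), res_diff = \<lambda>i. restrict (d i) (carrier (F (N (Suc i)))),
      res_aug = restrict aug (carrier (F n0))\<rparr>"
  have "proj_resolution K A M R"
    unfolding proj_resolution_def
  proof (intro conjI allI)
    show "projective K A (res_obj R i)" for i by (simp add: R_def F_def A.free_projective)
    show "res_diff R i \<in> rmod_hom K A (res_obj R (Suc i)) (res_obj R i)" for i
      using rlin_restrict[OF d F] by (simp add: R_def)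
    show "res_aug R \<in> rmod_hom K A (res_obj R 0) M"
      using rlin_restrict[OF aug(1) F] by (simp add: R_def N0)
    show "res_aug R ` carrier (res_obj R 0) = carrier M"
      using aug(2) by (simp add: R_def N0)
    show "res_diff R 0 ` carrier (res_obj R 1) = {x \<in> carrier (res_obj R 0). res_aug R x = \<zero>\<^bsub>M\<^esub>}"
      using im0 by (simp add: R_def N0 cong: conj_cong)
    show "res_diff R (Suc i) ` carrier (res_obj R (Suc (Suc i))) =
        {x \<in> carrier (res_obj R (Suc i)). res_diff R i x = \<zero>\<^bsub>res_obj R i\<^esub>}" for i
      using im[of i] by (simp add: R_def cong: conj_cong)
  qed
  then show ?thesis ..
qed

lemma rlin_factor:
  assumes P: "right_module K A P" and Q: "right_module K A Q" and N: "right_module K A N"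
    and e: "e \<in> rlin K A P Q" and surj: "e ` carrier P = carrier Q" and f: "f \<in> rlin K A P N"
    and ker: "\<And>x. x \<in> carrier P \<Longrightarrow> e x = \<zero>\<^bsub>Q\<^esub> \<Longrightarrow> f x = \<zero>\<^bsub>N\<^esub>"
  obtains g where "g \<in> rlin K A Q N" "\<And>x. x \<in> carrier P \<Longrightarrow> g (e x) = f x"
proof -
  interpret P: right_module K A P by fact
  interpret Q: right_module K A Q by fact
  interpret N: right_module K A N by fact
  define h where "h y = (SOME x. x \<in> carrier P \<and> e x = y)" for y
  have h: "h y \<in> carrier P" "e (h y) = y" if "y \<in> carrier Q" for y
  proof -
    have "y \<in> e ` carrier P" using that surj by simp
    then have "\<exists>x. x \<in> carrier P \<and> e x = y" by (auto simp: image_iff)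
    from someI_ex[OF this] show "h y \<in> carrier P" "e (h y) = y" by (simp_all add: h_def)
  qed
  have fe: "f x = f y" if "x \<in> carrier P" "y \<in> carrier P" "e x = e y" for x y
  proof -
    have "e (x \<ominus>\<^bsub>P\<^esub> y) = \<zero>\<^bsub>Q\<^esub>"
      using that rlin_group(3)[OF e P Q] rlinD(2)[OF e] by (simp add: Q.M.M.minus_eq Q.M.M.r_neg)
    then have "f x \<ominus>\<^bsub>N\<^esub> f y = \<zero>\<^bsub>N\<^esub>"
      using ker[of "x \<ominus>\<^bsub>P\<^esub> y"] that rlin_group(3)[OF f P N] by simp
    then show ?thesis using rlinD(2)[OF f] that by (simp add: N.M.M.diff_eq_zero_iff)
  qed
  define g where "g y = f (h y)" for y
  \<comment> \<open>The choice of preimage is immaterial, so additivity and linearity of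
    \<open>g\<close> may be read off at images under \<open>e\<close>, although \<open>h\<close> is
    not linear.\<close>
  have ge: "g (e x) = f x" if "x \<in> carrier P" for x
    unfolding g_def using that h[of "e x"] rlinD(2)[OF e] by (intro fe) auto
  have "g \<in> rlin K A Q N"
  proof (rule rlinI[OF Q N])
    fix x y a assume x: "x \<in> carrier Q" 
    show "g x \<in> carrier N" using h[OF x] rlinD(2)[OF f] by (simp add: g_def)
    { assume y: "y \<in> carrier Q"
      have "g (e (h x \<oplus>\<^bsub>P\<^esub> h y)) = g x \<oplus>\<^bsub>N\<^esub> g y"
        using h[OF x] h[OF y] rlinD(3)[OF f] by (simp add: ge) (simp add: g_def)
      then show "g (x \<oplus>\<^bsub>Q\<^esub> y) = g x \<oplus>\<^bsub>N\<^esub> g y" using h[OF x] h[OF y] rlinD(3)[OF e] by simp }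
    { assume a: "a \<in> carrier A"
      have "g (e (h x \<triangleleft>\<^bsub>P\<^esub> a)) = g x \<triangleleft>\<^bsub>N\<^esub> a"
        using h[OF x] a rlinD(5)[OF f] by (simp add: ge P.ract_closed) (simp add: g_def)
      then show "g (x \<triangleleft>\<^bsub>Q\<^esub> a) = g x \<triangleleft>\<^bsub>N\<^esub> a" using h[OF x] a rlinD(5)[OF e] by simp }
  qed
  then show ?thesis using that ge by blast
qed


section \<open>Connections\<close>

text \<open>Linear maps satisfying the Leibniz rule over a derivation \<open>\<delta>\<close> of the algebra; for
  \<open>\<delta> = 0\<close> these are the module endomorphisms, so that one lifting lemma serves both for chain
  maps and for lifts of derivations.\<close>

definition conn :: "('k, 'r) ring_scheme \<Rightarrow> ('k, 'a, 's) module_scheme \<Rightarrow> ('a \<Rightarrow> 'a) \<Rightarrow>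
    ('k, 'm, 'a, 'z) rmod_scheme \<Rightarrow> ('m \<Rightarrow> 'm) set" where
  "conn K A \<delta> M = {D \<in> lin_map K M M. \<forall>x\<in>carrier M. \<forall>a\<in>carrier A.
     D (x \<triangleleft>\<^bsub>M\<^esub> a) = (D x \<triangleleft>\<^bsub>M\<^esub> a) \<oplus>\<^bsub>M\<^esub> (x \<triangleleft>\<^bsub>M\<^esub> \<delta> a)}"

lemma connD:
  assumes "D \<in> conn K A \<delta> M"
  shows "D \<in> lin_map K M M"
    and "x \<in> carrier M \<Longrightarrow> D x \<in> carrier M"
    and "x \<in> carrier M \<Longrightarrow> y \<in> carrier M \<Longrightarrow> D (x \<oplus>\<^bsub>M\<^esub> y) = D x \<oplus>\<^bsub>M\<^esub> D y"
    and "r \<in> carrier K \<Longrightarrow> x \<in> carrier M \<Longrightarrow> D (r \<odot>\<^bsub>M\<^esub> x) = r \<odot>\<^bsub>M\<^esub> D x"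
    and "x \<in> carrier M \<Longrightarrow> a \<in> carrier A \<Longrightarrow> D (x \<triangleleft>\<^bsub>M\<^esub> a) = (D x \<triangleleft>\<^bsub>M\<^esub> a) \<oplus>\<^bsub>M\<^esub> (x \<triangleleft>\<^bsub>M\<^esub> \<delta> a)"
  using assms by (auto simp: conn_def lin_map_def)

lemma (in right_module) conn_zero: "conn K A (\<lambda>_. \<zero>\<^bsub>A\<^esub>) M = rlin K A M M"
  by (auto simp: conn_def rlin_def ract_simps lin_map_def Pi_iff)

text \<open>For \<open>e\<close> the identity, \<open>G\<close> is a connection on \<open>P\<close>
  over \<open>D\<close>. The induction forces \<open>e\<close> into the Leibniz term: a partial sum
  of the dual basis only differentiates the part of \<open>y\<close> it represents. As
  \<open>f\<close> need not be onto, \<open>im\<close> supplies the preimages.\<close>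

lemma finrank_connection:
  assumes P: "right_module K A P" and Q: "right_module K A Q"
    and \<delta>: "\<delta> \<in> derivations K A (reg_bimod A)"
    and f: "f \<in> rlin K A P Q" and D: "D \<in> conn K A \<delta> Q" and im: "D ` f ` carrier P \<subseteq> f ` carrier P"
    and e: "e \<in> finrank K A P P"
  shows "\<exists>G\<in>lin_map K P P. \<forall>y\<in>carrier P. f (G y) = D (f (e y)) \<and>
    (\<forall>a\<in>carrier A. G (y \<triangleleft>\<^bsub>P\<^esub> a) = (G y \<triangleleft>\<^bsub>P\<^esub> a) \<oplus>\<^bsub>P\<^esub> (e y \<triangleleft>\<^bsub>P\<^esub> \<delta> a))"
  using e
proof induction
  interpret P: right_module K A P by fact
  interpret Q: right_module K A Q by fact
  interpret R: bimodule K A "reg_bimod A" by (rule P.A.bimodule_reg)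
  note \<delta>l = lin_mapD[OF R.derivationsD(1)[OF \<delta>], simplified]
  note \<delta>m = R.derivationsD(3)[OF \<delta>, simplified]
  note fl = rlinD[OF f]
  {
    case (finrank_zero e)
    show ?case
    proof (intro bexI ballI conjI)
      show z: "(\<lambda>_. \<zero>\<^bsub>P\<^esub>) \<in> lin_map K P P" by (rule lin_mapI) auto
      fix y a assume y: "y \<in> carrier P"
      show "f \<zero>\<^bsub>P\<^esub> = D (f (e y))"
        using y finrank_zero rlin_group(1)[OF f P Q] lin_map_group(1)[OF connD(1)[OF D] Q.M.module_axioms Q.M.module_axioms]
        by simp
      show "\<zero>\<^bsub>P\<^esub> = \<zero>\<^bsub>P\<^esub> \<triangleleft>\<^bsub>P\<^esub> a \<oplus>\<^bsub>P\<^esub> e y \<triangleleft>\<^bsub>P\<^esub> \<delta> a" if "a \<in> carrier A"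
        using y that finrank_zero \<delta>l(1) by (simp add: P.ract_simps)
    qed
  next
    case (finrank_step e p \<phi> e')
    obtain G where G: "G \<in> lin_map K P P" and
      fG: "\<And>y. y \<in> carrier P \<Longrightarrow> f (G y) = D (f (e y))" and
      Ga: "\<And>y a. y \<in> carrier P \<Longrightarrow> a \<in> carrier A \<Longrightarrow> G (y \<triangleleft>\<^bsub>P\<^esub> a) = (G y \<triangleleft>\<^bsub>P\<^esub> a) \<oplus>\<^bsub>P\<^esub> (e y \<triangleleft>\<^bsub>P\<^esub> \<delta> a)"
      using finrank_step.IH by blast
    have "D (f p) \<in> f ` carrier P" using im finrank_step(2) by blast
    then obtain q where q: "q \<in> carrier P" "f q = D (f p)" by auto
    note p = finrank_step(2)
    note \<phi> = rlin_regD[OF finrank_step(3)]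
    note Gl = lin_mapD[OF G]
    have ec: "e y \<in> carrier P" if "y \<in> carrier P" for y using rlinD(2)[OF finrank_rlin[OF P P finrank_step(1)] that] .
    have e': "e' y = e y \<oplus>\<^bsub>P\<^esub> (p \<triangleleft>\<^bsub>P\<^esub> \<phi> y)" if "y \<in> carrier P" for y using finrank_step(4) that by blast
    \<comment> \<open>The formal derivative of the new summand: \<open>q\<close> stands for the
      derivative of \<open>p\<close>, and the second term differentiates the coefficient.\<close>
    let ?G = "\<lambda>y. G y \<oplus>\<^bsub>P\<^esub> ((q \<triangleleft>\<^bsub>P\<^esub> \<phi> y) \<oplus>\<^bsub>P\<^esub> (p \<triangleleft>\<^bsub>P\<^esub> \<delta> (\<phi> y)))"
    show ?case
    proof (intro bexI[of _ ?G] ballI conjI)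
      show "?G \<in> lin_map K P P"
        by (rule lin_mapI) (simp_all add: Gl \<phi> \<delta>l p q P.ract_simps P.M.M.a_ac P.M.smult_r_distr)
      fix y assume y: "y \<in> carrier P"
      have c: "\<phi> y \<in> carrier A" "\<delta> (\<phi> y) \<in> carrier A" "G y \<in> carrier P" "e y \<in> carrier P"
        using y \<phi> \<delta>l(1) Gl(1) ec by auto
      have "f (?G y) = D (f (e y)) \<oplus>\<^bsub>Q\<^esub> (D (f p) \<triangleleft>\<^bsub>Q\<^esub> \<phi> y \<oplus>\<^bsub>Q\<^esub> f p \<triangleleft>\<^bsub>Q\<^esub> \<delta> (\<phi> y))"
        using y c p q fG by (simp add: fl P.ract_closed)
      also have "\<dots> = D (f (e y)) \<oplus>\<^bsub>Q\<^esub> D (f p \<triangleleft>\<^bsub>Q\<^esub> \<phi> y)"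
        using y c p connD(5)[OF D, of "f p" "\<phi> y"] fl(2) by simp
      also have "\<dots> = D (f (e' y))"
        using y c p connD(3)[OF D] by (simp add: e' fl P.ract_closed Q.ract_closed)
      finally show "f (?G y) = D (f (e' y))" .
      fix a assume a: "a \<in> carrier A"
      show "?G (y \<triangleleft>\<^bsub>P\<^esub> a) = (?G y \<triangleleft>\<^bsub>P\<^esub> a) \<oplus>\<^bsub>P\<^esub> (e' y \<triangleleft>\<^bsub>P\<^esub> \<delta> a)"
        using y a c p q \<delta>l(1)[of a]
        by (simp add: Ga \<phi> \<delta>m P.ract_simps P.ract_assoc e' P.M.M.a_ac)
    qed
  }
qed

lemma conn_lift:
  assumes P: "fg_projective K A P" and Q: "right_module K A Q"
    and \<delta>: "\<delta> \<in> derivations K A (reg_bimod A)"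
    and f: "f \<in> rlin K A P Q" and D: "D \<in> conn K A \<delta> Q" and im: "D ` f ` carrier P \<subseteq> f ` carrier P"
  obtains G where "G \<in> conn K A \<delta> P" "\<And>y. y \<in> carrier P \<Longrightarrow> f (G y) = D (f y)"
  using finrank_connection[OF _ Q \<delta> f D im, of "\<lambda>y. y"] P that
  by (auto simp: fg_projective_def conn_def)

lemma (in k_algebra) zero_derivation: "(\<lambda>a\<in>carrier A. \<zero>\<^bsub>A\<^esub>) \<in> derivations K A (reg_bimod A)"
proof -
  interpret R: bimodule K A "reg_bimod A" by (rule bimodule_reg)
  have "\<zero>\<^bsub>R.DerS\<^esub> \<in> carrier R.DerS"
    using R.derivation_space_module by (simp add: module_def abelian_group_def abelian_monoid.zero_closed)
  then show ?thesis by (simp add: R.derivation_space_simps)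
qed

section \<open>Lifting along a projective resolution\<close>

locale resolved = right_module K A M
  for K :: "('k, 'r) ring_scheme" and A :: "('k, 'a, 's) module_scheme"
    and M :: "('k, 'm, 'a, 'z) rmod_scheme" (structure)
    and R :: "('k, 'p, 'a, 'm) resolution" +
  assumes resolution: "proj_resolution K A M R"
begin

abbreviation "Q \<equiv> res_obj R"
abbreviation "d \<equiv> res_diff R"
abbreviation "aug \<equiv> res_aug R"

lemma Q_proj: "fg_projective K A (Q n)"
  using resolution A.projective_fg_projective by (auto simp: proj_resolution_def)

lemma Q_mod: "right_module K A (Q n)"
  using Q_proj by (simp add: fg_projective_def)

lemma d_rlin: "d n \<in> rlin K A (Q (Suc n)) (Q n)"
  using resolution by (auto simp: proj_resolution_def rmod_hom_eq_rlin)

lemma aug_rlin: "aug \<in> rlin K A (Q 0) M"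
  using resolution by (auto simp: proj_resolution_def rmod_hom_eq_rlin)

lemma aug_surj: "aug ` carrier (Q 0) = carrier M"
  using resolution by (simp add: proj_resolution_def)

lemma exact_zero: "d 0 ` carrier (Q (Suc 0)) = {x \<in> carrier (Q 0). aug x = \<zero>\<^bsub>M\<^esub>}"
  using resolution by (simp add: proj_resolution_def)

lemma exact_Suc: "d (Suc n) ` carrier (Q (Suc (Suc n))) = {x \<in> carrier (Q (Suc n)). d n x = \<zero>\<^bsub>Q n\<^esub>}"
  using resolution by (simp add: proj_resolution_def)

lemma aug_d: "x \<in> carrier (Q (Suc 0)) \<Longrightarrow> aug (d 0 x) = \<zero>\<^bsub>M\<^esub>"
  using exact_zero by blast

lemma d_d: "x \<in> carrier (Q (Suc (Suc n))) \<Longrightarrow> d n (d (Suc n) x) = \<zero>\<^bsub>Q n\<^esub>"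
  using exact_Suc[of n] by blast

definition conn_chain :: "('a \<Rightarrow> 'a) \<Rightarrow> ('m \<Rightarrow> 'm) \<Rightarrow> (nat \<Rightarrow> 'p \<Rightarrow> 'p) \<Rightarrow> bool" where
  "conn_chain \<delta> D l \<longleftrightarrow> (\<forall>n. l n \<in> conn K A \<delta> (Q n)) \<and>
     (\<forall>x\<in>carrier (Q 0). aug (l 0 x) = D (aug x)) \<and>
     (\<forall>n. \<forall>x\<in>carrier (Q (Suc n)). d n (l (Suc n) x) = l n (d n x))"

lemma conn_chainD:
  assumes "conn_chain \<delta> D l"
  shows "l n \<in> conn K A \<delta> (Q n)"
    and "x \<in> carrier (Q 0) \<Longrightarrow> aug (l 0 x) = D (aug x)"
    and "x \<in> carrier (Q (Suc n)) \<Longrightarrow> d n (l (Suc n) x) = l n (d n x)"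
  using assms by (auto simp: conn_chain_def)

lemma conn_zero_at: "D \<in> conn K A \<delta> (Q n) \<Longrightarrow> D \<zero>\<^bsub>Q n\<^esub> = \<zero>\<^bsub>Q n\<^esub>"
  using lin_map_group(1)[OF connD(1) right_module.axioms(2)[OF Q_mod] right_module.axioms(2)[OF Q_mod]] by blast

lemma conn_chain_exists:
  assumes \<delta>: "\<delta> \<in> derivations K A (reg_bimod A)" and D: "D \<in> conn K A \<delta> M"
  shows "\<exists>l. conn_chain \<delta> D l"
proof -
  \<comment> \<open>The last clause, that \<open>G\<close> preserves the image of
    \<open>d n\<close>, is the invariant that the next application of \<open>conn_lift\<close>
    requires.\<close>
  define P where "P n G \<longleftrightarrow> G \<in> conn K A \<delta> (Q n) \<and> (n = 0 \<longrightarrow> (\<forall>x\<in>carrier (Q 0). aug (G x) = D (aug x))) \<and>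
    (\<forall>x\<in>carrier (Q (Suc n)). G (d n x) \<in> d n ` carrier (Q (Suc n)))" for n G
  have "\<exists>l. \<forall>n. P n (l n) \<and> (\<forall>x\<in>carrier (Q (Suc n)). d n (l (Suc n) x) = l n (d n x))"
  proof (rule dependent_nat_choice)
    have "D ` aug ` carrier (Q 0) \<subseteq> aug ` carrier (Q 0)"
      using connD(2)[OF D] by (auto simp: aug_surj)
    then obtain G where G: "G \<in> conn K A \<delta> (Q 0)" "\<And>y. y \<in> carrier (Q 0) \<Longrightarrow> aug (G y) = D (aug y)"
      using conn_lift[OF Q_proj right_module_axioms \<delta> aug_rlin D] by metis
    have D0: "D \<zero>\<^bsub>M\<^esub> = \<zero>\<^bsub>M\<^esub>"
      by (rule lin_map_group(1)[OF connD(1)[OF D] M.module_axioms M.module_axioms])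
    have "G (d 0 x) \<in> d 0 ` carrier (Q (Suc 0))" if "x \<in> carrier (Q (Suc 0))" for x
      using that rlinD(2)[OF d_rlin, of x 0] by (simp add: exact_zero connD(2)[OF G(1)] G(2) aug_d D0)
    then show "\<exists>G. P 0 G" using G by (intro exI[of _ G]) (simp add: P_def)
  next
    fix G n assume P: "P n G"
    have G: "G \<in> conn K A \<delta> (Q n)" using P by (simp add: P_def)
    have "G ` d n ` carrier (Q (Suc n)) \<subseteq> d n ` carrier (Q (Suc n))" using P by (auto simp: P_def)
    then obtain G' where G': "G' \<in> conn K A \<delta> (Q (Suc n))"
      "\<And>y. y \<in> carrier (Q (Suc n)) \<Longrightarrow> d n (G' y) = G (d n y)"
      using conn_lift[OF Q_proj Q_mod \<delta> d_rlin G] by metis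
    have "G' (d (Suc n) x) \<in> d (Suc n) ` carrier (Q (Suc (Suc n)))" if "x \<in> carrier (Q (Suc (Suc n)))" for x
      using that rlinD(2)[OF d_rlin, of x "Suc n"]
      by (simp add: exact_Suc connD(2)[OF G'(1)] G'(2) d_d conn_zero_at[OF G])
    then show "\<exists>G'. P (Suc n) G' \<and> (\<forall>x\<in>carrier (Q (Suc n)). d n (G' x) = G (d n x))"
      using G' by (intro exI[of _ G']) (simp add: P_def)
  qed
  then obtain l where "\<And>n. P n (l n)" "\<And>n. \<forall>x\<in>carrier (Q (Suc n)). d n (l (Suc n) x) = l n (d n x)"
    by blast
  then show ?thesis unfolding conn_chain_def P_def by (intro exI[of _ l]) auto
qed

text \<open>\<open>chain_lift\<close> with \<open>rlin\<close> for \<open>rmod_hom\<close>, so that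
  sums, differences and composites of lifts are again lifts without restricting them.\<close>

definition chain :: "('m \<Rightarrow> 'm) \<Rightarrow> (nat \<Rightarrow> 'p \<Rightarrow> 'p) \<Rightarrow> bool" where
  "chain h l \<longleftrightarrow> (\<forall>n. l n \<in> rlin K A (Q n) (Q n)) \<and>
     (\<forall>x\<in>carrier (Q 0). aug (l 0 x) = h (aug x)) \<and>
     (\<forall>n. \<forall>x\<in>carrier (Q (Suc n)). d n (l (Suc n) x) = l n (d n x))"

lemma chainD:
  assumes "chain h l"
  shows "l n \<in> rlin K A (Q n) (Q n)"
    and "x \<in> carrier (Q 0) \<Longrightarrow> aug (l 0 x) = h (aug x)"
    and "x \<in> carrier (Q (Suc n)) \<Longrightarrow> d n (l (Suc n) x) = l n (d n x)"
  using assms by (auto simp: chain_def)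

lemma chain_lift_chain: "chain_lift K A R h l \<Longrightarrow> chain h l"
  by (auto simp: chain_lift_def chain_def rmod_hom_eq_rlin)

lemma chain_lift_exists:
  assumes h: "h \<in> rlin K A M M"
  shows "\<exists>l. chain_lift K A R h l"
proof -
  \<comment> \<open>As a member of \<open>derivations\<close> the zero map has to be extensional; on
    the carrier it agrees with the constant zero, which is all that \<open>conn\<close>
    sees.\<close>
  have eq: "conn K A (\<lambda>a\<in>carrier A. \<zero>\<^bsub>A\<^esub>) N = conn K A (\<lambda>_. \<zero>\<^bsub>A\<^esub>) N" for N :: "('k, 'n, 'a, 'y) rmod_scheme"
    by (simp add: conn_def)
  have "h \<in> conn K A (\<lambda>a\<in>carrier A. \<zero>\<^bsub>A\<^esub>) M" using h by (simp add: eq conn_zero)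
  then obtain l where l: "conn_chain (\<lambda>a\<in>carrier A. \<zero>\<^bsub>A\<^esub>) h l"
    using conn_chain_exists[OF A.zero_derivation] by blast
  have ll: "l n \<in> rlin K A (Q n) (Q n)" for n
    using conn_chainD(1)[OF l, of n] by (simp add: eq right_module.conn_zero[OF Q_mod])
  have "chain_lift K A R h (\<lambda>n. restrict (l n) (carrier (Q n)))"
    unfolding chain_lift_def
    using rlin_restrict[OF ll Q_mod] rlinD(2)[OF d_rlin] rlinD(2)[OF ll]
    by (auto simp: conn_chainD(2,3)[OF l])
  then show ?thesis by blast
qed

lemma chain_diff:
  assumes l: "chain h l" and l': "chain h' l'"
  shows "chain (\<lambda>x. h x \<ominus>\<^bsub>M\<^esub> h' x) (\<lambda>n x. l n x \<ominus>\<^bsub>Q n\<^esub> l' n x)"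
  unfolding chain_def
proof (intro conjI allI ballI)
  show "(\<lambda>x. l n x \<ominus>\<^bsub>Q n\<^esub> l' n x) \<in> rlin K A (Q n) (Q n)" for n
    by (rule rlin_diff[OF chainD(1)[OF l] chainD(1)[OF l'] Q_mod Q_mod])
  show "aug (l 0 x \<ominus>\<^bsub>Q 0\<^esub> l' 0 x) = h (aug x) \<ominus> h' (aug x)" if "x \<in> carrier (Q 0)" for x
    using that rlin_group(3)[OF aug_rlin Q_mod right_module_axioms] rlinD(2)[OF chainD(1)[OF l]] rlinD(2)[OF chainD(1)[OF l']]
    by (simp add: chainD(2)[OF l] chainD(2)[OF l'])
  show "d n (l (Suc n) x \<ominus>\<^bsub>Q (Suc n)\<^esub> l' (Suc n) x) = l n (d n x) \<ominus>\<^bsub>Q n\<^esub> l' n (d n x)"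
    if "x \<in> carrier (Q (Suc n))" for n x
    using that rlin_group(3)[OF d_rlin Q_mod Q_mod] rlinD(2)[OF chainD(1)[OF l]] rlinD(2)[OF chainD(1)[OF l']]
    by (simp add: chainD(3)[OF l] chainD(3)[OF l'])
qed

text \<open>Half of the usual homotopy formula: \<open>l (Suc n)\<close> and \<open>h\<close> after
  \<open>d n\<close> differ by a cycle. This is enough, as cocycles vanish on cycles by exactness.
  In the step the difference is a map into the cycles, and projectivity lifts it through the next
  differential.\<close>

lemma null_homotopy:
  assumes l: "chain (\<lambda>_. \<zero>\<^bsub>M\<^esub>) l"
  shows "\<exists>h\<in>rlin K A (Q n) (Q (Suc n)). \<forall>x\<in>carrier (Q (Suc n)). d n (l (Suc n) x) = d n (h (d n x))"
proof (induction n)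
  case 0
  have "l 0 ` carrier (Q 0) \<subseteq> d 0 ` carrier (Q (Suc 0))"
    using rlinD(2)[OF chainD(1)[OF l]] chainD(2)[OF l] by (auto simp: exact_zero)
  then obtain h where h: "h \<in> rlin K A (Q 0) (Q (Suc 0))" "\<And>y. y \<in> carrier (Q 0) \<Longrightarrow> d 0 (h y) = l 0 y"
    using fg_projective_lift[OF Q_proj Q_mod Q_mod chainD(1)[OF l] d_rlin] by metis
  then show ?case
    using chainD(3)[OF l] rlinD(2)[OF d_rlin] by (intro bexI[OF _ h(1)]) auto
next
  case (Suc n)
  interpret Q0: right_module K A "Q n" by (rule Q_mod)
  interpret Q1: right_module K A "Q (Suc n)" by (rule Q_mod)
  obtain h where h: "h \<in> rlin K A (Q n) (Q (Suc n))"
    and dh: "\<And>x. x \<in> carrier (Q (Suc n)) \<Longrightarrow> d n (l (Suc n) x) = d n (h (d n x))" using Suc by blast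
  let ?g = "\<lambda>x. l (Suc n) x \<ominus>\<^bsub>Q (Suc n)\<^esub> h (d n x)"
  have hd: "(\<lambda>x. h (d n x)) \<in> rlin K A (Q (Suc n)) (Q (Suc n))" by (rule rlin_comp[OF d_rlin h])
  have g: "?g \<in> rlin K A (Q (Suc n)) (Q (Suc n))"
    by (rule rlin_diff[OF chainD(1)[OF l] hd Q_mod Q_mod])
  have "d n (?g x) = \<zero>\<^bsub>Q n\<^esub>" if "x \<in> carrier (Q (Suc n))" for x
    using that rlin_group(3)[OF d_rlin Q_mod Q_mod] rlinD(2)[OF chainD(1)[OF l]] rlinD(2)[OF hd] rlinD(2)[OF d_rlin]
    by (simp add: dh Q0.M.M.minus_eq Q0.M.M.r_neg)
  then have "?g ` carrier (Q (Suc n)) \<subseteq> d (Suc n) ` carrier (Q (Suc (Suc n)))"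
    using rlinD(2)[OF g] by (auto simp: exact_Suc)
  then obtain h' where h': "h' \<in> rlin K A (Q (Suc n)) (Q (Suc (Suc n)))"
    "\<And>y. y \<in> carrier (Q (Suc n)) \<Longrightarrow> d (Suc n) (h' y) = ?g y"
    using fg_projective_lift[OF Q_proj Q_mod Q_mod g d_rlin] by metis
  show ?case
  proof (intro bexI[OF _ h'(1)] ballI)
    fix x assume x: "x \<in> carrier (Q (Suc (Suc n)))"
    have dx: "d (Suc n) x \<in> carrier (Q (Suc n))" using x rlinD(2)[OF d_rlin] by auto
    show "d (Suc n) (l (Suc (Suc n)) x) = d (Suc n) (h' (d (Suc n) x))"
      using x dx rlinD(2)[OF chainD(1)[OF l] dx] rlin_group(1)[OF h Q_mod Q_mod]
      by (simp add: chainD(3)[OF l] h'(2) d_d Q1.M.M.minus_eq Q1.M.M.a_inv_zero)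
  qed
qed

lemma cocycle_factor:
  assumes "f \<in> rlin K A (Q (Suc n)) N" "right_module K A N"
    and "\<And>x. x \<in> carrier (Q (Suc (Suc n))) \<Longrightarrow> f (d (Suc n) x) = \<zero>\<^bsub>N\<^esub>"
    and "x \<in> carrier (Q (Suc n))" "d n x = \<zero>\<^bsub>Q n\<^esub>"
  shows "f x = \<zero>\<^bsub>N\<^esub>"
proof -
  have "x \<in> d (Suc n) ` carrier (Q (Suc (Suc n)))" using assms(4,5) by (simp add: exact_Suc)
  then show ?thesis using assms(3) by auto
qed

text \<open>Lifts of the zero map act on Ext by zero: \<open>f\<close> composed with the homotopy
  \<open>h\<close> is the map \<open>g\<close> that exhibits the coboundary.\<close>

lemma null_homotopic_cocycle:
  assumes l: "chain (\<lambda>_. \<zero>\<^bsub>M\<^esub>) l" and N: "right_module K A N" and f: "f \<in> rlin K A (Q (Suc n)) N"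
    and f0: "\<And>x. x \<in> carrier (Q (Suc (Suc n))) \<Longrightarrow> f (d (Suc n) x) = \<zero>\<^bsub>N\<^esub>"
  obtains g where "g \<in> rlin K A (Q n) N" "\<And>x. x \<in> carrier (Q (Suc n)) \<Longrightarrow> f (l (Suc n) x) = g (d n x)"
proof -
  interpret Q0: right_module K A "Q n" by (rule Q_mod)
  interpret Q1: right_module K A "Q (Suc n)" by (rule Q_mod)
  interpret N: right_module K A N by fact
  obtain h where h: "h \<in> rlin K A (Q n) (Q (Suc n))"
    and dh: "\<And>x. x \<in> carrier (Q (Suc n)) \<Longrightarrow> d n (l (Suc n) x) = d n (h (d n x))"
    using null_homotopy[OF l] by blast
  have "f (l (Suc n) x) = f (h (d n x))" if x: "x \<in> carrier (Q (Suc n))" for x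
  proof -
    have c: "l (Suc n) x \<in> carrier (Q (Suc n))" "h (d n x) \<in> carrier (Q (Suc n))" "d n x \<in> carrier (Q n)"
      using x rlinD(2)[OF chainD(1)[OF l]] rlinD(2)[OF h] rlinD(2)[OF d_rlin] by auto
    have "d n (l (Suc n) x \<ominus>\<^bsub>Q (Suc n)\<^esub> h (d n x)) = \<zero>\<^bsub>Q n\<^esub>"
      using c x rlin_group(3)[OF d_rlin Q_mod Q_mod] rlinD(2)[OF d_rlin] by (simp add: dh Q0.M.M.minus_eq Q0.M.M.r_neg)
    then have "f (l (Suc n) x \<ominus>\<^bsub>Q (Suc n)\<^esub> h (d n x)) = \<zero>\<^bsub>N\<^esub>"
      using c by (intro cocycle_factor[OF f N f0]) auto
    then show ?thesis
      using c rlin_group(3)[OF f Q_mod N] rlinD(2)[OF f] by (simp add: N.M.M.diff_eq_zero_iff)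
  qed
  then show ?thesis using that[OF rlin_comp[OF h f]] by blast
qed

end

section \<open>The bimodule structure of Ext\<close>

text \<open>The degree is written as \<open>Suc m\<close>, so that coboundaries always come from
  maps on \<open>Q m\<close>. The case of interest is \<open>m = 1\<close>, that is, the second
  Ext.\<close>

locale ext_bimodule = bimodule K A M + resolved K A M R
  for K :: "('k, 'r) ring_scheme" and A :: "('k, 'a, 's) module_scheme"
    and M :: "('k, 'm, 'a, 'z) bimod_scheme" (structure)
    and R :: "('k, 'p, 'a, 'm) resolution" +
  fixes m :: nat
begin

abbreviation "P \<equiv> carrier (Q (Suc m))"
abbreviation "Zs \<equiv> Hom_cocycles K A R (Suc m) (reg_bimod A)"
abbreviation "Z \<equiv> Hom_cocycle_space K A R (Suc m) (reg_bimod A)"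
abbreviation "W \<equiv> Hom_coboundaries K A R (Suc m) (reg_bimod A)"

text \<open>The body of \<open>Ext_bimod\<close> in degree \<open>Suc m\<close> with coefficients in
  the regular bimodule, for an arbitrary resolution \<open>R\<close>; \<open>Ext_bimod_eq\<close>
  specializes it to the chosen one.\<close>

definition E :: "('k, ('p \<Rightarrow> 'a) set, 'a) bimod" where
  "E = module.extend (quot_space Z W)
     \<lparr>ract = (\<lambda>Y a. let l = (SOME l. chain_lift K A R (\<lambda>x. a \<triangleright>\<^bsub>M\<^esub> x) l)
        in coset_map Z W (\<lambda>f. compose P f (l (Suc m))) Y),
      lact = (\<lambda>a. coset_map Z W (\<lambda>f. compose P (\<lambda>y. a \<triangleright>\<^bsub>reg_bimod A\<^esub> y) f))\<rparr>"

abbreviation "cl f \<equiv> W +>\<^bsub>Z\<^esub> f"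

lemma E_simps:
  "carrier E = a_rcosets\<^bsub>Z\<^esub> W" "\<zero>\<^bsub>E\<^esub> = W" "x \<oplus>\<^bsub>E\<^esub> y = x <+>\<^bsub>Z\<^esub> y"
  "r \<odot>\<^bsub>E\<^esub> x = quot_map Z W (\<lambda>x. r \<odot>\<^bsub>Z\<^esub> x) x"
  "x \<triangleleft>\<^bsub>E\<^esub> a = quot_map Z W (\<lambda>f. \<lambda>x\<in>P. f ((SOME l. chain_lift K A R (\<lambda>x. a \<triangleright>\<^bsub>M\<^esub> x) l) (Suc m) x)) x"
  "a \<triangleright>\<^bsub>E\<^esub> x = quot_map Z W (\<lambda>f. \<lambda>x\<in>P. a \<otimes>\<^bsub>A\<^esub> f x) x"
  by (simp_all add: E_def module.defs quot_space_def coset_map_eq_quot_map Let_def compose_def)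

lemma reg: "right_module K A (reg_bimod A)"
  by (rule A.reg_right_module)

lemma Zs_D:
  assumes "f \<in> Zs"
  shows "f \<in> rlin K A (Q (Suc m)) (reg_bimod A)" "f \<in> extensional P"
    and "x \<in> carrier (Q (Suc (Suc m))) \<Longrightarrow> f (d (Suc m) x) = \<zero>\<^bsub>A\<^esub>"
  using assms by (auto simp: Hom_cocycles_def rmod_hom_eq_rlin)

lemma Zs_closed: "f \<in> Zs \<Longrightarrow> x \<in> P \<Longrightarrow> f x \<in> carrier A"
  using rlin_regD(1)[OF Zs_D(1)] .

lemma Zs_I:
  assumes "f \<in> rlin K A (Q (Suc m)) (reg_bimod A)"
    and "\<And>x. x \<in> carrier (Q (Suc (Suc m))) \<Longrightarrow> f (d (Suc m) x) = \<zero>\<^bsub>A\<^esub>"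
  shows "restrict f P \<in> Zs"
  using rlin_restrict[OF assms(1) Q_mod] assms(2) rlinD(2)[OF d_rlin] by (simp add: Hom_cocycles_def)

lemma W_eq: "W = {\<lambda>x\<in>P. g (d m x) | g. g \<in> rlin K A (Q m) (reg_bimod A)}"
proof -
  have "\<exists>h\<in>rmod_hom K A (Q m) (reg_bimod A). (\<lambda>x\<in>P. g (d m x)) = (\<lambda>x\<in>P. h (d m x))"
    if "g \<in> rlin K A (Q m) (reg_bimod A)" for g
    using rlinD(2)[OF d_rlin] by (intro bexI[OF _ rlin_restrict[OF that Q_mod]] restrict_ext) simp
  then show ?thesis
    by (auto simp: Hom_coboundaries_def compose_def rmod_hom_eq_rlin)
qed

lemma Z_simps:
  "carrier Z = Zs" "\<zero>\<^bsub>Z\<^esub> = (\<lambda>x\<in>P. \<zero>\<^bsub>A\<^esub>)" "f \<oplus>\<^bsub>Z\<^esub> g = (\<lambda>x\<in>P. f x \<oplus>\<^bsub>A\<^esub> g x)"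
  "r \<odot>\<^bsub>Z\<^esub> f = (\<lambda>x\<in>P. r \<odot>\<^bsub>A\<^esub> f x)"
  by (simp_all add: Hom_cocycle_space_def)

lemma Zs_sub: "Zs \<subseteq> P \<rightarrow>\<^sub>E carrier (reg_bimod A)"
  using Zs_closed Zs_D(2) by (auto simp: PiE_def)

lemma Zs_add: "f \<in> Zs \<Longrightarrow> g \<in> Zs \<Longrightarrow> (\<lambda>x\<in>P. f x \<oplus>\<^bsub>A\<^esub> g x) \<in> Zs"
  using rlin_add[OF Zs_D(1) Zs_D(1) Q_mod reg] by (intro Zs_I) (simp_all add: Zs_D(3))

lemma rlin_smult:
  assumes "f \<in> rlin K A L N" "right_module K A L" "right_module K A N" "r \<in> carrier K"
  shows "(\<lambda>x. r \<odot>\<^bsub>N\<^esub> f x) \<in> rlin K A L N"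
proof -
  interpret N: right_module K A N by fact
  show ?thesis
    using assms(4) by (intro rlinI assms(2,3)) (simp_all add: rlinD[OF assms(1)] N.M.smult_r_distr N.ract_simps)
qed

lemma rlin_lmult:
  assumes "f \<in> rlin K A L (reg_bimod A)" "right_module K A L" "a \<in> carrier A"
  shows "(\<lambda>x. a \<otimes>\<^bsub>A\<^esub> f x) \<in> rlin K A L (reg_bimod A)"
  using assms(3) by (intro rlinI assms(2) reg) (simp_all add: rlin_regD[OF assms(1)] A.A.r_distr A.A.m_assoc)

lemma Zs_smult: "r \<in> carrier K \<Longrightarrow> f \<in> Zs \<Longrightarrow> (\<lambda>x\<in>P. r \<odot>\<^bsub>A\<^esub> f x) \<in> Zs"
  using rlin_smult[OF Zs_D(1) Q_mod reg] by (intro Zs_I) (simp_all add: Zs_D(3))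

lemma Zs_lmult: "a \<in> carrier A \<Longrightarrow> f \<in> Zs \<Longrightarrow> (\<lambda>x\<in>P. a \<otimes>\<^bsub>A\<^esub> f x) \<in> Zs"
  using rlin_lmult[OF Zs_D(1) Q_mod] by (intro Zs_I) (simp_all add: Zs_D(3))

lemma Zs_chain:
  assumes l: "chain h l" and f: "f \<in> Zs"
  shows "(\<lambda>x\<in>P. f (l (Suc m) x)) \<in> Zs"
proof (rule Zs_I)
  show "(\<lambda>x. f (l (Suc m) x)) \<in> rlin K A (Q (Suc m)) (reg_bimod A)"
    by (rule rlin_comp[OF chainD(1)[OF l] Zs_D(1)[OF f]])
  show "f (l (Suc m) (d (Suc m) x)) = \<zero>\<^bsub>A\<^esub>" if "x \<in> carrier (Q (Suc (Suc m)))" for x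
    using that Zs_D(3)[OF f rlinD(2)[OF chainD(1)[OF l]]] by (simp add: chainD(3)[OF l, symmetric])
qed

lemma Z_module: "module K Z"
proof -
  interpret N: right_module K A "reg_bimod A" by (rule reg)
  have "(\<lambda>x\<in>P. \<zero>\<^bsub>A\<^esub>) \<in> Zs"
    using rlin_zero[OF Q_mod reg] by (intro Zs_I) simp_all
  then show ?thesis
    unfolding Hom_cocycle_space_def
    by (intro fun_space_module[OF N.M.module_axioms Zs_sub]) (simp_all add: Zs_add Zs_smult)
qed

lemma Z_minus: "f \<in> Zs \<Longrightarrow> g \<in> Zs \<Longrightarrow> f \<ominus>\<^bsub>Z\<^esub> g = (\<lambda>x\<in>P. f x \<ominus>\<^bsub>A\<^esub> g x)"
proof -
  interpret N: right_module K A "reg_bimod A" by (rule reg)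
  show "f \<in> Zs \<Longrightarrow> g \<in> Zs \<Longrightarrow> f \<ominus>\<^bsub>Z\<^esub> g = (\<lambda>x\<in>P. f x \<ominus>\<^bsub>A\<^esub> g x)"
    using fun_space_minus[OF N.M.module_axioms Z_module[unfolded Hom_cocycle_space_def] Zs_sub]
    by (simp add: Hom_cocycle_space_def)
qed

lemma W_I: "g \<in> rlin K A (Q m) (reg_bimod A) \<Longrightarrow> (\<And>x. x \<in> P \<Longrightarrow> f x = g (d m x)) \<Longrightarrow> f \<in> extensional P \<Longrightarrow> f \<in> W"
  by (auto simp: W_eq fun_eq_iff extensional_def intro!: exI[of _ g])

lemma W_sub: "W \<subseteq> Zs"
  using rlin_comp[OF d_rlin] by (auto simp: W_eq d_d rlin_group(1)[OF _ Q_mod reg, simplified] intro!: Zs_I)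

lemma W_submodule: "submodule W K Z"
proof -
  interpret Z: module K Z by (rule Z_module)
  show ?thesis
  proof (rule Z.submoduleI')
    show "W \<subseteq> carrier Z" using W_sub by (simp add: Z_simps)
    show "\<zero>\<^bsub>Z\<^esub> \<in> W"
      using rlin_zero[OF Q_mod reg, of m] by (intro W_I[of "\<lambda>_. \<zero>\<^bsub>A\<^esub>"]) (simp_all add: Z_simps)
    fix f assume f: "f \<in> W"
    obtain g where g: "g \<in> rlin K A (Q m) (reg_bimod A)" "f = (\<lambda>x\<in>P. g (d m x))"
      using f unfolding W_eq by blast
    show "f \<oplus>\<^bsub>Z\<^esub> f' \<in> W" if f': "f' \<in> W" for f'
    proof -
      obtain g' where g': "g' \<in> rlin K A (Q m) (reg_bimod A)" "f' = (\<lambda>x\<in>P. g' (d m x))"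
        using f' unfolding W_eq by blast
      show ?thesis
        using rlin_add[OF g(1) g'(1) Q_mod reg] by (intro W_I) (simp_all add: Z_simps g g')
    qed
    show "r \<odot>\<^bsub>Z\<^esub> f \<in> W" if "r \<in> carrier K" for r
      using rlin_smult[OF g(1) Q_mod reg that] by (intro W_I) (simp_all add: Z_simps g)
  qed
qed

lemma E_module: "module K E"
  by (rule module_cong[OF quot_module[OF Z_module W_submodule]]) (simp_all add: E_simps)

lemma E_carrier: "x \<in> carrier E \<longleftrightarrow> (\<exists>f\<in>Zs. x = cl f)"
  using quot_carrier[OF Z_module W_submodule] by (auto simp: E_simps Z_simps)

lemma cl_in: "f \<in> Zs \<Longrightarrow> cl f \<in> carrier E"
  by (auto simp: E_carrier)

lemma cl_add: "f \<in> Zs \<Longrightarrow> g \<in> Zs \<Longrightarrow> cl f \<oplus>\<^bsub>E\<^esub> cl g = cl (\<lambda>x\<in>P. f x \<oplus>\<^bsub>A\<^esub> g x)"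
  using coset_add[OF Z_module W_submodule, of f g] by (simp add: E_simps Z_simps)

lemma cl_smult: "r \<in> carrier K \<Longrightarrow> f \<in> Zs \<Longrightarrow> r \<odot>\<^bsub>E\<^esub> cl f = cl (\<lambda>x\<in>P. r \<odot>\<^bsub>A\<^esub> f x)"
  using coset_smult[OF Z_module W_submodule, of r f] by (simp add: E_simps Z_simps)

lemma cl_eq_iff: "f \<in> Zs \<Longrightarrow> g \<in> Zs \<Longrightarrow> cl f = cl g \<longleftrightarrow> (\<lambda>x\<in>P. f x \<ominus>\<^bsub>A\<^esub> g x) \<in> W"
  using coset_eq_iff[OF Z_module W_submodule, of f g] by (simp add: Z_simps Z_minus)

lemma cl_zero: "f \<in> W \<Longrightarrow> cl f = \<zero>\<^bsub>E\<^esub>"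
  using coset_zero[OF Z_module W_submodule, of f] W_sub by (auto simp: Z_simps E_simps)

lemma cl_cong: "(\<And>x. x \<in> P \<Longrightarrow> f x = g x) \<Longrightarrow> cl (restrict f P) = cl (restrict g P)"
  by (metis restrict_ext)

lemma lmult_lin_map:
  assumes "a \<in> carrier A"
  shows "(\<lambda>f. \<lambda>x\<in>P. a \<otimes>\<^bsub>A\<^esub> f x) \<in> lin_map K Z Z"
  using assms by (intro lin_mapI)
    (auto simp: Z_simps Zs_lmult Zs_closed A.A.r_distr A.smult_mult_right intro!: restrict_ext)

lemma lact_cl:
  assumes a: "a \<in> carrier A" and f: "f \<in> Zs"
  shows "a \<triangleright>\<^bsub>E\<^esub> cl f = cl (\<lambda>x\<in>P. a \<otimes>\<^bsub>A\<^esub> f x)"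
proof -
  have "(\<lambda>x\<in>P. a \<otimes>\<^bsub>A\<^esub> g x) \<in> W" if g: "g \<in> W" for g
  proof -
    obtain h where h: "h \<in> rlin K A (Q m) (reg_bimod A)" "g = (\<lambda>x\<in>P. h (d m x))"
      using g unfolding W_eq by blast
    show ?thesis using rlin_lmult[OF h(1) Q_mod a] by (intro W_I) (simp_all add: h)
  qed
  then show ?thesis
    unfolding E_simps using f
    by (intro quot_map_coset[OF Z_module W_submodule Z_module W_submodule lmult_lin_map[OF a]]) (auto simp: Z_simps)
qed

lemma chain_lin_map:
  assumes l: "chain h l"
  shows "(\<lambda>f. \<lambda>x\<in>P. f (l (Suc m) x)) \<in> lin_map K Z Z"
  using Zs_chain[OF l] rlinD(2)[OF chainD(1)[OF l]]
  by (intro lin_mapI) (auto simp: Z_simps intro!: restrict_ext)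

lemma chain_W:
  assumes l: "chain h l" and g: "g \<in> W"
  shows "(\<lambda>x\<in>P. g (l (Suc m) x)) \<in> W"
proof -
  obtain h where h: "h \<in> rlin K A (Q m) (reg_bimod A)" "g = (\<lambda>x\<in>P. h (d m x))"
    using g unfolding W_eq by blast
  show ?thesis
    using rlin_comp[OF chainD(1)[OF l] h(1)] rlinD(2)[OF chainD(1)[OF l]]
    by (intro W_I[of "\<lambda>x. h (l m x)"]) (simp_all add: h chainD(3)[OF l])
qed

text \<open>The difference of two lifts of the same endomorphism lifts zero, hence turns cocycles
  into coboundaries.\<close>

lemma chain_unique:
  assumes l: "chain h l" and l': "chain h' l'" and eq: "\<And>x. x \<in> carrier M \<Longrightarrow> h x = h' x"
    and h: "\<And>x. x \<in> carrier M \<Longrightarrow> h x \<in> carrier M" and f: "f \<in> Zs"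
  shows "cl (\<lambda>x\<in>P. f (l (Suc m) x)) = cl (\<lambda>x\<in>P. f (l' (Suc m) x))"
proof -
  have "h (aug x) \<ominus>\<^bsub>M\<^esub> h' (aug x) = \<zero>\<^bsub>M\<^esub>" if "x \<in> carrier (Q 0)" for x
    using eq[of "aug x"] h[of "aug x"] rlinD(2)[OF aug_rlin that] by (simp add: M.M.diff_eq_zero_iff)
  then have c: "chain (\<lambda>_. \<zero>\<^bsub>M\<^esub>) (\<lambda>n x. l n x \<ominus>\<^bsub>Q n\<^esub> l' n x)"
    using chain_diff[OF l l'] by (simp add: chain_def)
  obtain g where g: "g \<in> rlin K A (Q m) (reg_bimod A)"
    "\<And>x. x \<in> P \<Longrightarrow> f (l (Suc m) x \<ominus>\<^bsub>Q (Suc m)\<^esub> l' (Suc m) x) = g (d m x)"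
    using null_homotopic_cocycle[OF c reg Zs_D(1)[OF f]] Zs_D(3)[OF f] by auto
  have "(\<lambda>x\<in>P. f (l (Suc m) x) \<ominus>\<^bsub>A\<^esub> f (l' (Suc m) x)) \<in> W"
    using rlin_group(3)[OF Zs_D(1)[OF f] Q_mod reg] rlinD(2)[OF chainD(1)[OF l]] rlinD(2)[OF chainD(1)[OF l']]
    by (intro W_I[OF g(1)]) (simp_all add: g(2)[symmetric])
  then show ?thesis
    by (subst cl_eq_iff[OF Zs_chain[OF l f] Zs_chain[OF l' f]])
      (simp cong: restrict_cong)
qed

lemma lact_rlin: "a \<in> carrier A \<Longrightarrow> (\<lambda>x. a \<triangleright>\<^bsub>M\<^esub> x) \<in> rlin K A M M"
  by (rule rlinI) (simp_all add: lact_simps lact_ract right_module_axioms)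

lemma lact_chain: "a \<in> carrier A \<Longrightarrow> \<exists>l. chain (\<lambda>x. a \<triangleright>\<^bsub>M\<^esub> x) l"
  using chain_lift_exists[OF lact_rlin] chain_lift_chain by blast

text \<open>Any lift computes the right action, in place of the one picked by \<open>SOME\<close>.
  This allows lifts adapted to the situation: sums, composites, commutators, or right multiplication
  by a central element.\<close>

lemma ract_cl:
  assumes a: "a \<in> carrier A" and f: "f \<in> Zs" and l: "chain h l"
    and h: "\<And>x. x \<in> carrier M \<Longrightarrow> h x = a \<triangleright>\<^bsub>M\<^esub> x"
  shows "cl f \<triangleleft>\<^bsub>E\<^esub> a = cl (\<lambda>x\<in>P. f (l (Suc m) x))"
proof -
  define l' where "l' = (SOME l. chain_lift K A R (\<lambda>x. a \<triangleright>\<^bsub>M\<^esub> x) l)"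
  have l': "chain (\<lambda>x. a \<triangleright>\<^bsub>M\<^esub> x) l'"
    unfolding l'_def by (rule chain_lift_chain[OF someI_ex[OF chain_lift_exists[OF lact_rlin[OF a]]]])
  have "cl f \<triangleleft>\<^bsub>E\<^esub> a = cl (\<lambda>x\<in>P. f (l' (Suc m) x))"
    unfolding E_simps l'_def[symmetric] using f chain_W[OF l']
    by (intro quot_map_coset[OF Z_module W_submodule Z_module W_submodule chain_lin_map[OF l']]) (auto simp: Z_simps)
  also have "\<dots> = cl (\<lambda>x\<in>P. f (l (Suc m) x))"
    by (rule chain_unique[OF l' l _ _ f]) (simp_all add: h a lact_closed)
  finally show ?thesis .
qed

section \<open>Operations on lifts and the bimodule axioms\<close>

lemma chain_add:
  assumes l: "chain h l" and l': "chain h' l'"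
  shows "chain (\<lambda>x. h x \<oplus>\<^bsub>M\<^esub> h' x) (\<lambda>n x. l n x \<oplus>\<^bsub>Q n\<^esub> l' n x)"
  unfolding chain_def
  using rlin_add[OF chainD(1)[OF l] chainD(1)[OF l'] Q_mod Q_mod] rlinD(2)[OF chainD(1)[OF l]] rlinD(2)[OF chainD(1)[OF l']]
  by (simp add: rlinD(3)[OF aug_rlin] rlinD(3)[OF d_rlin] chainD(2,3)[OF l] chainD(2,3)[OF l'])

lemma chain_smult:
  assumes l: "chain h l" and r: "r \<in> carrier K"
  shows "chain (\<lambda>x. r \<odot>\<^bsub>M\<^esub> h x) (\<lambda>n x. r \<odot>\<^bsub>Q n\<^esub> l n x)"
  unfolding chain_def
  using rlin_smult[OF chainD(1)[OF l] Q_mod Q_mod r] rlinD(2)[OF chainD(1)[OF l]] r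
  by (simp add: rlinD(4)[OF aug_rlin] rlinD(4)[OF d_rlin] chainD(2,3)[OF l])

lemma chain_comp:
  assumes l: "chain h l" and l': "chain h' l'"
  shows "chain (\<lambda>x. h (h' x)) (\<lambda>n x. l n (l' n x))"
  unfolding chain_def
  using rlin_comp[OF chainD(1)[OF l'] chainD(1)[OF l]] rlinD(2)[OF chainD(1)[OF l']]
  by (simp add: chainD(2,3)[OF l] chainD(2,3)[OF l'])

lemma chain_id: "chain (\<lambda>x. x) (\<lambda>n x. x)"
  by (simp add: chain_def rlin_id[OF Q_mod])

lemma E_bimodule: "bimodule K A E"
proof -
  interpret EM: module K E by (rule E_module)
  have ll: "\<exists>l. chain (\<lambda>x. a \<triangleright>\<^bsub>M\<^esub> x) l" if "a \<in> carrier A" for a by (rule lact_chain[OF that])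
  show ?thesis
  proof unfold_locales
    fix x a assume "x \<in> carrier E" and a: "a \<in> carrier A"
    then obtain f where f: "f \<in> Zs" "x = cl f" by (auto simp: E_carrier)
    obtain l where l: "chain (\<lambda>x. a \<triangleright>\<^bsub>M\<^esub> x) l" using ll[OF a] by blast
    note l1 = rlinD(2)[OF chainD(1)[OF l]]
    note Zl = Zs_chain[OF l]
    show "x \<triangleleft>\<^bsub>E\<^esub> a \<in> carrier E" using f by (simp add: ract_cl[OF a _ l] cl_in Zl)
    show "a \<triangleright>\<^bsub>E\<^esub> x \<in> carrier E" using f a by (simp add: lact_cl cl_in Zs_lmult)
    { fix y assume "y \<in> carrier E"
      then obtain g where g: "g \<in> Zs" "y = cl g" by (auto simp: E_carrier)
      show "(x \<oplus>\<^bsub>E\<^esub> y) \<triangleleft>\<^bsub>E\<^esub> a = (x \<triangleleft>\<^bsub>E\<^esub> a) \<oplus>\<^bsub>E\<^esub> (y \<triangleleft>\<^bsub>E\<^esub> a)"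
        using f g l1 by (simp add: cl_add ract_cl[OF a _ l] Zs_add Zl cong: restrict_cong)
      show "a \<triangleright>\<^bsub>E\<^esub> (x \<oplus>\<^bsub>E\<^esub> y) = (a \<triangleright>\<^bsub>E\<^esub> x) \<oplus>\<^bsub>E\<^esub> (a \<triangleright>\<^bsub>E\<^esub> y)"
        using f g a by (simp add: cl_add lact_cl Zs_add Zs_lmult Zs_closed A.A.r_distr cong: restrict_cong) }
    { fix r assume r: "r \<in> carrier K"
      show "(r \<odot>\<^bsub>E\<^esub> x) \<triangleleft>\<^bsub>E\<^esub> a = r \<odot>\<^bsub>E\<^esub> (x \<triangleleft>\<^bsub>E\<^esub> a)"
        using f r l1 by (simp add: cl_smult ract_cl[OF a _ l] Zs_smult Zl cong: restrict_cong)
      show "a \<triangleright>\<^bsub>E\<^esub> (r \<odot>\<^bsub>E\<^esub> x) = r \<odot>\<^bsub>E\<^esub> (a \<triangleright>\<^bsub>E\<^esub> x)"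
        using f r a by (simp add: cl_smult lact_cl Zs_smult Zs_lmult Zs_closed A.smult_mult_right cong: restrict_cong)
      show "(r \<odot>\<^bsub>A\<^esub> a) \<triangleright>\<^bsub>E\<^esub> x = r \<odot>\<^bsub>E\<^esub> (a \<triangleright>\<^bsub>E\<^esub> x)"
        using f r a by (simp add: cl_smult lact_cl Zs_smult Zs_lmult Zs_closed A.smult_mult_left cong: restrict_cong)
      have "cl f \<triangleleft>\<^bsub>E\<^esub> (r \<odot>\<^bsub>A\<^esub> a) = cl (\<lambda>x\<in>P. f (r \<odot>\<^bsub>Q (Suc m)\<^esub> l (Suc m) x))"
        by (rule ract_cl[OF _ f(1) chain_smult[OF l r]]) (simp_all add: a r lact_simps)
      also have "\<dots> = r \<odot>\<^bsub>E\<^esub> (cl f \<triangleleft>\<^bsub>E\<^esub> a)"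
        using f r l1 rlin_regD(3)[OF Zs_D(1)[OF f(1)] r]
        by (simp add: cl_smult ract_cl[OF a _ l] Zl cong: restrict_cong)
      finally show "x \<triangleleft>\<^bsub>E\<^esub> (r \<odot>\<^bsub>A\<^esub> a) = r \<odot>\<^bsub>E\<^esub> (x \<triangleleft>\<^bsub>E\<^esub> a)" using f by simp }
    fix b assume b: "b \<in> carrier A"
    obtain l' where l': "chain (\<lambda>x. b \<triangleright>\<^bsub>M\<^esub> x) l'" using ll[OF b] by blast
    note l1' = rlinD(2)[OF chainD(1)[OF l']]
    note Zl' = Zs_chain[OF l']
    have "cl f \<triangleleft>\<^bsub>E\<^esub> (a \<oplus>\<^bsub>A\<^esub> b) = cl (\<lambda>x\<in>P. f (l (Suc m) x \<oplus>\<^bsub>Q (Suc m)\<^esub> l' (Suc m) x))"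
      by (rule ract_cl[OF _ f(1) chain_add[OF l l']]) (simp_all add: a b lact_simps)
    also have "\<dots> = (cl f \<triangleleft>\<^bsub>E\<^esub> a) \<oplus>\<^bsub>E\<^esub> (cl f \<triangleleft>\<^bsub>E\<^esub> b)"
      using f l1 l1' rlin_regD(2)[OF Zs_D(1)[OF f(1)]]
      by (simp add: cl_add ract_cl[OF a _ l] ract_cl[OF b _ l'] Zl Zl' cong: restrict_cong)
    finally show "x \<triangleleft>\<^bsub>E\<^esub> (a \<oplus>\<^bsub>A\<^esub> b) = (x \<triangleleft>\<^bsub>E\<^esub> a) \<oplus>\<^bsub>E\<^esub> (x \<triangleleft>\<^bsub>E\<^esub> b)" using f by simp
    \<comment> \<open>Multiplication by the product lifts to \<open>l\<close> after
      \<open>l'\<close>. Precomposition applies the outer map to the cocycle first, so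
      \<open>a\<close> acts before \<open>b\<close>, as a right action should.\<close>
    have "cl f \<triangleleft>\<^bsub>E\<^esub> (a \<otimes>\<^bsub>A\<^esub> b) = cl (\<lambda>x\<in>P. f (l (Suc m) (l' (Suc m) x)))"
      by (rule ract_cl[OF _ f(1) chain_comp[OF l l']]) (simp_all add: a b lact_assoc)
    also have "\<dots> = (cl f \<triangleleft>\<^bsub>E\<^esub> a) \<triangleleft>\<^bsub>E\<^esub> b"
      using f l1 l1' by (simp add: ract_cl[OF a _ l] ract_cl[OF b _ l'] Zl Zl' cong: restrict_cong)
    finally show "x \<triangleleft>\<^bsub>E\<^esub> (a \<otimes>\<^bsub>A\<^esub> b) = (x \<triangleleft>\<^bsub>E\<^esub> a) \<triangleleft>\<^bsub>E\<^esub> b" using f by simp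
    show "(a \<oplus>\<^bsub>A\<^esub> b) \<triangleright>\<^bsub>E\<^esub> x = (a \<triangleright>\<^bsub>E\<^esub> x) \<oplus>\<^bsub>E\<^esub> (b \<triangleright>\<^bsub>E\<^esub> x)"
      using f a b by (simp add: cl_add lact_cl Zs_lmult Zs_closed A.A.l_distr cong: restrict_cong)
    show "(a \<otimes>\<^bsub>A\<^esub> b) \<triangleright>\<^bsub>E\<^esub> x = a \<triangleright>\<^bsub>E\<^esub> (b \<triangleright>\<^bsub>E\<^esub> x)"
      using f a b by (simp add: lact_cl Zs_lmult Zs_closed A.A.m_assoc cong: restrict_cong)
    show "(a \<triangleright>\<^bsub>E\<^esub> x) \<triangleleft>\<^bsub>E\<^esub> b = a \<triangleright>\<^bsub>E\<^esub> (x \<triangleleft>\<^bsub>E\<^esub> b)"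
      using f a l1' by (simp add: lact_cl ract_cl[OF b _ l'] Zl' Zs_lmult cong: restrict_cong)
  next
    fix x assume "x \<in> carrier E"
    then obtain f where f: "f \<in> Zs" "x = cl f" by (auto simp: E_carrier)
    have e: "restrict f P = f" using Zs_D(2)[OF f(1)] by (simp add: extensional_restrict)
    show "x \<triangleleft>\<^bsub>E\<^esub> \<one>\<^bsub>A\<^esub> = x"
      using f ract_cl[OF _ f(1) chain_id, of "\<one>\<^bsub>A\<^esub>"] by (simp add: lact_one e)
    have "(\<lambda>x\<in>P. \<one>\<^bsub>A\<^esub> \<otimes>\<^bsub>A\<^esub> f x) = restrict f P"
      using f by (intro restrict_ext) (simp add: Zs_closed)
    then show "\<one>\<^bsub>A\<^esub> \<triangleright>\<^bsub>E\<^esub> x = x"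
      using f e by (simp add: lact_cl)
  qed
qed

end

section \<open>Central elements, derivations and left linear maps on Ext\<close>

context ext_bimodule
begin

lemma E_central:
  assumes c: "c \<in> carrier A" and cA: "\<And>a. a \<in> carrier A \<Longrightarrow> c \<otimes>\<^bsub>A\<^esub> a = a \<otimes>\<^bsub>A\<^esub> c"
    and cM: "\<And>x. x \<in> carrier M \<Longrightarrow> c \<triangleright>\<^bsub>M\<^esub> x = x \<triangleleft>\<^bsub>M\<^esub> c" and e: "e \<in> carrier E"
  shows "c \<triangleright>\<^bsub>E\<^esub> e = e \<triangleleft>\<^bsub>E\<^esub> c"
proof -
  obtain f where f: "f \<in> Zs" "e = cl f" using e by (auto simp: E_carrier)
  \<comment> \<open>Linear because \<open>c\<close> is central: acting by \<open>b\<close> and then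
    \<open>c\<close> is the same as acting by \<open>c\<close> and then \<open>b\<close>.\<close>
  have "(\<lambda>x. x \<triangleleft>\<^bsub>Q n\<^esub> c) \<in> rlin K A (Q n) (Q n)" for n
  proof -
    interpret Qn: right_module K A "Q n" by (rule Q_mod)
    show ?thesis
      using c by (intro rlinI Q_mod) (simp_all add: Qn.ract_simps Qn.ract_assoc[symmetric] cA)
  qed
  then have ch: "chain (\<lambda>x. x \<triangleleft>\<^bsub>M\<^esub> c) (\<lambda>n x. x \<triangleleft>\<^bsub>Q n\<^esub> c)"
    using c by (simp add: chain_def rlinD(5)[OF aug_rlin] rlinD(5)[OF d_rlin])
  have "e \<triangleleft>\<^bsub>E\<^esub> c = cl (\<lambda>x\<in>P. f (x \<triangleleft>\<^bsub>Q (Suc m)\<^esub> c))"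
    unfolding f(2) by (rule ract_cl[OF c f(1) ch]) (simp add: cM)
  also have "\<dots> = cl (\<lambda>x\<in>P. c \<otimes>\<^bsub>A\<^esub> f x)"
    using c by (intro cl_cong) (simp add: rlin_regD(4)[OF Zs_D(1)[OF f(1)]] cA Zs_closed[OF f(1)])
  finally show ?thesis using f c by (simp add: lact_cl)
qed

text \<open>With \<open>l\<close> a lift of \<open>D\<close> to connections on the resolution, the
  operator sends a cocycle \<open>f\<close> to \<open>T f\<close>, which is \<delta> after
  \<open>f\<close> minus \<open>f\<close> after \<open>l\<close>: the derivative of \<open>f\<close>
  as a map between modules with connection.\<close>

lemma E_derivation:
  assumes \<delta>: "\<delta> \<in> derivations K A (reg_bimod A)" and D: "D \<in> conn K A \<delta> M"
    and DL: "\<And>a x. a \<in> carrier A \<Longrightarrow> x \<in> carrier M \<Longrightarrow> D (a \<triangleright>\<^bsub>M\<^esub> x) = (a \<triangleright>\<^bsub>M\<^esub> D x) \<oplus>\<^bsub>M\<^esub> (\<delta> a \<triangleright>\<^bsub>M\<^esub> x)"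
  shows "\<exists>G\<in>lin_map K E E. \<forall>a\<in>carrier A. \<forall>e\<in>carrier E.
    G (a \<triangleright>\<^bsub>E\<^esub> e) = (a \<triangleright>\<^bsub>E\<^esub> G e) \<oplus>\<^bsub>E\<^esub> (\<delta> a \<triangleright>\<^bsub>E\<^esub> e) \<and>
    G (e \<triangleleft>\<^bsub>E\<^esub> a) = (G e \<triangleleft>\<^bsub>E\<^esub> a) \<oplus>\<^bsub>E\<^esub> (e \<triangleleft>\<^bsub>E\<^esub> \<delta> a)"
proof -
  interpret R: bimodule K A "reg_bimod A" by (rule A.bimodule_reg)
  note \<delta>l = lin_mapD[OF R.derivationsD(1)[OF \<delta>], simplified]
  note \<delta>m = R.derivationsD(3)[OF \<delta>, simplified]
  have \<delta>0: "\<delta> \<zero>\<^bsub>A\<^esub> = \<zero>\<^bsub>A\<^esub>" "\<And>x y. x \<in> carrier A \<Longrightarrow> y \<in> carrier A \<Longrightarrow> \<delta> (x \<ominus>\<^bsub>A\<^esub> y) = \<delta> x \<ominus>\<^bsub>A\<^esub> \<delta> y"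
    using lin_map_group[OF R.derivationsD(1)[OF \<delta>] A.module_axioms R.M.module_axioms] by simp_all
  obtain l where l: "conn_chain \<delta> D l" using conn_chain_exists[OF \<delta> D] by blast
  note lc = connD[OF conn_chainD(1)[OF l]]
  \<comment> \<open>Neither term is linear over \<open>A\<close>: each has the defect
    \<open>f x\<close> times \<delta> \<open>a\<close>, and these cancel in the difference.\<close>
  define T where "T n f x = \<delta> (f x) \<ominus>\<^bsub>A\<^esub> f (l n x)" for n f x
  have T: "T n f \<in> rlin K A (Q n) (reg_bimod A)" if f: "f \<in> rlin K A (Q n) (reg_bimod A)" for n f
  proof -
    interpret Qn: right_module K A "Q n" by (rule Q_mod)
    note fl = rlin_regD[OF f]
    show ?thesis
      unfolding T_def
    proof (rule rlinI[OF Q_mod reg])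
      fix x a assume x: "x \<in> carrier (Q n)" and a: "a \<in> carrier A"
      have c: "\<delta> (f x) \<in> carrier A" "f x \<in> carrier A" "f (l n x) \<in> carrier A" "\<delta> a \<in> carrier A"
        using x a fl(1) lc(2) \<delta>l(1) by auto
      show "\<delta> (f (x \<triangleleft>\<^bsub>Q n\<^esub> a)) \<ominus>\<^bsub>A\<^esub> f (l n (x \<triangleleft>\<^bsub>Q n\<^esub> a)) = (\<delta> (f x) \<ominus>\<^bsub>A\<^esub> f (l n x)) \<triangleleft>\<^bsub>reg_bimod A\<^esub> a"
        using x a c lc(2)[OF x]
        by (simp add: fl lc(5) \<delta>m Qn.ract_closed A.A.l_distr A.A.l_minus A.M.ag_simps)
    qed (simp_all add: fl lc \<delta>l A.M.ag_simps)
  qed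
  have TZ: "restrict (T (Suc m) f) P \<in> Zs" if f: "f \<in> Zs" for f
  proof (rule Zs_I[OF T[OF Zs_D(1)[OF f]]])
    fix x assume x: "x \<in> carrier (Q (Suc (Suc m)))"
    have "l (Suc m) (d (Suc m) x) = d (Suc m) (l (Suc (Suc m)) x)"
      by (simp add: conn_chainD(3)[OF l x])
    then show "T (Suc m) f (d (Suc m) x) = \<zero>\<^bsub>A\<^esub>"
      using x by (simp add: T_def Zs_D(3)[OF f] lc(2) \<delta>0 A.M.ag_simps)
  qed
  let ?T = "\<lambda>f. restrict (T (Suc m) f) P"
  have Tl: "?T \<in> lin_map K Z Z"
  proof (rule lin_mapI)
    fix f g assume fg: "f \<in> carrier Z" "g \<in> carrier Z"
    then show "?T (f \<oplus>\<^bsub>Z\<^esub> g) = ?T f \<oplus>\<^bsub>Z\<^esub> ?T g"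
      unfolding Z_simps by (intro restrict_ext) (simp add: T_def \<delta>l lc(2) Zs_closed A.M.ag_simps)
  next
    fix r f assume "r \<in> carrier K" "f \<in> carrier Z"
    then show "?T (r \<odot>\<^bsub>Z\<^esub> f) = r \<odot>\<^bsub>Z\<^esub> ?T f"
      unfolding Z_simps by (intro restrict_ext)
        (simp add: T_def \<delta>l lc(2) Zs_closed A.M.minus_eq A.smult_r_distr A.smult_r_minus)
  qed (simp add: Z_simps TZ)
  have TW: "?T ` W \<subseteq> W"
  proof (rule image_subsetI)
    fix f assume "f \<in> W"
    then obtain g where g: "g \<in> rlin K A (Q m) (reg_bimod A)" "f = (\<lambda>x\<in>P. g (d m x))"
      unfolding W_eq by blast
    show "?T f \<in> W"
      by (rule W_I[OF T[OF g(1)]]) (simp_all add: T_def g(2) lc(2) conn_chainD(3)[OF l])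
  qed
  define G where "G = quot_map Z W ?T"
  have Gl: "G \<in> lin_map K E E"
    using quot_map_lin_map[OF Z_module W_submodule Z_module W_submodule Tl TW, folded G_def]
    by (simp add: lin_map_def E_simps)
  have G: "G (cl f) = cl (?T f)" if "f \<in> Zs" for f
    unfolding G_def using that
    by (intro quot_map_coset[OF Z_module W_submodule Z_module W_submodule Tl TW]) (simp add: Z_simps)
  show ?thesis
  proof (intro bexI[OF _ Gl] ballI conjI)
    fix a e assume a: "a \<in> carrier A" and "e \<in> carrier E"
    then obtain f where f: "f \<in> Zs" and e: "e = cl f" by (auto simp: E_carrier)
    have da: "\<delta> a \<in> carrier A" using \<delta>l(1)[OF a] .
    note fc = Zs_closed[OF f]
    have "G (a \<triangleright>\<^bsub>E\<^esub> e) = cl (\<lambda>x\<in>P. (a \<otimes>\<^bsub>A\<^esub> T (Suc m) f x) \<oplus>\<^bsub>A\<^esub> (\<delta> a \<otimes>\<^bsub>A\<^esub> f x))"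
      unfolding e lact_cl[OF a f] G[OF Zs_lmult[OF a f]]
    proof (rule cl_cong)
      fix x assume x: "x \<in> P"
      have c: "\<delta> (f x) \<in> carrier A" "f x \<in> carrier A" "f (l (Suc m) x) \<in> carrier A"
        using x fc lc(2) \<delta>l(1) by auto
      show "T (Suc m) (\<lambda>x\<in>P. a \<otimes>\<^bsub>A\<^esub> f x) x = (a \<otimes>\<^bsub>A\<^esub> T (Suc m) f x) \<oplus>\<^bsub>A\<^esub> (\<delta> a \<otimes>\<^bsub>A\<^esub> f x)"
        using x a c da lc(2)[OF x] by (simp add: T_def \<delta>m A.A.r_distr A.A.r_minus A.M.ag_simps)
    qed
    also have "\<dots> = cl (\<lambda>x\<in>P. (\<lambda>x\<in>P. a \<otimes>\<^bsub>A\<^esub> ?T f x) x \<oplus>\<^bsub>A\<^esub> (\<lambda>x\<in>P. \<delta> a \<otimes>\<^bsub>A\<^esub> f x) x)"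
      by (rule cl_cong) simp
    also have "\<dots> = (a \<triangleright>\<^bsub>E\<^esub> G e) \<oplus>\<^bsub>E\<^esub> (\<delta> a \<triangleright>\<^bsub>E\<^esub> e)"
      unfolding e G[OF f] lact_cl[OF a TZ[OF f]] lact_cl[OF da f]
      by (rule cl_add[OF Zs_lmult[OF a TZ[OF f]] Zs_lmult[OF da f], symmetric])
    finally show "G (a \<triangleright>\<^bsub>E\<^esub> e) = (a \<triangleright>\<^bsub>E\<^esub> G e) \<oplus>\<^bsub>E\<^esub> (\<delta> a \<triangleright>\<^bsub>E\<^esub> e)" .
    obtain r where r: "chain (\<lambda>x. a \<triangleright>\<^bsub>M\<^esub> x) r" using lact_chain[OF a] by blast
    note rl = rlinD[OF chainD(1)[OF r]]
    \<comment> \<open>The commutator of the connection \<open>l\<close> with a lift \<open>r\<close>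
      of left multiplication by \<open>a\<close>. The Leibniz defects cancel, so it is linear, and
      it lifts the commutator of \<open>D\<close> with that multiplication, which by
      \<open>DL\<close> is left multiplication by \<delta> \<open>a\<close>. It therefore computes
      the right action of \<delta> \<open>a\<close>.\<close>
    define s where "s n x = l n (r n x) \<ominus>\<^bsub>Q n\<^esub> r n (l n x)" for n x
    have s: "chain (\<lambda>x. \<delta> a \<triangleright>\<^bsub>M\<^esub> x) s"
      unfolding chain_def
    proof (intro conjI allI ballI)
      fix n
      interpret Qn: right_module K A "Q n" by (rule Q_mod)
      show "s n \<in> rlin K A (Q n) (Q n)"
        unfolding s_def
      proof (rule rlinI[OF Q_mod Q_mod])
        fix x b assume x: "x \<in> carrier (Q n)" and b: "b \<in> carrier A"
        have c: "l n (r n x) \<in> carrier (Q n)" "r n (l n x) \<in> carrier (Q n)" "r n x \<in> carrier (Q n)" "l n x \<in> carrier (Q n)"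
          "\<delta> b \<in> carrier A"
          using x b rl(2) lc(2) \<delta>l(1) by auto
        show "l n (r n (x \<triangleleft>\<^bsub>Q n\<^esub> b)) \<ominus>\<^bsub>Q n\<^esub> r n (l n (x \<triangleleft>\<^bsub>Q n\<^esub> b)) = (l n (r n x) \<ominus>\<^bsub>Q n\<^esub> r n (l n x)) \<triangleleft>\<^bsub>Q n\<^esub> b"
          using x b c by (simp add: rl lc Qn.ract_simps Qn.M.M.ag_simps)
      qed (simp_all add: rl lc Qn.M.M.ag_simps)
      show "d n (s (Suc n) x) = s n (d n x)" if x: "x \<in> carrier (Q (Suc n))" for x
        using x rl(2) lc(2) rlin_group(3)[OF d_rlin Q_mod Q_mod]
        by (simp add: s_def conn_chainD(3)[OF l] chainD(3)[OF r])
    next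
      fix x assume x: "x \<in> carrier (Q 0)"
      have ax: "aug x \<in> carrier M" using rlinD(2)[OF aug_rlin x] .
      have "aug (s 0 x) = D (a \<triangleright>\<^bsub>M\<^esub> aug x) \<ominus>\<^bsub>M\<^esub> (a \<triangleright>\<^bsub>M\<^esub> D (aug x))"
        using x rl(2) lc(2) rlin_group(3)[OF aug_rlin Q_mod right_module_axioms]
        by (simp add: s_def conn_chainD(2)[OF l] chainD(2)[OF r])
      also have "\<dots> = \<delta> a \<triangleright>\<^bsub>M\<^esub> aug x"
        using ax a da connD(2)[OF D ax] by (simp add: DL lact_simps M.M.ag_simps)
      finally show "aug (s 0 x) = \<delta> a \<triangleright>\<^bsub>M\<^esub> aug x" .
    qed
    have "G (e \<triangleleft>\<^bsub>E\<^esub> a) = cl (\<lambda>x\<in>P. T (Suc m) f (r (Suc m) x) \<oplus>\<^bsub>A\<^esub> f (s (Suc m) x))"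
      unfolding e ract_cl[OF a f r refl] G[OF Zs_chain[OF r f]]
    proof (rule cl_cong)
      fix x assume x: "x \<in> P"
      have c: "l (Suc m) (r (Suc m) x) \<in> P" "r (Suc m) (l (Suc m) x) \<in> P" "r (Suc m) x \<in> P" "l (Suc m) x \<in> P"
        using x rl(2) lc(2) by auto
      have "f (s (Suc m) x) = f (l (Suc m) (r (Suc m) x)) \<ominus>\<^bsub>A\<^esub> f (r (Suc m) (l (Suc m) x))"
        using c rlin_group(3)[OF Zs_D(1)[OF f] Q_mod reg] by (simp add: s_def)
      moreover have "\<delta> (f (r (Suc m) x)) \<in> carrier A" "f (l (Suc m) (r (Suc m) x)) \<in> carrier A"
        "f (r (Suc m) (l (Suc m) x)) \<in> carrier A" using c fc \<delta>l(1) by auto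
      ultimately show "T (Suc m) (\<lambda>x\<in>P. f (r (Suc m) x)) x = T (Suc m) f (r (Suc m) x) \<oplus>\<^bsub>A\<^esub> f (s (Suc m) x)"
        using x c by (simp add: T_def A.M.ag_simps)
    qed
    also have "\<dots> = cl (\<lambda>x\<in>P. (\<lambda>x\<in>P. ?T f (r (Suc m) x)) x \<oplus>\<^bsub>A\<^esub> (\<lambda>x\<in>P. f (s (Suc m) x)) x)"
      by (rule cl_cong) (simp add: rl(2))
    also have "\<dots> = (G e \<triangleleft>\<^bsub>E\<^esub> a) \<oplus>\<^bsub>E\<^esub> (e \<triangleleft>\<^bsub>E\<^esub> \<delta> a)"
      unfolding e G[OF f] ract_cl[OF a TZ[OF f] r refl] ract_cl[OF da f s refl]
      by (rule cl_add[OF Zs_chain[OF r TZ[OF f]] Zs_chain[OF s f], symmetric])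
    finally show "G (e \<triangleleft>\<^bsub>E\<^esub> a) = (G e \<triangleleft>\<^bsub>E\<^esub> a) \<oplus>\<^bsub>E\<^esub> (e \<triangleleft>\<^bsub>E\<^esub> \<delta> a)" .
  qed
qed

text \<open>A left linear map \<open>F\<close> from \<open>Ext\<close> to \<open>A\<close> is evaluation of cocycles at an element \<open>w\<close> of the
  syzygy \<open>\<Omega>\<close>, by the dual basis of \<open>\<Omega>\<close>. As \<open>F\<close> kills coboundaries, \<open>w\<close> is annihilated by all
  functionals on the projective module containing \<open>\<Omega>\<close>, hence \<open>w = 0\<close>.\<close>

lemma E_no_hom:
  assumes \<Omega>: "fg_projective K A ((Q m)\<lparr>carrier := d m ` P\<rparr>)"
    and F: "F \<in> lin_map K E A"
    and FL: "\<And>a e. a \<in> carrier A \<Longrightarrow> e \<in> carrier E \<Longrightarrow> F (a \<triangleright>\<^bsub>E\<^esub> e) = a \<otimes>\<^bsub>A\<^esub> F e"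
    and e: "e \<in> carrier E"
  shows "F e = \<zero>\<^bsub>A\<^esub>"
proof -
  let ?\<Omega> = "(Q m)\<lparr>carrier := d m ` P\<rparr>"
  interpret O: right_module K A ?\<Omega> using \<Omega> by (simp add: fg_projective_def)
  note Om = O.right_module_axioms
  note Fl = lin_mapD[OF F]
  have \<Omega>Q: "d m ` P \<subseteq> carrier (Q m)" using rlinD(2)[OF d_rlin] by auto
  have dO: "d m \<in> rlin K A (Q (Suc m)) ?\<Omega>" by (rule rlin_corestrict[OF d_rlin]) simp
  have coc: "(\<lambda>x\<in>P. g (d m x)) \<in> Zs" if g: "g \<in> rlin K A ?\<Omega> (reg_bimod A)" for g
    using rlin_comp[OF dO g] rlin_group(1)[OF g Om reg] by (intro Zs_I) (simp_all add: d_d)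
  have cl0: "cl (\<lambda>x\<in>P. \<zero>\<^bsub>A\<^esub>) = \<zero>\<^bsub>E\<^esub>"
    using rlin_zero[OF Q_mod reg, of m] by (intro cl_zero W_I[of "\<lambda>_. \<zero>\<^bsub>A\<^esub>"]) simp_all
  have F0: "F \<zero>\<^bsub>E\<^esub> = \<zero>\<^bsub>A\<^esub>" by (rule lin_map_group(1)[OF F E_module A.module_axioms])
  \<comment> \<open>For \<open>u\<close> the identity this makes \<open>F\<close> an evaluation at
    \<open>w\<close>. A general finite rank \<open>u\<close> lets \<open>w\<close> be accumulated
    along the dual basis.\<close>
  have "\<exists>w\<in>d m ` P. \<forall>g\<in>rlin K A ?\<Omega> (reg_bimod A). F (cl (\<lambda>x\<in>P. g (u (d m x)))) = g w"
    if "u \<in> finrank K A ?\<Omega> ?\<Omega>" for u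
    using that
  proof induction
    case (finrank_zero u)
    show ?case
    proof (intro bexI[of _ "\<zero>\<^bsub>Q m\<^esub>"] ballI)
      fix g assume g: "g \<in> rlin K A ?\<Omega> (reg_bimod A)"
      have "g \<zero>\<^bsub>Q m\<^esub> = \<zero>\<^bsub>A\<^esub>" using rlin_group(1)[OF g Om reg] by simp
      then have "cl (\<lambda>x\<in>P. g (u (d m x))) = cl (\<lambda>x\<in>P. \<zero>\<^bsub>A\<^esub>)"
        using finrank_zero by (intro cl_cong) simp
      then show "F (cl (\<lambda>x\<in>P. g (u (d m x)))) = g \<zero>\<^bsub>Q m\<^esub>"
        using cl0 F0 \<open>g \<zero>\<^bsub>Q m\<^esub> = \<zero>\<^bsub>A\<^esub>\<close> by simp
    qed (use O.M.M.zero_closed in simp)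
  next
    case (finrank_step u p \<phi> v)
    obtain w where w: "w \<in> d m ` P" and Fw: "\<And>g. g \<in> rlin K A ?\<Omega> (reg_bimod A) \<Longrightarrow>
        F (cl (\<lambda>x\<in>P. g (u (d m x)))) = g w" using finrank_step.IH by blast
    \<comment> \<open>The value of \<open>F\<close> on the class of the coordinate functional
      \<phi>. The summand of \<open>p\<close> and \<phi> contributes \<open>g p\<close> times this
      class, so by left linearity \<open>F\<close> gives \<open>g p\<close> times \<open>t\<close>,
      which is \<open>g\<close> at \<open>p\<close> acted on by \<open>t\<close>.\<close>
    define t where "t = F (cl (\<lambda>x\<in>P. \<phi> (d m x)))"
    have t: "t \<in> carrier A" unfolding t_def by (rule Fl(1)[OF cl_in[OF coc[OF finrank_step(3)]]])
    have p: "p \<in> carrier ?\<Omega>" by (rule finrank_step(2))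
    have u: "u y \<in> carrier ?\<Omega>" if "y \<in> carrier ?\<Omega>" for y
      using rlinD(2)[OF finrank_rlin[OF Om Om finrank_step(1)] that] .
    note \<phi> = rlin_regD(1)[OF finrank_step(3)]
    have pt: "p \<triangleleft>\<^bsub>Q m\<^esub> t \<in> carrier ?\<Omega>" using O.ract_closed[OF p t] by simp
    show ?case
    proof (intro bexI[of _ "w \<oplus>\<^bsub>Q m\<^esub> (p \<triangleleft>\<^bsub>Q m\<^esub> t)"] ballI)
      fix g assume g: "g \<in> rlin K A ?\<Omega> (reg_bimod A)"
      note gl = rlin_regD[OF g]
      have gp: "g p \<in> carrier A" using gl(1)[OF p] .
      have Zu: "(\<lambda>x\<in>P. g (u (d m x))) \<in> Zs"
        using coc[OF rlin_comp[OF finrank_rlin[OF Om Om finrank_step(1)] g]] .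
      note Z\<phi> = coc[OF finrank_step(3)]
      have "cl (\<lambda>x\<in>P. g (v (d m x))) =
          cl (\<lambda>x\<in>P. (\<lambda>x\<in>P. g (u (d m x))) x \<oplus>\<^bsub>A\<^esub> (\<lambda>x\<in>P. g p \<otimes>\<^bsub>A\<^esub> (\<lambda>x\<in>P. \<phi> (d m x)) x) x)"
      proof (rule cl_cong)
        fix x assume x: "x \<in> P"
        have dx: "d m x \<in> carrier ?\<Omega>" using x by simp
        have v: "v (d m x) = u (d m x) \<oplus>\<^bsub>Q m\<^esub> (p \<triangleleft>\<^bsub>Q m\<^esub> \<phi> (d m x))"
          using bspec[OF finrank_step(4) dx] by simp
        have "p \<triangleleft>\<^bsub>Q m\<^esub> \<phi> (d m x) \<in> carrier ?\<Omega>" using O.ract_closed[OF p \<phi>[OF dx]] by simp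
        from gl(2)[OF u[OF dx] this] gl(4)[OF p \<phi>[OF dx]]
        have "g (v (d m x)) = g (u (d m x)) \<oplus>\<^bsub>A\<^esub> g p \<otimes>\<^bsub>A\<^esub> \<phi> (d m x)" by (simp add: v)
        then show "g (v (d m x)) =
            (\<lambda>x\<in>P. g (u (d m x))) x \<oplus>\<^bsub>A\<^esub> (\<lambda>x\<in>P. g p \<otimes>\<^bsub>A\<^esub> (\<lambda>x\<in>P. \<phi> (d m x)) x) x"
          using x by simp
      qed
      also have "\<dots> = cl (\<lambda>x\<in>P. g (u (d m x))) \<oplus>\<^bsub>E\<^esub> (g p \<triangleright>\<^bsub>E\<^esub> cl (\<lambda>x\<in>P. \<phi> (d m x)))"
        by (simp only: cl_add[OF Zu Zs_lmult[OF gp Z\<phi>]] lact_cl[OF gp Z\<phi>])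
      finally have "F (cl (\<lambda>x\<in>P. g (v (d m x)))) = g w \<oplus>\<^bsub>A\<^esub> g p \<otimes>\<^bsub>A\<^esub> t"
        by (simp only: Fl(2)[OF cl_in[OF Zu] bimodule.lact_closed[OF E_bimodule gp cl_in[OF Z\<phi>]]]
            Fw[OF g] t_def FL[OF gp cl_in[OF Z\<phi>]])
      also have "\<dots> = g (w \<oplus>\<^bsub>Q m\<^esub> (p \<triangleleft>\<^bsub>Q m\<^esub> t))"
        using gl(2)[OF _ pt, of w] gl(4)[OF p t] w by simp
      finally show "F (cl (\<lambda>x\<in>P. g (v (d m x)))) = g (w \<oplus>\<^bsub>Q m\<^esub> (p \<triangleleft>\<^bsub>Q m\<^esub> t))" .
    next
      show "w \<oplus>\<^bsub>Q m\<^esub> (p \<triangleleft>\<^bsub>Q m\<^esub> t) \<in> d m ` P"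
        using O.M.M.a_closed[of w "p \<triangleleft>\<^bsub>Q m\<^esub> t"] w pt by simp
    qed
  qed
  from this[of "\<lambda>y. y"] obtain w where w: "w \<in> d m ` P" and
    Fw: "\<And>g. g \<in> rlin K A ?\<Omega> (reg_bimod A) \<Longrightarrow> F (cl (\<lambda>x\<in>P. g (d m x))) = g w"
    using \<Omega> by (auto simp: fg_projective_def)
  have wQ: "w \<in> carrier (Q m)" using w \<Omega>Q by blast
  have \<psi>w: "\<psi> w = \<zero>\<^bsub>A\<^esub>" if \<psi>: "\<psi> \<in> rlin K A (Q m) (reg_bimod A)" for \<psi>
  proof -
    have "cl (\<lambda>x\<in>P. \<psi> (d m x)) = \<zero>\<^bsub>E\<^esub>" by (intro cl_zero W_I[OF \<psi>]) simp_all
    then show ?thesis using Fw[OF rlin_sub[OF \<psi> \<Omega>Q]] F0 by simp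
  qed
  have "(\<lambda>y. y) \<in> finrank K A (Q m) (Q m)" using Q_proj by (simp add: fg_projective_def)
  from fg_projective_functionals[OF Q_mod Q_mod this] have w0: "w = \<zero>\<^bsub>Q m\<^esub>"
    using wQ \<psi>w by (meson subsetD)
  obtain f where f: "f \<in> Zs" "e = cl f" using e by (auto simp: E_carrier)
  have dsurj: "d m ` carrier (Q (Suc m)) = carrier ?\<Omega>" by simp
  have kerf: "f x = \<zero>\<^bsub>reg_bimod A\<^esub>" if "x \<in> P" "d m x = \<zero>\<^bsub>?\<Omega>\<^esub>" for x
    using cocycle_factor[OF Zs_D(1)[OF f(1)] reg _ that(1)] that(2) Zs_D(3)[OF f(1)] by simp
  \<comment> \<open>Cocycles vanish on the kernel of \<open>d m\<close>, so each one comes from a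
    functional on \<Omega>, and every class is reached by \<open>Fw\<close>.\<close>
  obtain g where g: "g \<in> rlin K A ?\<Omega> (reg_bimod A)" "\<And>x. x \<in> P \<Longrightarrow> g (d m x) = f x"
    by (rule rlin_factor[OF Q_mod Om reg dO dsurj Zs_D(1)[OF f(1)] kerf]) (assumption+, rule that)
  have "(\<lambda>x\<in>P. g (d m x)) = f"
    using Zs_D(2)[OF f(1)] g(2) by (intro extensionalityI[of _ P]) auto
  then have "F e = g w" using Fw[OF g(1)] f(2) by simp
  also have "\<dots> = \<zero>\<^bsub>A\<^esub>" using rlin_group(1)[OF g(1) Om reg] w0 by simp
  finally show ?thesis .
qed

end

section \<open>Endomorphism algebras of rigid modules over hereditary algebras\<close>

lemma rlin_nsum:
  assumes "\<And>j. j < n \<Longrightarrow> f j \<in> rlin K A L N" "right_module K A L" "right_module K A N"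
  shows "(\<lambda>y. nsum N (\<lambda>j. f j y) n) \<in> rlin K A L N"
  using assms(1)
proof (induction n)
  case 0
  then show ?case using rlin_zero[OF assms(2,3)] by simp
next
  case (Suc n)
  have "(\<lambda>y. nsum N (\<lambda>j. f j y) n) \<in> rlin K A L N" using Suc by simp
  from rlin_add[OF this Suc.prems assms(2,3), of n] show ?case by simp
qed

text \<open>Since \<open>H\<close> is hereditary, the preimage of \<open>T \<subseteq> U\<^sup>n\<close> in \<open>P\<^sup>n\<close> is projective, so its projection
  onto \<open>T\<close> lifts to \<open>U\<^sup>r\<close>. On the kernel of \<open>P\<^sup>n \<rightarrow> U\<^sup>n\<close> the lift agrees with a map that is defined on
  all of \<open>P\<^sup>n\<close>, by \<open>Ext\<^sup>1(U, U) = 0\<close>, and that \<open>\<sigma>\<close> kills, by the lifting property of \<open>\<sigma>\<close>. The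
  difference descends to a section of \<open>\<sigma>\<close>.\<close>

lemma split_by_extension:
  fixes U :: "('k, 'u, 'h, 'z) rmod_scheme" and P :: "('k, 'p, 'h, 'y) rmod_scheme"
  assumes H: "k_algebra K H"
    and ideals: "\<And>I. rsubmod H (reg_bimod H) I \<Longrightarrow> fg_projective K H ((reg_bimod H)\<lparr>carrier := I\<rparr>)"
    and U: "right_module K H U" and P: "fg_projective K H P"
    and \<epsilon>: "\<epsilon> \<in> rlin K H P U" and \<epsilon>_surj: "\<epsilon> ` carrier P = carrier U"
    and ext: "\<And>f. f \<in> rlin K H (P\<lparr>carrier := {x \<in> carrier P. \<epsilon> x = \<zero>\<^bsub>U\<^esub>}\<rparr>) U \<Longrightarrow>
      \<exists>g\<in>rlin K H P U. \<forall>x\<in>carrier P. \<epsilon> x = \<zero>\<^bsub>U\<^esub> \<longrightarrow> g x = f x"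
    and \<sigma>: "\<sigma> \<in> rlin K H (power_mod r U) (power_mod n U)"
    and T: "T = \<sigma> ` carrier (power_mod r U)"
    and lift: "\<And>v. v \<in> rlin K H U (power_mod n U) \<Longrightarrow> v ` carrier U \<subseteq> T \<Longrightarrow>
      \<exists>\<kappa>\<in>rlin K H U (power_mod r U). \<forall>u\<in>carrier U. \<sigma> (\<kappa> u) = v u"
  shows "\<exists>\<tau>\<in>rlin K H ((power_mod n U)\<lparr>carrier := T\<rparr>) (power_mod r U). \<forall>t\<in>T. \<sigma> (\<tau> t) = t"
proof -
  let ?V = "power_mod n U" and ?W = "power_mod r U" and ?F = "power_mod n P"
  have Pm: "right_module K H P" using P by (simp add: fg_projective_def)
  have Vm: "right_module K H ?V" and Wm: "right_module K H ?W" and Fm: "right_module K H ?F"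
    by (rule power_mod_right_module[OF U] power_mod_right_module[OF Pm])+
  interpret U: right_module K H U by fact
  interpret P: right_module K H P by (rule Pm)
  interpret V: right_module K H ?V by (rule Vm)
  interpret W: right_module K H ?W by (rule Wm)
  interpret F: right_module K H ?F by (rule Fm)
  define Ker where "Ker = {x \<in> carrier P. \<epsilon> x = \<zero>\<^bsub>U\<^esub>}"
  have KerP: "Ker \<subseteq> carrier P" by (auto simp: Ker_def)
  have Ker: "rsubmod H P Ker" unfolding Ker_def by (rule rsubmod_ker[OF \<epsilon> Pm U])
  have Ker0: "\<zero>\<^bsub>P\<^esub> \<in> Ker" using Ker by (simp add: rsubmod_def)
  define eps where "eps p = (\<lambda>i\<in>{..<n}. \<epsilon> (p i))" for p
  have eps: "eps \<in> rlin K H ?F ?V"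
    unfolding eps_def by (rule power_mod_tuple[OF rlin_comp[OF power_mod_coord \<epsilon>]])
  have Tsub: "rsubmod H ?V T" unfolding T by (rule rsubmod_image[OF \<sigma> Wm Vm])
  have TV: "T \<subseteq> carrier ?V" using Tsub by (simp add: rsubmod_def)
  define PT where "PT = {p \<in> carrier ?F. eps p \<in> T}"
  have PTF: "PT \<subseteq> carrier ?F" by (auto simp: PT_def)
  have PTsub: "rsubmod H ?F PT"
    unfolding rsubmod_def
  proof (intro conjI ballI)
    show "PT \<subseteq> carrier ?F" by (rule PTF)
    show "\<zero>\<^bsub>?F\<^esub> \<in> PT"
      using F.M.M.zero_closed Tsub rlin_group(1)[OF eps Fm Vm] unfolding PT_def rsubmod_def by simp
    show "x \<oplus>\<^bsub>?F\<^esub> y \<in> PT" if "x \<in> PT" "y \<in> PT" for x y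
      using that Tsub F.M.M.a_closed[of x y] rlinD(3)[OF eps, of x y] unfolding PT_def rsubmod_def by simp
    show "x \<triangleleft>\<^bsub>?F\<^esub> a \<in> PT" if "x \<in> PT" "a \<in> carrier H" for x a
      using that Tsub F.ract_closed[of x a] rlinD(5)[OF eps, of x a] unfolding PT_def rsubmod_def by simp
  qed
  let ?T = "?V\<lparr>carrier := T\<rparr>" and ?PT = "?F\<lparr>carrier := PT\<rparr>"
  have Tm: "right_module K H ?T" by (rule V.right_module_sub[OF Tsub])
  have PTm: "right_module K H ?PT" by (rule F.right_module_sub[OF PTsub])
  have PTproj: "fg_projective K H ?PT"
  proof -
    have "(\<lambda>y. y) \<in> finrank K H P P" using P by (simp add: fg_projective_def)
    from fg_projective_functionals[OF Pm Pm this] obtain \<Phi> where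
      \<Phi>: "finite \<Phi>" "\<Phi> \<subseteq> rlin K H P (reg_bimod H)"
        "\<And>y. y \<in> carrier P \<Longrightarrow> \<forall>\<phi>\<in>\<Phi>. \<phi> y = \<zero>\<^bsub>H\<^esub> \<Longrightarrow> y = \<zero>\<^bsub>P\<^esub>" by blast
    \<comment> \<open>Functionals separating the points of \<open>P\<close>, applied in each
      coordinate, separate those of the powers of \<open>P\<close>, hence of
      \<open>PT\<close>.\<close>
    let ?\<Psi> = "(\<lambda>(\<phi>, i). \<lambda>p. \<phi> (p i)) ` (\<Phi> \<times> {..<n})"
    show ?thesis
    proof (rule fg_projective_by_functionals[OF H ideals _ PTm, of ?\<Psi>])
      show "finite ?\<Psi>" using \<Phi>(1) by simp
      have "(\<lambda>p. \<phi> (p i)) \<in> rlin K H ?PT (reg_bimod H)" if "\<phi> \<in> \<Phi>" "i < n" for \<phi> i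
        by (rule rlin_sub[OF rlin_comp[OF power_mod_coord[OF that(2)] subsetD[OF \<Phi>(2) that(1)]] PTF])
      then show "?\<Psi> \<subseteq> rlin K H ?PT (reg_bimod H)" by auto
    next
      fix p assume p: "p \<in> carrier ?PT" and 0: "\<forall>\<psi>\<in>?\<Psi>. \<psi> p = \<zero>\<^bsub>H\<^esub>"
      have pF: "p \<in> carrier ?F" using p PTF by auto
      have "p i = \<zero>\<^bsub>P\<^esub>" if i: "i < n" for i
      proof (rule \<Phi>(3))
        show "p i \<in> carrier P" using rlinD(2)[OF power_mod_coord[OF i] pF] .
        show "\<forall>\<phi>\<in>\<Phi>. \<phi> (p i) = \<zero>\<^bsub>H\<^esub>" using 0 i by force
      qed
      then have "p = \<zero>\<^bsub>?F\<^esub>" by (intro power_mod_ext[OF pF F.M.M.zero_closed]) simp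
      then show "p = \<zero>\<^bsub>?PT\<^esub>" by simp
    qed
  qed
  have epsPT: "eps \<in> rlin K H ?PT ?V" by (rule rlin_sub[OF eps PTF])
  have "eps ` carrier ?PT \<subseteq> \<sigma> ` carrier ?W" unfolding T[symmetric] by (auto simp: PT_def)
  from fg_projective_lift[OF PTproj Wm Vm epsPT \<sigma> this] obtain lam where
    lam: "lam \<in> rlin K H ?PT ?W" and \<sigma>lam: "\<And>p. p \<in> PT \<Longrightarrow> \<sigma> (lam p) = eps p" by auto
  \<comment> \<open>The hypothesis \<open>ext\<close> extends maps from one copy of the kernel. The
    kernel of \<open>eps\<close> consists of the tuples with entries in \<open>Ker\<close>, so it is
    treated coordinate by coordinate through these inclusions.\<close>
  define inc where "inc i x = (\<lambda>j\<in>{..<n}. if j = i then x else \<zero>\<^bsub>P\<^esub>)" for i :: nat and x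
  have inc: "inc i \<in> rlin K H P ?F" for i
    unfolding inc_def
  proof (rule power_mod_tuple)
    show "(\<lambda>x. if j = i then x else \<zero>\<^bsub>P\<^esub>) \<in> rlin K H P P" for j
      using rlin_id[OF Pm] rlin_zero[OF Pm Pm] by (cases "j = i") auto
  qed
  have eps_ker: "eps p = \<zero>\<^bsub>?V\<^esub>" if "p \<in> carrier ?F" "\<And>i. i < n \<Longrightarrow> p i \<in> Ker" for p
    using that(2) by (auto simp: eps_def Ker_def intro!: restrict_ext)
  have ker_PT: "p \<in> PT" if "p \<in> carrier ?F" "\<And>i. i < n \<Longrightarrow> p i \<in> Ker" for p
    using that eps_ker[OF that] Tsub unfolding PT_def rsubmod_def by simp
  have incK: "inc i x \<in> PT" "eps (inc i x) = \<zero>\<^bsub>?V\<^esub>" if "x \<in> Ker" for i x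
  proof -
    have F: "inc i x \<in> carrier ?F" using rlinD(2)[OF inc] that KerP by blast
    have K: "inc i x j \<in> Ker" if "j < n" for j
      using \<open>x \<in> Ker\<close> Ker0 that by (simp add: inc_def)
    show "inc i x \<in> PT" "eps (inc i x) = \<zero>\<^bsub>?V\<^esub>" by (rule ker_PT[OF F K] eps_ker[OF F K]; assumption)+
  qed
  have \<sigma>0: "\<sigma> \<zero>\<^bsub>?W\<^esub> = \<zero>\<^bsub>?V\<^esub>" by (rule rlin_group(1)[OF \<sigma> Wm Vm])
  \<comment> \<open>Extend \<open>lam\<close> from the i-th copy of \<open>Ker\<close> to \<mu>' on
    \<open>P\<close>. Then \<sigma> after \<mu>' kills \<open>Ker\<close> and descends to a map
    \<open>v\<close> from \<open>U\<close> into \<open>T\<close>. Subtracting a lift \<kappa> of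
    \<open>v\<close> makes \<sigma> kill the result and changes nothing on
    \<open>Ker\<close>.\<close>
  have one: "\<exists>\<mu>\<in>rlin K H P ?W. (\<forall>x\<in>carrier P. \<sigma> (\<mu> x) = \<zero>\<^bsub>?V\<^esub>) \<and> (\<forall>x\<in>Ker. \<mu> x = lam (inc i x))" for i
  proof -
    have incKer: "inc i \<in> rlin K H (P\<lparr>carrier := Ker\<rparr>) ?PT"
      by (rule rlin_corestrict[OF rlin_sub[OF inc KerP]]) (simp add: incK)
    have li: "(\<lambda>x. lam (inc i x)) \<in> rlin K H (P\<lparr>carrier := Ker\<rparr>) ?W"
      by (rule rlin_comp[OF incKer lam])
    have "\<exists>g\<in>rlin K H P U. \<forall>x\<in>Ker. g x = lam (inc i x) j" if j: "j < r" for j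
    proof -
      have "(\<lambda>x. lam (inc i x) j) \<in> rlin K H (P\<lparr>carrier := Ker\<rparr>) U"
        by (rule rlin_comp[OF li power_mod_coord[OF j]])
      from ext[OF this[unfolded Ker_def]] show ?thesis by (auto simp: Ker_def)
    qed
    then obtain g where g: "\<And>j. j < r \<Longrightarrow> g j \<in> rlin K H P U"
      and gK: "\<And>j x. j < r \<Longrightarrow> x \<in> Ker \<Longrightarrow> g j x = lam (inc i x) j" by metis
    define \<mu>' where "\<mu>' x = (\<lambda>j\<in>{..<r}. g j x)" for x
    have \<mu>': "\<mu>' \<in> rlin K H P ?W" unfolding \<mu>'_def by (rule power_mod_tuple[OF g])
    have \<mu>'K: "\<mu>' x = lam (inc i x)" if x: "x \<in> Ker" for x
    proof (rule power_mod_ext)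
      show "\<mu>' x \<in> carrier ?W" using rlinD(2)[OF \<mu>'] x KerP by blast
      show "lam (inc i x) \<in> carrier ?W" using rlinD(2)[OF li] x by simp
      show "\<mu>' x j = lam (inc i x) j" if "j < r" for j using that x by (simp add: \<mu>'_def gK)
    qed
    have "\<sigma> (\<mu>' x) = \<zero>\<^bsub>?V\<^esub>" if "x \<in> carrier P" "\<epsilon> x = \<zero>\<^bsub>U\<^esub>" for x
    proof -
      have x: "x \<in> Ker" using that by (simp add: Ker_def)
      show ?thesis unfolding \<mu>'K[OF x] \<sigma>lam[OF incK(1)[OF x]] by (rule incK(2)[OF x])
    qed
    from rlin_factor[OF Pm U Vm \<epsilon> \<epsilon>_surj rlin_comp[OF \<mu>' \<sigma>] this] obtain v where
      v: "v \<in> rlin K H U ?V" and v\<epsilon>: "\<And>x. x \<in> carrier P \<Longrightarrow> v (\<epsilon> x) = \<sigma> (\<mu>' x)" by metis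
    have "v ` carrier U \<subseteq> T"
    proof
      fix y assume "y \<in> v ` carrier U"
      then obtain x where "x \<in> carrier P" "y = v (\<epsilon> x)" unfolding \<epsilon>_surj[symmetric] by auto
      then show "y \<in> T" unfolding T using v\<epsilon> rlinD(2)[OF \<mu>'] by auto
    qed
    from lift[OF v this] obtain \<kappa> where \<kappa>: "\<kappa> \<in> rlin K H U ?W"
      and \<sigma>\<kappa>: "\<And>u. u \<in> carrier U \<Longrightarrow> \<sigma> (\<kappa> u) = v u" by blast
    note \<kappa>\<epsilon> = rlin_comp[OF \<epsilon> \<kappa>]
    show ?thesis
    proof (intro bexI conjI ballI)
      show "(\<lambda>x. \<mu>' x \<ominus>\<^bsub>?W\<^esub> \<kappa> (\<epsilon> x)) \<in> rlin K H P ?W" by (rule rlin_diff[OF \<mu>' \<kappa>\<epsilon> Pm Wm])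
      show "\<sigma> (\<mu>' x \<ominus>\<^bsub>?W\<^esub> \<kappa> (\<epsilon> x)) = \<zero>\<^bsub>?V\<^esub>" if x: "x \<in> carrier P" for x
        unfolding rlin_group(3)[OF \<sigma> Wm Vm rlinD(2)[OF \<mu>' x] rlinD(2)[OF \<kappa>\<epsilon> x]]
          \<sigma>\<kappa>[OF rlinD(2)[OF \<epsilon> x]] v\<epsilon>[OF x] V.M.M.minus_eq
        by (rule V.M.M.r_neg[OF rlinD(2)[OF \<sigma> rlinD(2)[OF \<mu>' x]]])
      show "\<mu>' x \<ominus>\<^bsub>?W\<^esub> \<kappa> (\<epsilon> x) = lam (inc i x)" if x: "x \<in> Ker" for x
      proof -
        have "\<epsilon> x = \<zero>\<^bsub>U\<^esub>" "x \<in> carrier P" using x by (auto simp: Ker_def)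
        then have "\<mu>' x \<ominus>\<^bsub>?W\<^esub> \<kappa> (\<epsilon> x) = \<mu>' x"
          using rlinD(2)[OF \<mu>' \<open>x \<in> carrier P\<close>]
          by (simp only: rlin_group(1)[OF \<kappa> U Wm] W.M.M.minus_eq W.M.M.a_inv_zero W.M.M.r_zero)
        then show ?thesis by (simp only: \<mu>'K[OF x])
      qed
    qed
  qed
  \<comment> \<open>Adds up the maps for the single coordinates; \<open>k\<close> bounds the support
    of the tuples on which agreement with \<open>lam\<close> is already known.\<close>
  have "\<exists>\<mu>\<in>rlin K H ?F ?W. (\<forall>p\<in>carrier ?F. \<sigma> (\<mu> p) = \<zero>\<^bsub>?V\<^esub>) \<and>
     (\<forall>p\<in>carrier ?F. (\<forall>i<n. p i \<in> Ker) \<and> (\<forall>i<n. k \<le> i \<longrightarrow> p i = \<zero>\<^bsub>P\<^esub>) \<longrightarrow> \<mu> p = lam p)" for k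
  proof (induction k)
    case 0
    show ?case
    proof (intro bexI[OF _ rlin_zero[OF Fm Wm]] conjI ballI impI)
      show "\<sigma> \<zero>\<^bsub>?W\<^esub> = \<zero>\<^bsub>?V\<^esub>" by (rule \<sigma>0)
      fix p assume p: "p \<in> carrier ?F" "(\<forall>i<n. p i \<in> Ker) \<and> (\<forall>i<n. 0 \<le> i \<longrightarrow> p i = \<zero>\<^bsub>P\<^esub>)"
      have "p = \<zero>\<^bsub>?F\<^esub>" using p(2) by (intro power_mod_ext[OF p(1) F.M.M.zero_closed]) simp
      then show "\<zero>\<^bsub>?W\<^esub> = lam p" using rlin_group(1)[OF lam PTm Wm] by simp
    qed
  next
    case (Suc k)
    then obtain \<mu> where \<mu>: "\<mu> \<in> rlin K H ?F ?W" and \<sigma>\<mu>: "\<And>p. p \<in> carrier ?F \<Longrightarrow> \<sigma> (\<mu> p) = \<zero>\<^bsub>?V\<^esub>"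
      and \<mu>l: "\<And>p. p \<in> carrier ?F \<Longrightarrow> \<forall>i<n. p i \<in> Ker \<Longrightarrow> \<forall>i<n. k \<le> i \<longrightarrow> p i = \<zero>\<^bsub>P\<^esub> \<Longrightarrow> \<mu> p = lam p"
      by blast
    show ?case
    proof (cases "k < n")
      case False
      have "\<mu> p = lam p" if "p \<in> carrier ?F" "\<forall>i<n. p i \<in> Ker" for p
        using that False by (intro \<mu>l) auto
      then show ?thesis using \<sigma>\<mu> by (intro bexI[OF _ \<mu>]) auto
    next
      case True
      obtain \<nu> where \<nu>: "\<nu> \<in> rlin K H P ?W" and \<sigma>\<nu>: "\<And>x. x \<in> carrier P \<Longrightarrow> \<sigma> (\<nu> x) = \<zero>\<^bsub>?V\<^esub>"
        and \<nu>K: "\<And>x. x \<in> Ker \<Longrightarrow> \<nu> x = lam (inc k x)" using one[of k] by blast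
      define z where "z p = (\<lambda>i\<in>{..<n}. if i = k then \<zero>\<^bsub>P\<^esub> else p i)" for p
      have z: "z \<in> rlin K H ?F ?F"
        unfolding z_def
      proof (rule power_mod_tuple)
        show "(\<lambda>p. if i = k then \<zero>\<^bsub>P\<^esub> else p i) \<in> rlin K H ?F P" if "i < n" for i
          using power_mod_coord[OF that] rlin_zero[OF Fm Pm] by (cases "i = k") auto
      qed
      note \<mu>z = rlin_comp[OF z \<mu>] and \<nu>k = rlin_comp[OF power_mod_coord[OF True] \<nu>]
      show ?thesis
      proof (intro bexI[OF _ rlin_add[OF \<mu>z \<nu>k Fm Wm]] conjI ballI impI)
        fix p assume p: "p \<in> carrier ?F"
        have pk: "p k \<in> carrier P" using rlinD(2)[OF power_mod_coord[OF True] p] .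
        have zp: "z p \<in> carrier ?F" using rlinD(2)[OF z p] .
        show "\<sigma> (\<mu> (z p) \<oplus>\<^bsub>?W\<^esub> \<nu> (p k)) = \<zero>\<^bsub>?V\<^esub>"
          unfolding rlinD(3)[OF \<sigma> rlinD(2)[OF \<mu>z p] rlinD(2)[OF \<nu>k p]] \<sigma>\<mu>[OF zp] \<sigma>\<nu>[OF pk]
          by (rule V.M.M.l_zero[OF V.M.M.zero_closed])
        assume K: "(\<forall>i<n. p i \<in> Ker) \<and> (\<forall>i<n. Suc k \<le> i \<longrightarrow> p i = \<zero>\<^bsub>P\<^esub>)"
        have zK: "\<forall>i<n. z p i \<in> Ker" using K Ker0 by (simp add: z_def)
        have "\<mu> (z p) = lam (z p)" using K by (intro \<mu>l[OF zp zK]) (auto simp: z_def)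
        moreover have "\<nu> (p k) = lam (inc k (p k))" using K True by (intro \<nu>K) simp
        moreover have "lam (z p \<oplus>\<^bsub>?PT\<^esub> inc k (p k)) = lam (z p) \<oplus>\<^bsub>?W\<^esub> lam (inc k (p k))"
          using zK K True ker_PT[OF zp] incK(1) by (intro rlinD(3)[OF lam]) auto
        moreover have "z p \<oplus>\<^bsub>?PT\<^esub> inc k (p k) = p"
        proof -
          have c: "p i \<in> carrier P" if "i < n" for i using rlinD(2)[OF power_mod_coord[OF that] p] .
          show ?thesis
          proof (rule power_mod_ext[OF _ p])
            show "z p \<oplus>\<^bsub>?PT\<^esub> inc k (p k) \<in> carrier ?F"
              using F.M.M.a_closed[OF zp rlinD(2)[OF inc pk]] by simp
            show "(z p \<oplus>\<^bsub>?PT\<^esub> inc k (p k)) i = p i" if "i < n" for i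
              using that c[OF that] pk by (simp add: z_def inc_def)
          qed
        qed
        ultimately show "\<mu> (z p) \<oplus>\<^bsub>?W\<^esub> \<nu> (p k) = lam p" by simp
      qed
    qed
  qed
  from this[of n] obtain \<mu> where \<mu>: "\<mu> \<in> rlin K H ?F ?W" and \<sigma>\<mu>: "\<And>p. p \<in> carrier ?F \<Longrightarrow> \<sigma> (\<mu> p) = \<zero>\<^bsub>?V\<^esub>"
    and \<mu>l: "\<And>p. p \<in> carrier ?F \<Longrightarrow> \<forall>i<n. p i \<in> Ker \<Longrightarrow> \<mu> p = lam p" by auto
  have \<mu>PT: "\<mu> \<in> rlin K H ?PT ?W" by (rule rlin_sub[OF \<mu> PTF])
  \<comment> \<open>The corrected lift: it still lies over \<open>eps\<close>, as \<sigma> kills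
    \<mu>, and it vanishes on the kernel of \<open>eps\<close>. So it descends to a section of
    \<sigma> over \<open>T\<close>.\<close>
  have e: "(\<lambda>p. lam p \<ominus>\<^bsub>?W\<^esub> \<mu> p) \<in> rlin K H ?PT ?W" by (rule rlin_diff[OF lam \<mu>PT PTm Wm])
  have epsT: "eps \<in> rlin K H ?PT ?T" by (rule rlin_corestrict[OF epsPT]) (simp add: PT_def)
  have eps_surj: "eps ` carrier ?PT = carrier ?T"
  proof
    show "eps ` carrier ?PT \<subseteq> carrier ?T" by (auto simp: PT_def)
    show "carrier ?T \<subseteq> eps ` carrier ?PT"
    proof
      fix t assume t: "t \<in> carrier ?T"
      then have tV: "t \<in> carrier ?V" using TV by auto
      have "\<exists>x\<in>carrier P. \<epsilon> x = t i" if "i < n" for i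
      proof -
        have "t i \<in> \<epsilon> ` carrier P" unfolding \<epsilon>_surj using rlinD(2)[OF power_mod_coord[OF that] tV] .
        then show ?thesis by auto
      qed
      then obtain x where x: "\<And>i. i < n \<Longrightarrow> x i \<in> carrier P" "\<And>i. i < n \<Longrightarrow> \<epsilon> (x i) = t i" by metis
      let ?p = "\<lambda>i\<in>{..<n}. x i"
      have p: "?p \<in> carrier ?F" using x(1) by auto
      have "eps ?p = t"
        by (rule power_mod_ext[OF rlinD(2)[OF eps p] tV]) (simp add: eps_def x)
      then show "t \<in> eps ` carrier ?PT" using p t by (intro image_eqI[of _ _ ?p]) (simp_all add: PT_def)
    qed
  qed
  have "lam p \<ominus>\<^bsub>?W\<^esub> \<mu> p = \<zero>\<^bsub>?W\<^esub>" if p: "p \<in> carrier ?PT" and 0: "eps p = \<zero>\<^bsub>?T\<^esub>" for p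
  proof -
    have pF: "p \<in> carrier ?F" using p PTF by auto
    have "p i \<in> Ker" if "i < n" for i
      using fun_cong[OF 0, of i] rlinD(2)[OF power_mod_coord[OF that] pF] that by (simp add: eps_def Ker_def)
    then have "\<mu> p = lam p" by (intro \<mu>l[OF pF]) simp
    then show ?thesis using rlinD(2)[OF lam p] by (simp only: W.M.M.minus_eq W.M.M.r_neg)
  qed
  from rlin_factor[OF PTm Tm Wm epsT eps_surj e this] obtain \<tau> where \<tau>: "\<tau> \<in> rlin K H ?T ?W"
    and \<tau>e: "\<And>p. p \<in> PT \<Longrightarrow> \<tau> (eps p) = lam p \<ominus>\<^bsub>?W\<^esub> \<mu> p" by auto
  have "\<sigma> (\<tau> t) = t" if t: "t \<in> T" for t
  proof -
    have "t \<in> eps ` carrier ?PT" unfolding eps_surj using t by simp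
    then obtain p where p: "p \<in> PT" "t = eps p" by auto
    have pF: "p \<in> carrier ?F" and pP: "p \<in> carrier ?PT" using p PTF by auto
    have "\<sigma> (\<tau> t) = \<sigma> (lam p) \<ominus>\<^bsub>?V\<^esub> \<sigma> (\<mu> p)"
      unfolding p(2) \<tau>e[OF p(1)] by (rule rlin_group(3)[OF \<sigma> Wm Vm rlinD(2)[OF lam pP] rlinD(2)[OF \<mu> pF]])
    also have "\<dots> = t"
      using rlinD(2)[OF eps pF]
      by (simp only: \<sigma>lam[OF p(1)] \<sigma>\<mu>[OF pF] p(2) V.M.M.minus_eq V.M.M.a_inv_zero V.M.M.r_zero)
    finally show ?thesis .
  qed
  with \<tau> show ?thesis by blast
qed

text \<open>The isomorphism of \<open>C\<close> with the endomorphism algebra of \<open>U\<close>,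
  unpacked into a faithful and full action by \<open>H\<close>-linear maps. Identities in
  \<open>C\<close> are then checked on elements of \<open>U\<close>, and elements of
  \<open>C\<close> are produced from endomorphisms.\<close>

locale endo_algebra = U: right_module K H U + C: k_algebra K C
  for K :: "('k, 'r) ring_scheme" and H :: "('k, 'h, 't) module_scheme"
    and U :: "('k, 'u, 'h, 'z) rmod_scheme" and C :: "('k, 'c, 's) module_scheme" +
  fixes act :: "'c \<Rightarrow> 'u \<Rightarrow> 'u"
  assumes act_rlin: "c \<in> carrier C \<Longrightarrow> act c \<in> rlin K H U U"
    and act_add: "\<lbrakk>b \<in> carrier C; c \<in> carrier C; u \<in> carrier U\<rbrakk> \<Longrightarrow> act (b \<oplus>\<^bsub>C\<^esub> c) u = act b u \<oplus>\<^bsub>U\<^esub> act c u"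
    and act_mult: "\<lbrakk>b \<in> carrier C; c \<in> carrier C; u \<in> carrier U\<rbrakk> \<Longrightarrow> act (b \<otimes>\<^bsub>C\<^esub> c) u = act b (act c u)"
    and act_smult: "\<lbrakk>r \<in> carrier K; c \<in> carrier C; u \<in> carrier U\<rbrakk> \<Longrightarrow> act (r \<odot>\<^bsub>C\<^esub> c) u = r \<odot>\<^bsub>U\<^esub> act c u"
    and act_faithful: "\<lbrakk>b \<in> carrier C; c \<in> carrier C; \<And>u. u \<in> carrier U \<Longrightarrow> act b u = act c u\<rbrakk> \<Longrightarrow> b = c"
    and act_full: "v \<in> rlin K H U U \<Longrightarrow> \<exists>c\<in>carrier C. \<forall>u\<in>carrier U. act c u = v u"
begin

lemma act_closed: "c \<in> carrier C \<Longrightarrow> u \<in> carrier U \<Longrightarrow> act c u \<in> carrier U"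
  using rlinD(2)[OF act_rlin] .

lemma act_lin_left: "u \<in> carrier U \<Longrightarrow> (\<lambda>c. act c u) \<in> lin_map K C U"
  by (rule lin_mapI) (simp_all add: act_closed act_add act_smult)

lemma act_zero: "u \<in> carrier U \<Longrightarrow> act \<zero>\<^bsub>C\<^esub> u = \<zero>\<^bsub>U\<^esub>"
  using lin_map_group(1)[OF act_lin_left C.module_axioms U.M.module_axioms] .

lemma act_nsum:
  assumes "u \<in> carrier U" "\<And>i. i < n \<Longrightarrow> f i \<in> carrier C"
  shows "act (nsum C f n) u = nsum U (\<lambda>i. act (f i) u) n"
  using assms
  by (intro nsum_hom[where h = "\<lambda>c. act c u"]) (auto simp: act_add act_zero C.M.abelian_group_axioms)

text \<open>Identifies \<open>C\<^sup>n\<close> with the homomorphisms \<open>U \<rightarrow> U\<^sup>n\<close>.\<close>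

definition hat :: "nat \<Rightarrow> (nat \<Rightarrow> 'c) \<Rightarrow> 'u \<Rightarrow> nat \<Rightarrow> 'u" where
  "hat n a u = (\<lambda>i\<in>{..<n}. act (a i) u)"

abbreviation "F n \<equiv> power_mod n (reg_bimod C)"
abbreviation "V n \<equiv> power_mod n U"

lemma Vm: "right_module K H (V n)"
  by (rule power_mod_right_module) unfold_locales

lemma Fm: "right_module K C (F n)"
  by (rule power_mod_right_module[OF C.reg_right_module])

lemma F_coord: "a \<in> carrier (F n) \<Longrightarrow> i < n \<Longrightarrow> a i \<in> carrier C"
  by (simp add: PiE_iff)

lemma hat_rlin: "a \<in> carrier (F n) \<Longrightarrow> hat n a \<in> rlin K H U (V n)"
  unfolding hat_def by (rule power_mod_tuple[OF act_rlin]) (rule F_coord)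

lemma hat_add:
  assumes "a \<in> carrier (F n)" "b \<in> carrier (F n)" "u \<in> carrier U"
  shows "hat n (a \<oplus>\<^bsub>F n\<^esub> b) u = hat n a u \<oplus>\<^bsub>V n\<^esub> hat n b u"
  using assms F_coord[OF assms(1)] F_coord[OF assms(2)]
  by (auto simp: hat_def act_add intro!: restrict_ext)

lemma hat_ract:
  assumes "a \<in> carrier (F n)" "c \<in> carrier C" "u \<in> carrier U"
  shows "hat n (a \<triangleleft>\<^bsub>F n\<^esub> c) u = hat n a (act c u)"
  using assms F_coord[OF assms(1)]
  by (auto simp: hat_def act_mult intro!: restrict_ext)

lemma hat_smult:
  assumes "a \<in> carrier (F n)" "r \<in> carrier K" "u \<in> carrier U"
  shows "hat n (r \<odot>\<^bsub>F n\<^esub> a) u = r \<odot>\<^bsub>V n\<^esub> hat n a u"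
  using assms F_coord[OF assms(1)]
  by (auto simp: hat_def act_smult intro!: restrict_ext)

lemma hat_zero: "u \<in> carrier U \<Longrightarrow> hat n \<zero>\<^bsub>F n\<^esub> u = \<zero>\<^bsub>V n\<^esub>"
  by (auto simp: hat_def act_zero intro!: restrict_ext)

lemma hat_nsum:
  assumes "u \<in> carrier U" "\<And>j. j < q \<Longrightarrow> f j \<in> carrier (F n)"
  shows "hat n (nsum (F n) f q) u = nsum (V n) (\<lambda>j. hat n (f j) u) q"
proof (rule nsum_hom[where h = "\<lambda>a. hat n a u"])
  show "abelian_group (F n)" using Fm[of n] by (simp add: right_module_def module_def)
qed (use assms hat_add hat_zero in auto)

lemma hat_inj:
  assumes "a \<in> carrier (F n)" "b \<in> carrier (F n)" "\<And>u. u \<in> carrier U \<Longrightarrow> hat n a u = hat n b u"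
  shows "a = b"
proof (rule power_mod_ext[OF assms(1,2)])
  fix i assume i: "i < n"
  show "a i = b i"
  proof (rule act_faithful[OF F_coord[OF assms(1) i] F_coord[OF assms(2) i]])
    show "act (a i) u = act (b i) u" if "u \<in> carrier U" for u
      using fun_cong[OF assms(3)[OF that], of i] i by (simp add: hat_def)
  qed
qed

text \<open>A functional is left multiplication by the row of its values at the unit vectors. The
  induction is on the support of the argument.\<close>

lemma functional_form:
  assumes G: "G \<in> rlin K C (F n) (reg_bimod C)"
  obtains g where "\<And>i. i < n \<Longrightarrow> g i \<in> carrier C" "\<And>b. b \<in> carrier (F n) \<Longrightarrow> G b = nsum C (\<lambda>i. g i \<otimes>\<^bsub>C\<^esub> b i) n"
proof -
  interpret F: right_module K C "F n" by (rule Fm)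
  define e where "e k = (\<lambda>i\<in>{..<n}. if i = k then \<one>\<^bsub>C\<^esub> else \<zero>\<^bsub>C\<^esub>)" for k
  have e: "e k \<in> carrier (F n)" for k by (auto simp: e_def)
  have "\<forall>b\<in>carrier (F n). (\<forall>i<n. k \<le> i \<longrightarrow> b i = \<zero>\<^bsub>C\<^esub>) \<longrightarrow> G b = nsum C (\<lambda>i. G (e i) \<otimes>\<^bsub>C\<^esub> b i) k" if "k \<le> n" for k
    using that
  proof (induction k)
    case 0
    show ?case
    proof (intro ballI impI)
      fix b assume b: "b \<in> carrier (F n)" "\<forall>i<n. 0 \<le> i \<longrightarrow> b i = \<zero>\<^bsub>C\<^esub>"
      have "b = \<zero>\<^bsub>F n\<^esub>" using b(2) by (intro power_mod_ext[OF b(1) F.M.M.zero_closed]) simp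
      then show "G b = nsum C (\<lambda>i. G (e i) \<otimes>\<^bsub>C\<^esub> b i) 0"
        using rlin_group(1)[OF G Fm C.reg_right_module] by simp
    qed
  next
    case (Suc k)
    show ?case
    proof (intro ballI impI)
      fix b assume b: "b \<in> carrier (F n)" and b0: "\<forall>i<n. Suc k \<le> i \<longrightarrow> b i = \<zero>\<^bsub>C\<^esub>"
      define z where "z = (\<lambda>i\<in>{..<n}. if i = k then \<zero>\<^bsub>C\<^esub> else b i)"
      have bi: "b i \<in> carrier C" if "i < n" for i using F_coord[OF b that] .
      have bk: "b k \<in> carrier C" using bi Suc.prems by simp
      have z: "z \<in> carrier (F n)" using bi by (auto simp: z_def)
      have ek: "e k \<triangleleft>\<^bsub>F n\<^esub> b k \<in> carrier (F n)" by (rule F.ract_closed[OF e bk])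
      have "b = z \<oplus>\<^bsub>F n\<^esub> (e k \<triangleleft>\<^bsub>F n\<^esub> b k)"
      proof (rule power_mod_ext[OF b F.M.M.a_closed[OF z ek]])
        show "b i = (z \<oplus>\<^bsub>F n\<^esub> (e k \<triangleleft>\<^bsub>F n\<^esub> b k)) i" if "i < n" for i
          using that bi[OF that] bk by (simp add: z_def e_def)
      qed
      then have "G b = G z \<oplus>\<^bsub>C\<^esub> G (e k) \<otimes>\<^bsub>C\<^esub> b k"
        using rlin_regD(2)[OF G z ek] rlin_regD(4)[OF G e bk] by simp
      also have "G z = nsum C (\<lambda>i. G (e i) \<otimes>\<^bsub>C\<^esub> z i) k"
        using Suc z b0 by (auto simp: z_def)
      also have "\<dots> = nsum C (\<lambda>i. G (e i) \<otimes>\<^bsub>C\<^esub> b i) k"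
        using Suc.prems by (intro nsum_cong) (simp add: z_def)
      finally show "G b = nsum C (\<lambda>i. G (e i) \<otimes>\<^bsub>C\<^esub> b i) (Suc k)" by simp
    qed
  qed
  from this[of n] show ?thesis
    using rlin_regD(1)[OF G e] by (intro that[of "\<lambda>i. G (e i)"]) auto
qed

text \<open>Functionals on \<open>F n\<close> act as homomorphisms from \<open>V n\<close> to
  \<open>U\<close>. This carries the vanishing of a functional on elements of a syzygy over to a
  submodule of \<open>V n\<close>.\<close>

lemma functional_hat:
  assumes G: "G \<in> rlin K C (F n) (reg_bimod C)"
  obtains G' where "G' \<in> rlin K H (V n) U"
    "\<And>b u. b \<in> carrier (F n) \<Longrightarrow> u \<in> carrier U \<Longrightarrow> G' (hat n b u) = act (G b) u"
proof -
  obtain g where g: "\<And>i. i < n \<Longrightarrow> g i \<in> carrier C"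
    and Gb: "\<And>b. b \<in> carrier (F n) \<Longrightarrow> G b = nsum C (\<lambda>i. g i \<otimes>\<^bsub>C\<^esub> b i) n"
    using functional_form[OF G] by blast
  define G' where "G' w = nsum U (\<lambda>i. act (g i) (w i)) n" for w
  have "G' \<in> rlin K H (V n) U"
    unfolding G'_def
    by (rule rlin_nsum[OF rlin_comp[OF power_mod_coord act_rlin[OF g]] Vm U.right_module_axioms])
  moreover have "G' (hat n b u) = act (G b) u" if b: "b \<in> carrier (F n)" and u: "u \<in> carrier U" for b u
  proof -
    have "act (G b) u = nsum U (\<lambda>i. act (g i \<otimes>\<^bsub>C\<^esub> b i) u) n"
      unfolding Gb[OF b] using g F_coord[OF b] by (intro act_nsum[OF u]) simp
    also have "\<dots> = nsum U (\<lambda>i. act (g i) (hat n b u i)) n"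
      using g F_coord[OF b] u by (intro nsum_cong) (simp add: act_mult hat_def)
    finally show ?thesis by (simp add: G'_def)
  qed
  ultimately show ?thesis using that by blast
qed

text \<open>An endomorphism is determined by its values on a finite spanning set of
  \<open>U\<close>, so the evaluations at the \<open>v j\<close> are jointly injective.\<close>

lemma fin_functionals_C:
  assumes fU: "fin_functionals K U"
  shows "fin_functionals K C"
proof -
  obtain n v t where v: "\<And>j. j < n \<Longrightarrow> v j \<in> carrier U" and t: "\<And>j. j < n \<Longrightarrow> t j \<in> lin_map K U (base_space K)"
    and x: "\<And>x. x \<in> carrier U \<Longrightarrow> x = nsum U (\<lambda>j. t j x \<odot>\<^bsub>U\<^esub> v j) (n::nat)"
    using fin_functionals_basis[OF U.A.K.field_axioms U.M.module_axioms fU] by blast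
  show ?thesis
  proof (rule fin_functionals_joint[OF fU, of "(\<lambda>j c. act c (v j)) ` {..<n}"])
    show "(\<lambda>j c. act c (v j)) ` {..<n} \<subseteq> lin_map K C U" using v by (auto intro: act_lin_left)
    fix c assume c: "c \<in> carrier C" and 0: "\<forall>f\<in>(\<lambda>j c. act c (v j)) ` {..<n}. f c = \<zero>\<^bsub>U\<^esub>"
    show "c = \<zero>\<^bsub>C\<^esub>"
    proof (rule act_faithful[OF c C.M.zero_closed])
      fix u assume u: "u \<in> carrier U"
      note al = rlinD[OF act_rlin[OF c]]
      have tu: "t j u \<in> carrier K" if "j < n" for j using lin_mapD(1)[OF t[OF that] u] by simp
      have "act c u = act c (nsum U (\<lambda>j. t j u \<odot>\<^bsub>U\<^esub> v j) n)" using x[OF u] by simp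
      also have "\<dots> = nsum U (\<lambda>j. act c (t j u \<odot>\<^bsub>U\<^esub> v j)) n"
        using v tu al(3) rlin_group(1)[OF act_rlin[OF c] U.right_module_axioms U.right_module_axioms]
        by (intro nsum_hom U.M.M.abelian_group_axioms) auto
      also have "\<dots> = nsum U (\<lambda>j. \<zero>\<^bsub>U\<^esub>) n"
        using v tu al(4) 0 by (intro nsum_cong) simp
      also have "\<dots> = \<zero>\<^bsub>U\<^esub>" by (induction n) auto
      finally show "act c u = act \<zero>\<^bsub>C\<^esub> u" by (simp add: act_zero[OF u])
    qed
  qed simp
qed

text \<open>A spanning set \<open>x\<^sub>1, \<dots>, x\<^sub>q\<close> of the syzygy \<open>N\<close> gives a map \<open>\<sigma> : U\<^sup>q \<rightarrow> U\<^sup>n\<close> through whose image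
  \<open>T\<close> all elements of \<open>N\<close> factor. Conversely each homomorphism \<open>U \<rightarrow> T\<close> comes from \<open>N\<close> and hence
  lifts along \<open>\<sigma>\<close>. So \<open>\<sigma>\<close> splits over \<open>T\<close>, and the components of a section form a dual basis of \<open>N\<close>.\<close>

theorem syzygy_projective:
  fixes P :: "('k, 'p, 'h, 'y) rmod_scheme" and L :: "('k, 'l, 'c, 'w) rmod_scheme"
    and L' :: "('k, 'l2, 'c, 'w2) rmod_scheme"
  assumes ideals: "\<And>I. rsubmod H (reg_bimod H) I \<Longrightarrow> fg_projective K H ((reg_bimod H)\<lparr>carrier := I\<rparr>)"
    and fU: "fin_functionals K U" and P: "fg_projective K H P"
    and \<epsilon>: "\<epsilon> \<in> rlin K H P U" and \<epsilon>_surj: "\<epsilon> ` carrier P = carrier U"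
    and ext: "\<And>f. f \<in> rlin K H (P\<lparr>carrier := {x \<in> carrier P. \<epsilon> x = \<zero>\<^bsub>U\<^esub>}\<rparr>) U \<Longrightarrow>
      \<exists>g\<in>rlin K H P U. \<forall>x\<in>carrier P. \<epsilon> x = \<zero>\<^bsub>U\<^esub> \<longrightarrow> g x = f x"
    and L: "right_module K C L" and s: "s \<in> rlin K C L (F n)" and r: "r \<in> rlin K C (F n) L"
    and rs: "\<And>y. y \<in> carrier L \<Longrightarrow> r (s y) = y"
    and L': "right_module K C L'" and s': "s' \<in> rlin K C L' (F n')"
    and s'_inj: "\<And>y. y \<in> carrier L' \<Longrightarrow> s' y = \<zero>\<^bsub>F n'\<^esub> \<Longrightarrow> y = \<zero>\<^bsub>L'\<^esub>"
    and d: "d \<in> rlin K C L L'"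
  defines "N \<equiv> {y \<in> carrier L. d y = \<zero>\<^bsub>L'\<^esub>}"
  shows "fg_projective K C (L\<lparr>carrier := N\<rparr>)"
proof -
  let ?N = "L\<lparr>carrier := N\<rparr>"
  interpret L: right_module K C L by fact
  interpret Fn: right_module K C "F n" by (rule Fm)
  interpret Vn: right_module K H "V n" by (rule Vm)
  have NL: "N \<subseteq> carrier L" by (auto simp: N_def)
  have Nm: "right_module K C ?N"
    unfolding N_def by (rule L.right_module_sub[OF rsubmod_ker[OF d L L']])
  interpret N: right_module K C ?N by (rule Nm)
  have Cm: "right_module K C (reg_bimod C)" by (rule C.reg_right_module)
  have sN: "s y \<in> carrier (F n)" if "y \<in> N" for y using rlinD(2)[OF s] that NL by auto
  have "fin_functionals K (reg_bimod C)"
    by (rule fin_functionals_inj[OF fin_functionals_C[OF fU], of "\<lambda>x. x"]) (auto intro: lin_mapI)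
  then have fF: "fin_functionals K (F n)" by (rule fin_functionals_power)
  have "fin_functionals K L"
  proof (rule fin_functionals_inj[OF fF rlinD(1)[OF s]])
    fix x assume x: "x \<in> carrier L" "s x = \<zero>\<^bsub>F n\<^esub>"
    then show "x = \<zero>\<^bsub>L\<^esub>" using rs[OF x(1)] rlin_group(1)[OF r Fm L] by simp
  qed
  then have fN: "fin_functionals K ?N" by (rule fin_functionals_sub[OF _ NL])
  obtain q x t where xN: "\<And>j. j < q \<Longrightarrow> x j \<in> N" and t: "\<And>j. j < q \<Longrightarrow> t j \<in> lin_map K ?N (base_space K)"
    and xt: "\<And>y. y \<in> N \<Longrightarrow> y = nsum L (\<lambda>j. t j y \<odot>\<^bsub>L\<^esub> x j) (q::nat)"
    using fin_functionals_basis[OF U.A.K.field_axioms N.M.module_axioms fN] by auto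
  have tK: "t j y \<in> carrier K" if "j < q" "y \<in> N" for j y using lin_mapD(1)[OF t[OF that(1)], of y] that(2) by simp
  define \<sigma> where "\<sigma> w = nsum (V n) (\<lambda>j. hat n (s (x j)) (w j)) q" for w
  have \<sigma>: "\<sigma> \<in> rlin K H (V q) (V n)"
    unfolding \<sigma>_def by (rule rlin_nsum[OF rlin_comp[OF power_mod_coord hat_rlin[OF sN[OF xN]]] Vm Vm])
  define T where "T = \<sigma> ` carrier (V q)"
  \<comment> \<open>The coordinates of \<open>y\<close> with respect to the \<open>x j\<close>,
    acting on \<open>U\<close> as scalars: this lifts \<open>hat n (s y)\<close> along
    \<sigma>.\<close>
  define \<kappa> where "\<kappa> y u = (\<lambda>j\<in>{..<q}. t j y \<odot>\<^bsub>U\<^esub> u)" for y u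
  have \<kappa>: "\<kappa> y \<in> rlin K H U (V q)" if y: "y \<in> N" for y
    unfolding \<kappa>_def
  proof (rule power_mod_tuple)
    show "(\<lambda>u. t j y \<odot>\<^bsub>U\<^esub> u) \<in> rlin K H U U" if "j < q" for j
      using tK[OF that y] by (intro rlinI U.right_module_axioms) (simp_all add: U.M.smult_r_distr U.ract_smult_left)
  qed
  have \<sigma>\<kappa>: "\<sigma> (\<kappa> y u) = hat n (s y) u" if y: "y \<in> N" and u: "u \<in> carrier U" for y u
  proof -
    have txL: "t j y \<odot>\<^bsub>L\<^esub> x j \<in> carrier L" if "j < q" for j
      using tK[OF that y] xN[OF that] NL by auto
    have "s (nsum L (\<lambda>j. t j y \<odot>\<^bsub>L\<^esub> x j) q) = nsum (F n) (\<lambda>j. s (t j y \<odot>\<^bsub>L\<^esub> x j)) q"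
      by (rule nsum_hom[OF L.M.M.abelian_group_axioms rlinD(3)[OF s] rlin_group(1)[OF s L Fm] txL])
    then have "s y = nsum (F n) (\<lambda>j. s (t j y \<odot>\<^bsub>L\<^esub> x j)) q" using xt[OF y] by simp
    also have "\<dots> = nsum (F n) (\<lambda>j. t j y \<odot>\<^bsub>F n\<^esub> s (x j)) q"
      using tK[OF _ y] xN NL by (intro nsum_cong rlinD(4)[OF s]) auto
    finally have "hat n (s y) u = nsum (V n) (\<lambda>j. hat n (t j y \<odot>\<^bsub>F n\<^esub> s (x j)) u) q"
      using hat_nsum[OF u Fn.M.smult_closed[OF tK[OF _ y] sN[OF xN]]] by simp
    also have "\<dots> = \<sigma> (\<kappa> y u)"
      unfolding \<sigma>_def
    proof (rule nsum_cong)
      fix j assume j: "j < q"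
      show "hat n (t j y \<odot>\<^bsub>F n\<^esub> s (x j)) u = hat n (s (x j)) (\<kappa> y u j)"
        using hat_smult[OF sN[OF xN[OF j]] tK[OF j y] u] rlinD(4)[OF hat_rlin[OF sN[OF xN[OF j]]] tK[OF j y] u] j
        by (simp only: \<kappa>_def) simp
    qed
    finally show ?thesis by simp
  qed
  have hatT: "hat n (s y) u \<in> T" if "y \<in> N" "u \<in> carrier U" for y u
    unfolding T_def using \<sigma>\<kappa>[OF that] rlinD(2)[OF \<kappa>[OF that(1)] that(2)] by (metis image_eqI)
  \<comment> \<open>By fullness the coordinates of \<open>v\<close> form a vector \<open>a\<close>
    with \<open>hat n a\<close> equal to \<open>v\<close>. Once \<open>a\<close> is known to be
    \<open>s\<close> of an element of \<open>N\<close>, the map \<kappa> of that element is the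
    lift.\<close>
  have lift: "\<exists>\<kappa>\<in>rlin K H U (V q). \<forall>u\<in>carrier U. \<sigma> (\<kappa> u) = v u"
    if v: "v \<in> rlin K H U (V n)" and vT: "v ` carrier U \<subseteq> T" for v
  proof -
    have "\<exists>c\<in>carrier C. \<forall>u\<in>carrier U. act c u = v u i" if "i < n" for i
      by (rule act_full[OF rlin_comp[OF v power_mod_coord[OF that]]])
    then obtain a' where a': "\<And>i. i < n \<Longrightarrow> a' i \<in> carrier C" "\<And>i u. i < n \<Longrightarrow> u \<in> carrier U \<Longrightarrow> act (a' i) u = v u i"
      by metis
    define a where "a = (\<lambda>i\<in>{..<n}. a' i)"
    have a: "a \<in> carrier (F n)" using a'(1) by (auto simp: a_def)
    have av: "hat n a u = v u" if u: "u \<in> carrier U" for u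
      by (rule power_mod_ext[OF rlinD(2)[OF hat_rlin[OF a] u] rlinD(2)[OF v u]]) (simp add: hat_def a_def a'(2)[OF _ u])
    \<comment> \<open>A functional that vanishes on \<open>N\<close> induces a homomorphism that
      vanishes on \<open>T\<close>, where \<open>v\<close> takes its values; faithfulness then gives
      its vanishing at \<open>a\<close>.\<close>
    have Ga: "G a = \<zero>\<^bsub>C\<^esub>" if G: "G \<in> rlin K C (F n) (reg_bimod C)" and G0: "\<And>y. y \<in> N \<Longrightarrow> G (s y) = \<zero>\<^bsub>C\<^esub>" for G
    proof -
      obtain G' where G': "G' \<in> rlin K H (V n) U"
        and G'h: "\<And>b u. b \<in> carrier (F n) \<Longrightarrow> u \<in> carrier U \<Longrightarrow> G' (hat n b u) = act (G b) u"
        using functional_hat[OF G] by blast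
      have G'T: "G' w = \<zero>\<^bsub>U\<^esub>" if "w \<in> T" for w
      proof -
        obtain z where z: "z \<in> carrier (V q)" "w = \<sigma> z" using \<open>w \<in> T\<close> by (auto simp: T_def)
        have zj: "z j \<in> carrier U" if "j < q" for j using rlinD(2)[OF power_mod_coord[OF that] z(1)] .
        have "G' w = nsum U (\<lambda>j. G' (hat n (s (x j)) (z j))) q"
          unfolding z(2) \<sigma>_def
          by (rule nsum_hom[OF Vn.M.M.abelian_group_axioms rlinD(3)[OF G'] rlin_group(1)[OF G' Vm U.right_module_axioms]
                rlinD(2)[OF hat_rlin[OF sN[OF xN]] zj]])
        also have "\<dots> = nsum U (\<lambda>j. \<zero>\<^bsub>U\<^esub>) q"
          by (rule nsum_cong) (simp add: G'h[OF sN[OF xN] zj] G0[OF xN] act_zero[OF zj])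
        also have "\<dots> = \<zero>\<^bsub>U\<^esub>" by (induction q) auto
        finally show ?thesis .
      qed
      show ?thesis
      proof (rule act_faithful)
        show "G a \<in> carrier C" by (rule rlin_regD(1)[OF G a])
        fix u assume u: "u \<in> carrier U"
        have "v u \<in> T" using vT u by auto
        then show "act (G a) u = act \<zero>\<^bsub>C\<^esub> u" using G'T G'h[OF a u] av[OF u] act_zero[OF u] by simp
      qed simp
    qed
    \<comment> \<open>Two families of such functionals place \<open>a\<close> in the image of
      \<open>N\<close>: the coordinates of \<open>s\<close> after \<open>r\<close> minus the
      identity give \<open>s (r a) = a\<close>, and those of \<open>s'\<close> after
      \<open>d\<close> after \<open>r\<close> give that \<open>d\<close> kills
      \<open>r a\<close>.\<close>
    note sr = rlin_comp[OF r s]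
    have ra: "r a \<in> carrier L" by (rule rlinD(2)[OF r a])
    have sra: "s (r a) = a"
    proof (rule power_mod_ext[OF rlinD(2)[OF sr a] a])
      fix i assume i: "i < n"
      have G: "(\<lambda>b. s (r b) i \<ominus>\<^bsub>reg_bimod C\<^esub> b i) \<in> rlin K C (F n) (reg_bimod C)"
        by (rule rlin_diff[OF rlin_comp[OF sr power_mod_coord[OF i]] power_mod_coord[OF i] Fm Cm])
      have "s (r a) i \<ominus>\<^bsub>reg_bimod C\<^esub> a i = \<zero>\<^bsub>C\<^esub>"
      proof (rule Ga[OF G])
        fix y assume y: "y \<in> N"
        have "s y i \<in> carrier C" by (rule F_coord[OF sN[OF y] i])
        then show "s (r (s y)) i \<ominus>\<^bsub>reg_bimod C\<^esub> s y i = \<zero>\<^bsub>C\<^esub>"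
          using rs[of y] y NL by (simp add: C.M.minus_eq C.M.r_neg subset_iff)
      qed
      then show "s (r a) i = a i"
        using F_coord[OF rlinD(2)[OF sr a] i] F_coord[OF a i] by (simp add: C.M.diff_eq_zero_iff)
    qed
    have "d (r a) = \<zero>\<^bsub>L'\<^esub>"
    proof (rule s'_inj[OF rlinD(2)[OF d ra]])
      note s'dr = rlin_comp[OF rlin_comp[OF r d] s']
      show "s' (d (r a)) = \<zero>\<^bsub>F n'\<^esub>"
      proof (rule power_mod_ext[OF rlinD(2)[OF s'dr a]])
        show "\<zero>\<^bsub>F n'\<^esub> \<in> carrier (F n')" by auto
        fix i assume i: "i < n'"
        have "s' (d (r a)) i = \<zero>\<^bsub>C\<^esub>"
        proof (rule Ga[OF rlin_comp[OF s'dr power_mod_coord[OF i]]])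
          fix y assume y: "y \<in> N"
          then have "d (r (s y)) = \<zero>\<^bsub>L'\<^esub>" using rs[of y] by (auto simp: N_def)
          then show "s' (d (r (s y))) i = \<zero>\<^bsub>C\<^esub>" using rlin_group(1)[OF s' L' Fm] i by simp
        qed
        then show "s' (d (r a)) i = \<zero>\<^bsub>F n'\<^esub> i" using i by simp
      qed
    qed
    then have raN: "r a \<in> N" using ra by (simp add: N_def)
    show ?thesis
      by (intro bexI[OF _ \<kappa>[OF raN]] ballI) (simp add: \<sigma>\<kappa>[OF raN] sra av)
  qed
  have "\<exists>\<tau>\<in>rlin K H ((V n)\<lparr>carrier := T\<rparr>) (V q). \<forall>w\<in>T. \<sigma> (\<tau> w) = w"
    by (rule split_by_extension[OF U.A.k_algebra_axioms ideals U.right_module_axioms P \<epsilon> \<epsilon>_surj ext \<sigma> T_def lift])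
  then obtain \<tau> where \<tau>: "\<tau> \<in> rlin K H ((V n)\<lparr>carrier := T\<rparr>) (V q)" and \<sigma>\<tau>: "\<And>w. w \<in> T \<Longrightarrow> \<sigma> (\<tau> w) = w"
    by auto
  have \<tau>hat: "(\<lambda>u. \<tau> (hat n (s y) u)) \<in> rlin K H U (V q)" if y: "y \<in> N" for y
    by (rule rlin_comp[OF rlin_corestrict[OF hat_rlin[OF sN[OF y]]] \<tau>]) (rule hatT[OF y])
  \<comment> \<open>By fullness each component of the section \<tau>, composed with
    \<open>hat n (s y)\<close>, is given by an element of \<open>C\<close>. Faithfulness makes it
    unique, and hence linear in \<open>y\<close>.\<close>
  define \<phi> where "\<phi> j y = (SOME c. c \<in> carrier C \<and> (\<forall>u\<in>carrier U. act c u = \<tau> (hat n (s y) u) j))" for j y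
  have \<phi>': "\<phi> j y \<in> carrier C \<and> (\<forall>u\<in>carrier U. act (\<phi> j y) u = \<tau> (hat n (s y) u) j)" if "y \<in> N" "j < q" for y j
    unfolding \<phi>_def
    by (rule someI_ex[OF act_full[OF rlin_comp[OF \<tau>hat[OF that(1)] power_mod_coord[OF that(2)]], unfolded Bex_def]])
  then have \<phi>C: "\<And>y j. y \<in> N \<Longrightarrow> j < q \<Longrightarrow> \<phi> j y \<in> carrier C"
    and \<phi>: "\<And>y j u. y \<in> N \<Longrightarrow> j < q \<Longrightarrow> u \<in> carrier U \<Longrightarrow> act (\<phi> j y) u = \<tau> (hat n (s y) u) j"
    by simp_all
  have \<phi>l: "\<phi> j \<in> rlin K C ?N (reg_bimod C)" if j: "j < q" for j
  proof (rule rlinI[OF Nm Cm])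
    fix y assume "y \<in> carrier ?N" then have y: "y \<in> N" and yL: "y \<in> carrier L" using NL by auto
    show "\<phi> j y \<in> carrier (reg_bimod C)" using \<phi>C[OF y j] by simp
    { fix y' assume "y' \<in> carrier ?N" then have y': "y' \<in> N" and yL': "y' \<in> carrier L" using NL by auto
      have yy: "y \<oplus>\<^bsub>L\<^esub> y' \<in> N" using N.M.M.a_closed[of y y'] y y' by simp
      have "\<phi> j (y \<oplus>\<^bsub>L\<^esub> y') = \<phi> j y \<oplus>\<^bsub>C\<^esub> \<phi> j y'"
      proof (rule act_faithful[OF \<phi>C[OF yy j] C.M.a_closed[OF \<phi>C[OF y j] \<phi>C[OF y' j]]])
        fix u assume u: "u \<in> carrier U"
        have "\<tau> (hat n (s (y \<oplus>\<^bsub>L\<^esub> y')) u) = \<tau> (hat n (s y) u) \<oplus>\<^bsub>V q\<^esub> \<tau> (hat n (s y') u)"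
          using rlinD(3)[OF \<tau>, of "hat n (s y) u" "hat n (s y') u"] hatT[OF y u] hatT[OF y' u]
          by (simp only: rlinD(3)[OF s yL yL'] hat_add[OF sN[OF y] sN[OF y'] u]) simp
        then show "act (\<phi> j (y \<oplus>\<^bsub>L\<^esub> y')) u = act (\<phi> j y \<oplus>\<^bsub>C\<^esub> \<phi> j y') u"
          using j by (simp add: act_add[OF \<phi>C[OF y j] \<phi>C[OF y' j] u] \<phi>[OF yy j u] \<phi>[OF y j u] \<phi>[OF y' j u])
      qed
      then show "\<phi> j (y \<oplus>\<^bsub>?N\<^esub> y') = \<phi> j y \<oplus>\<^bsub>reg_bimod C\<^esub> \<phi> j y'" by simp }
    { fix c assume c: "c \<in> carrier C"
      have yc: "y \<triangleleft>\<^bsub>L\<^esub> c \<in> N" using N.ract_closed[of y c] y c by simp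
      have "\<phi> j (y \<triangleleft>\<^bsub>L\<^esub> c) = \<phi> j y \<otimes>\<^bsub>C\<^esub> c"
      proof (rule act_faithful[OF \<phi>C[OF yc j] C.A.m_closed[OF \<phi>C[OF y j] c]])
        fix u assume u: "u \<in> carrier U"
        show "act (\<phi> j (y \<triangleleft>\<^bsub>L\<^esub> c)) u = act (\<phi> j y \<otimes>\<^bsub>C\<^esub> c) u"
          by (simp only: act_mult[OF \<phi>C[OF y j] c u] \<phi>[OF yc j u] \<phi>[OF y j act_closed[OF c u]]
              rlinD(5)[OF s yL c] hat_ract[OF sN[OF y] c u])
      qed
      then show "\<phi> j (y \<triangleleft>\<^bsub>?N\<^esub> c) = \<phi> j y \<triangleleft>\<^bsub>reg_bimod C\<^esub> c" by simp }
  qed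
  have "(\<lambda>y. nsum ?N (\<lambda>j. x j \<triangleleft>\<^bsub>?N\<^esub> \<phi> j y) q) \<in> finrank K C ?N ?N"
    by (rule finrank_nsum[OF _ \<phi>l]) (simp_all add: xN)
  then have "(\<lambda>y. y) \<in> finrank K C ?N ?N"
  proof (rule finrank_cong)
    fix y assume "y \<in> carrier ?N" then have y: "y \<in> N" and yL: "y \<in> carrier L" using NL by auto
    have xL: "x j \<in> carrier L" if "j < q" for j using xN[OF that] NL by auto
    have x\<phi>: "x j \<triangleleft>\<^bsub>L\<^esub> \<phi> j y \<in> carrier L" if "j < q" for j
      by (rule L.ract_closed[OF xL[OF that] \<phi>C[OF y that]])
    let ?y = "nsum L (\<lambda>j. x j \<triangleleft>\<^bsub>L\<^esub> \<phi> j y) q"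
    have y': "?y \<in> carrier L" by (rule L.M.M.nsum_closed[OF x\<phi>])
    \<comment> \<open>Compared after \<open>hat\<close>: the expansion on the left becomes \<sigma>
      applied to \<tau> of \<open>hat n (s y)\<close>, and \<tau> is a section.\<close>
    have "s ?y = s y"
    proof (rule hat_inj[OF rlinD(2)[OF s y'] sN[OF y]])
      fix u assume u: "u \<in> carrier U"
      have "s ?y = nsum (F n) (\<lambda>j. s (x j \<triangleleft>\<^bsub>L\<^esub> \<phi> j y)) q"
        by (rule nsum_hom[OF L.M.M.abelian_group_axioms rlinD(3)[OF s] rlin_group(1)[OF s L Fm] x\<phi>])
      then have "hat n (s ?y) u = nsum (V n) (\<lambda>j. hat n (s (x j \<triangleleft>\<^bsub>L\<^esub> \<phi> j y)) u) q"
        using hat_nsum[OF u rlinD(2)[OF s x\<phi>]] by simp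
      also have "\<dots> = \<sigma> (\<tau> (hat n (s y) u))"
        unfolding \<sigma>_def
        by (rule nsum_cong) (simp only: rlinD(5)[OF s xL \<phi>C[OF y]] hat_ract[OF sN[OF xN] \<phi>C[OF y] u] \<phi>[OF y _ u])
      finally show "hat n (s ?y) u = hat n (s y) u" using \<sigma>\<tau>[OF hatT[OF y u]] by simp
    qed
    then have "?y = y" using rs[OF y'] rs[OF yL] by simp
    then show "y = nsum ?N (\<lambda>j. x j \<triangleleft>\<^bsub>?N\<^esub> \<phi> j y) q" by simp
  qed
  then show ?thesis using Nm by (simp add: fg_projective_def)
qed

end

section \<open>The bimodule DC\<close>

lemma dual_simps [simp]:
  "carrier (dual_bimod K Y) = lin_map K Y (base_space K) \<inter> extensional (carrier Y)"
  "\<zero>\<^bsub>dual_bimod K Y\<^esub> = (\<lambda>x\<in>carrier Y. \<zero>\<^bsub>K\<^esub>)"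
  "f \<oplus>\<^bsub>dual_bimod K Y\<^esub> g = (\<lambda>x\<in>carrier Y. f x \<oplus>\<^bsub>K\<^esub> g x)"
  "r \<odot>\<^bsub>dual_bimod K Y\<^esub> f = (\<lambda>x\<in>carrier Y. r \<otimes>\<^bsub>K\<^esub> f x)"
  "f \<triangleleft>\<^bsub>dual_bimod K Y\<^esub> a = (\<lambda>x\<in>carrier Y. f (a \<triangleright>\<^bsub>Y\<^esub> x))"
  "a \<triangleright>\<^bsub>dual_bimod K Y\<^esub> f = (\<lambda>x\<in>carrier Y. f (x \<triangleleft>\<^bsub>Y\<^esub> a))"
  by (simp_all add: dual_bimod_def fun_space_def module.defs)

context k_algebra
begin

abbreviation "DA \<equiv> dual_bimod K (reg_bimod A)"

lemma DA_I:
  assumes "\<And>x. x \<in> carrier A \<Longrightarrow> f x \<in> carrier K"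
    and "\<And>x y. x \<in> carrier A \<Longrightarrow> y \<in> carrier A \<Longrightarrow> f (x \<oplus>\<^bsub>A\<^esub> y) = f x \<oplus>\<^bsub>K\<^esub> f y"
    and "\<And>r x. r \<in> carrier K \<Longrightarrow> x \<in> carrier A \<Longrightarrow> f (r \<odot>\<^bsub>A\<^esub> x) = r \<otimes>\<^bsub>K\<^esub> f x"
  shows "restrict f (carrier A) \<in> carrier DA"
  using assms by (auto intro!: lin_mapI)

lemma DA_D:
  assumes "f \<in> carrier DA"
  shows "x \<in> carrier A \<Longrightarrow> f x \<in> carrier K"
    and "x \<in> carrier A \<Longrightarrow> y \<in> carrier A \<Longrightarrow> f (x \<oplus>\<^bsub>A\<^esub> y) = f x \<oplus>\<^bsub>K\<^esub> f y"
    and "r \<in> carrier K \<Longrightarrow> x \<in> carrier A \<Longrightarrow> f (r \<odot>\<^bsub>A\<^esub> x) = r \<otimes>\<^bsub>K\<^esub> f x"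
    and "f \<in> extensional (carrier A)"
  using assms lin_mapD[of f K "reg_bimod A" "base_space K"] by auto

lemma DA_ext: "f \<in> carrier DA \<Longrightarrow> g \<in> carrier DA \<Longrightarrow> (\<And>x. x \<in> carrier A \<Longrightarrow> f x = g x) \<Longrightarrow> f = g"
  using DA_D(4) by (intro extensionalityI[of f "carrier A" g])

lemma DA_module: "module K DA"
proof -
  have B: "module K (base_space K)" by (rule base_space_module) (rule K.is_cring)
  let ?F = "lin_map K (reg_bimod A) (base_space K) \<inter> extensional (carrier A)"
  have "module K (fun_space (carrier A) ?F (base_space K))"
  proof (rule fun_space_module[OF B])
    show "?F \<subseteq> carrier A \<rightarrow>\<^sub>E carrier (base_space K)"
      using lin_mapD(1)[of _ K "reg_bimod A" "base_space K"] by (auto simp: PiE_def)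
    show "(\<lambda>s\<in>carrier A. \<zero>\<^bsub>base_space K\<^esub>) \<in> ?F" using DA_I[of "\<lambda>_. \<zero>\<^bsub>K\<^esub>"] by simp
    show "(\<lambda>s\<in>carrier A. f s \<oplus>\<^bsub>base_space K\<^esub> g s) \<in> ?F" if "f \<in> ?F" "g \<in> ?F" for f g
      using DA_I[of "\<lambda>s. f s \<oplus>\<^bsub>K\<^esub> g s"] DA_D[of f] DA_D[of g] that by (simp add: K.a_ac K.r_distr)
    show "(\<lambda>s\<in>carrier A. r \<odot>\<^bsub>base_space K\<^esub> f s) \<in> ?F" if "r \<in> carrier K" "f \<in> ?F" for r f
      using DA_I[of "\<lambda>s. r \<otimes>\<^bsub>K\<^esub> f s"] DA_D[of f] that by (simp add: K.m_lcomm K.r_distr)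
  qed
  then show ?thesis by (rule module_cong) simp_all
qed

lemma DA_bimodule: "bimodule K A DA"
proof -
  interpret D: module K DA by (rule DA_module)
  have R: "f \<triangleleft>\<^bsub>DA\<^esub> a \<in> carrier DA" and L: "a \<triangleright>\<^bsub>DA\<^esub> f \<in> carrier DA" if "f \<in> carrier DA" "a \<in> carrier A" for f a
    using that DA_D[OF that(1)] DA_I[of "\<lambda>x. f (a \<otimes> x)"] DA_I[of "\<lambda>x. f (x \<otimes> a)"]
    by (simp_all add: A.r_distr A.l_distr smult_mult_left smult_mult_right)
  show ?thesis
  proof unfold_locales
    fix f a assume f: "f \<in> carrier DA" and a: "a \<in> carrier A"
    note fD = DA_D(1-3)[OF f]
    show "f \<triangleleft>\<^bsub>DA\<^esub> a \<in> carrier DA" "a \<triangleright>\<^bsub>DA\<^esub> f \<in> carrier DA" by (rule R[OF f a] L[OF f a])+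
    { fix g assume g: "g \<in> carrier DA"
      show "(f \<oplus>\<^bsub>DA\<^esub> g) \<triangleleft>\<^bsub>DA\<^esub> a = (f \<triangleleft>\<^bsub>DA\<^esub> a) \<oplus>\<^bsub>DA\<^esub> (g \<triangleleft>\<^bsub>DA\<^esub> a)"
        "a \<triangleright>\<^bsub>DA\<^esub> (f \<oplus>\<^bsub>DA\<^esub> g) = (a \<triangleright>\<^bsub>DA\<^esub> f) \<oplus>\<^bsub>DA\<^esub> (a \<triangleright>\<^bsub>DA\<^esub> g)"
        using a by (simp_all cong: restrict_cong) }
    { fix r assume r: "r \<in> carrier K"
      show "(r \<odot>\<^bsub>DA\<^esub> f) \<triangleleft>\<^bsub>DA\<^esub> a = r \<odot>\<^bsub>DA\<^esub> (f \<triangleleft>\<^bsub>DA\<^esub> a)"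
        "f \<triangleleft>\<^bsub>DA\<^esub> (r \<odot>\<^bsub>A\<^esub> a) = r \<odot>\<^bsub>DA\<^esub> (f \<triangleleft>\<^bsub>DA\<^esub> a)"
        "(r \<odot>\<^bsub>A\<^esub> a) \<triangleright>\<^bsub>DA\<^esub> f = r \<odot>\<^bsub>DA\<^esub> (a \<triangleright>\<^bsub>DA\<^esub> f)"
        "a \<triangleright>\<^bsub>DA\<^esub> (r \<odot>\<^bsub>DA\<^esub> f) = r \<odot>\<^bsub>DA\<^esub> (a \<triangleright>\<^bsub>DA\<^esub> f)"
        using a r fD by (simp_all add: smult_mult_left smult_mult_right cong: restrict_cong) }
    fix b assume b: "b \<in> carrier A"
    show "f \<triangleleft>\<^bsub>DA\<^esub> (a \<oplus>\<^bsub>A\<^esub> b) = (f \<triangleleft>\<^bsub>DA\<^esub> a) \<oplus>\<^bsub>DA\<^esub> (f \<triangleleft>\<^bsub>DA\<^esub> b)"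
      "(a \<oplus>\<^bsub>A\<^esub> b) \<triangleright>\<^bsub>DA\<^esub> f = (a \<triangleright>\<^bsub>DA\<^esub> f) \<oplus>\<^bsub>DA\<^esub> (b \<triangleright>\<^bsub>DA\<^esub> f)"
      "f \<triangleleft>\<^bsub>DA\<^esub> (a \<otimes>\<^bsub>A\<^esub> b) = (f \<triangleleft>\<^bsub>DA\<^esub> a) \<triangleleft>\<^bsub>DA\<^esub> b"
      "(a \<otimes>\<^bsub>A\<^esub> b) \<triangleright>\<^bsub>DA\<^esub> f = a \<triangleright>\<^bsub>DA\<^esub> (b \<triangleright>\<^bsub>DA\<^esub> f)"
      "(a \<triangleright>\<^bsub>DA\<^esub> f) \<triangleleft>\<^bsub>DA\<^esub> b = a \<triangleright>\<^bsub>DA\<^esub> (f \<triangleleft>\<^bsub>DA\<^esub> b)"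
      using a b fD by (simp_all add: A.l_distr A.r_distr A.m_assoc cong: restrict_cong)
  next
    fix f assume f: "f \<in> carrier DA"
    have "restrict f (carrier A) = f" using DA_D(4)[OF f] by (rule extensional_restrict)
    then show "f \<triangleleft>\<^bsub>DA\<^esub> \<one>\<^bsub>A\<^esub> = f" "\<one>\<^bsub>A\<^esub> \<triangleright>\<^bsub>DA\<^esub> f = f" by (simp_all cong: restrict_cong)
  qed
qed

text \<open>The evaluations at a finite spanning set of \<open>A\<close> separate linear
  forms.\<close>

lemma DA_fin_functionals:
  assumes "fin_functionals K A"
  shows "fin_functionals K DA"
proof -
  obtain n v t where v: "\<And>j. j < n \<Longrightarrow> v j \<in> carrier A" and t: "\<And>j. j < n \<Longrightarrow> t j \<in> lin_map K A (base_space K)"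
    and x: "\<And>x. x \<in> carrier A \<Longrightarrow> x = nsum A (\<lambda>j. t j x \<odot>\<^bsub>A\<^esub> v j) (n::nat)"
    using fin_functionals_basis[OF K.field_axioms module_axioms assms] by blast
  interpret D: module K DA by (rule DA_module)
  show ?thesis
  proof (rule fin_functionals_joint[OF fin_functionals_base[OF K.is_cring], of "(\<lambda>j f. f (v j)) ` {..<n}"])
    have "(\<lambda>f. f (v j)) \<in> lin_map K DA (base_space K)" if "j < n" for j
      using v[OF that] DA_D(1)[OF _ v[OF that]] by (intro lin_mapI) simp_all
    then show "(\<lambda>j f. f (v j)) ` {..<n} \<subseteq> lin_map K DA (base_space K)" by auto
    fix f assume f: "f \<in> carrier DA" and 0: "\<forall>t\<in>(\<lambda>j f. f (v j)) ` {..<n}. t f = \<zero>\<^bsub>base_space K\<^esub>"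
    note fD = DA_D[OF f]
    have f0: "f \<zero>\<^bsub>A\<^esub> = \<zero>\<^bsub>K\<^esub>" using fD(3)[of "\<zero>\<^bsub>K\<^esub>" "\<zero>\<^bsub>A\<^esub>"] fD(1) by simp
    show "f = \<zero>\<^bsub>DA\<^esub>"
    proof (rule DA_ext[OF f D.M.zero_closed])
      fix y assume y: "y \<in> carrier A"
      have ty: "t j y \<in> carrier K" if "j < n" for j using lin_mapD(1)[OF t[OF that] y] by simp
      have "f y = f (nsum A (\<lambda>j. t j y \<odot>\<^bsub>A\<^esub> v j) n)" using x[OF y] by simp
      also have "\<dots> = nsum K (\<lambda>j. f (t j y \<odot>\<^bsub>A\<^esub> v j)) n"
        using v ty fD(2) f0 by (intro nsum_hom M.abelian_group_axioms) auto
      also have "\<dots> = nsum K (\<lambda>j. \<zero>\<^bsub>K\<^esub>) n"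
        using v ty fD(3) 0 by (intro nsum_cong) simp
      also have "\<dots> = \<zero>\<^bsub>K\<^esub>" by (induction n) auto
      finally show "f y = \<zero>\<^bsub>DA\<^esub> y" using y by simp
    qed
  qed simp
qed

text \<open>The sign makes the Leibniz rules hold with a plus: composing \<open>f\<close> with
  \<delta> of a product produces an extra term in \<delta> \<open>a\<close>, which the last summand
  has to cancel.\<close>

lemma DA_conn:
  assumes \<delta>: "\<delta> \<in> derivations K A (reg_bimod A)"
  defines "D \<equiv> \<lambda>f. \<lambda>x\<in>carrier A. \<ominus>\<^bsub>K\<^esub> f (\<delta> x)"
  shows "D \<in> conn K A \<delta> DA"
    and "\<lbrakk>a \<in> carrier A; f \<in> carrier DA\<rbrakk> \<Longrightarrow> D (a \<triangleright>\<^bsub>DA\<^esub> f) = (a \<triangleright>\<^bsub>DA\<^esub> D f) \<oplus>\<^bsub>DA\<^esub> (\<delta> a \<triangleright>\<^bsub>DA\<^esub> f)"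
proof -
  interpret R: bimodule K A "reg_bimod A" by (rule bimodule_reg)
  note \<delta>l = lin_mapD[OF R.derivationsD(1)[OF \<delta>], simplified]
  note \<delta>m = R.derivationsD(3)[OF \<delta>, simplified]
  have Dc: "D f \<in> carrier DA" if f: "f \<in> carrier DA" for f
    unfolding D_def using DA_D[OF f] \<delta>l
    by (intro DA_I) (simp_all add: K.minus_add K.r_minus)
  show "D \<in> conn K A \<delta> DA"
    unfolding conn_def
  proof (intro CollectI conjI ballI)
    show "D \<in> lin_map K DA DA"
    proof (rule lin_mapI)
      show "D f \<in> carrier DA" if "f \<in> carrier DA" for f by (rule Dc[OF that])
      show "D (f \<oplus>\<^bsub>DA\<^esub> g) = D f \<oplus>\<^bsub>DA\<^esub> D g" if "f \<in> carrier DA" "g \<in> carrier DA" for f g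
        using DA_D(1)[OF that(1)] DA_D(1)[OF that(2)] \<delta>l(1) by (simp add: D_def K.minus_add cong: restrict_cong)
      show "D (r \<odot>\<^bsub>DA\<^esub> f) = r \<odot>\<^bsub>DA\<^esub> D f" if "r \<in> carrier K" "f \<in> carrier DA" for r f
        using that(1) DA_D(1)[OF that(2)] \<delta>l(1) by (simp add: D_def K.r_minus cong: restrict_cong)
    qed
    fix f a assume f: "f \<in> carrier DA" and a: "a \<in> carrier A"
    have da: "\<delta> a \<in> carrier A" using \<delta>l(1)[OF a] .
    have "\<ominus>\<^bsub>K\<^esub> f (a \<otimes>\<^bsub>A\<^esub> \<delta> x) = \<ominus>\<^bsub>K\<^esub> f (\<delta> (a \<otimes>\<^bsub>A\<^esub> x)) \<oplus>\<^bsub>K\<^esub> f (\<delta> a \<otimes>\<^bsub>A\<^esub> x)" if x: "x \<in> carrier A" for x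
      using a x da \<delta>l(1)[OF x] DA_D(1,2)[OF f] by (simp add: \<delta>m K.minus_add K.a_assoc K.l_neg)
    then show "D (f \<triangleleft>\<^bsub>DA\<^esub> a) = (D f \<triangleleft>\<^bsub>DA\<^esub> a) \<oplus>\<^bsub>DA\<^esub> (f \<triangleleft>\<^bsub>DA\<^esub> \<delta> a)"
      using a \<delta>l(1) by (simp add: D_def cong: restrict_cong)
  qed
  assume a: "a \<in> carrier A" and f: "f \<in> carrier DA"
  have da: "\<delta> a \<in> carrier A" using \<delta>l(1)[OF a] .
  have "\<ominus>\<^bsub>K\<^esub> f (\<delta> x \<otimes>\<^bsub>A\<^esub> a) = \<ominus>\<^bsub>K\<^esub> f (\<delta> (x \<otimes>\<^bsub>A\<^esub> a)) \<oplus>\<^bsub>K\<^esub> f (x \<otimes>\<^bsub>A\<^esub> \<delta> a)" if x: "x \<in> carrier A" for x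
  proof -
    have c: "f (x \<otimes>\<^bsub>A\<^esub> \<delta> a) \<in> carrier K" "f (\<delta> x \<otimes>\<^bsub>A\<^esub> a) \<in> carrier K"
      using a x da \<delta>l(1)[OF x] DA_D(1)[OF f] by auto
    then show ?thesis
      using a x da \<delta>l(1)[OF x] DA_D(2)[OF f] by (simp add: \<delta>m K.ag_simps)
  qed
  then show "D (a \<triangleright>\<^bsub>DA\<^esub> f) = (a \<triangleright>\<^bsub>DA\<^esub> D f) \<oplus>\<^bsub>DA\<^esub> (\<delta> a \<triangleright>\<^bsub>DA\<^esub> f)"
    using a \<delta>l(1) by (simp add: D_def cong: restrict_cong)
qed

end

section \<open>Passage to the definitions in the statement\<close>

lemma Ext_bimod_eq:
  assumes "ext_bimodule K A M (the_resolution K A M)"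
  shows "Ext_bimod K A (Suc m) M (reg_bimod A) = ext_bimodule.E K A M (the_resolution K A M) m"
  by (simp add: Ext_bimod_def Ext_def Let_def ext_bimodule.E_def[OF assms])

lemma End_algebra_simps:
  "carrier (End_algebra K H U) = rmod_hom K H U U"
  "f \<otimes>\<^bsub>End_algebra K H U\<^esub> g = compose (carrier U) f g"
  "f \<oplus>\<^bsub>End_algebra K H U\<^esub> g = (\<lambda>u\<in>carrier U. f u \<oplus>\<^bsub>U\<^esub> g u)"
  "r \<odot>\<^bsub>End_algebra K H U\<^esub> f = (\<lambda>u\<in>carrier U. r \<odot>\<^bsub>U\<^esub> f u)"
  by (simp_all add: End_algebra_def fun_space_def)

lemma endo_algebra_iso:
  assumes U: "right_module K H U" and C: "k_algebra K C"
    and h: "h \<in> ring_iso C (End_algebra K H U)" "h \<in> lin_map K C (End_algebra K H U)"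
  shows "endo_algebra K H U C h"
proof -
  interpret U: right_module K H U by fact
  interpret C: k_algebra K C by fact
  have hom: "h \<in> ring_hom C (End_algebra K H U)" and bij: "bij_betw h (carrier C) (rmod_hom K H U U)"
    using h(1) by (auto simp: ring_iso_def End_algebra_simps)
  have hc: "h c \<in> rmod_hom K H U U" if "c \<in> carrier C" for c
    using ring_hom_closed[OF hom that] by (simp add: End_algebra_simps)
  show ?thesis
  proof unfold_locales
    show "h c \<in> rlin K H U U" if "c \<in> carrier C" for c
      using hc[OF that] by (simp add: rmod_hom_eq_rlin)
    show "h (b \<oplus>\<^bsub>C\<^esub> c) u = h b u \<oplus>\<^bsub>U\<^esub> h c u" if "b \<in> carrier C" "c \<in> carrier C" "u \<in> carrier U" for b c u
      using that(3) by (simp add: ring_hom_add[OF hom that(1,2)] End_algebra_simps)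
    show "h (b \<otimes>\<^bsub>C\<^esub> c) u = h b (h c u)" if "b \<in> carrier C" "c \<in> carrier C" "u \<in> carrier U" for b c u
      using that(3) by (simp add: ring_hom_mult[OF hom that(1,2)] End_algebra_simps compose_def)
    show "h (r \<odot>\<^bsub>C\<^esub> c) u = r \<odot>\<^bsub>U\<^esub> h c u" if "r \<in> carrier K" "c \<in> carrier C" "u \<in> carrier U" for r c u
      using that(3) by (simp add: lin_mapD(3)[OF h(2) that(1,2)] End_algebra_simps)
    show "b = c" if "b \<in> carrier C" "c \<in> carrier C" "\<And>u. u \<in> carrier U \<Longrightarrow> h b u = h c u" for b c
    proof -
      have "h b = h c"
        using hc[OF that(1)] hc[OF that(2)] that(3)
        by (intro extensionalityI[of _ "carrier U"]) (auto simp: rmod_hom_eq_rlin)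
      then show ?thesis using bij that(1,2) by (auto simp: bij_betw_def inj_on_def)
    qed
    show "\<exists>c\<in>carrier C. \<forall>u\<in>carrier U. h c u = v u" if v: "v \<in> rlin K H U U" for v
    proof -
      have "restrict v (carrier U) \<in> h ` carrier C"
        using bij rlin_restrict[OF v U] by (simp add: bij_betw_def)
      then obtain c where "c \<in> carrier C" "h c = restrict v (carrier U)" by auto
      then show ?thesis by (intro bexI[of _ c]) simp_all
    qed
  qed
qed

text \<open>A map on the kernel of the augmentation, pulled back along \<open>d 0\<close>, is a
  cocycle of degree 1, hence a coboundary. The map on \<open>Q 0\<close> that exhibits this extends
  \<open>f\<close>, since \<open>d 0\<close> is onto the kernel.\<close>

lemma Ext1_extension:
  assumes R_def: "R = the_resolution K A M" and R: "resolved K A M R" and N: "right_module K A N"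
    and Ext: "carrier (Ext K A 1 M N) = {\<zero>\<^bsub>Ext K A 1 M N\<^esub>}"
    and f: "f \<in> rlin K A ((res_obj R 0)\<lparr>carrier := {x \<in> carrier (res_obj R 0). res_aug R x = \<zero>\<^bsub>M\<^esub>}\<rparr>) N"
  shows "\<exists>g\<in>rlin K A (res_obj R 0) N. \<forall>x\<in>carrier (res_obj R 0). res_aug R x = \<zero>\<^bsub>M\<^esub> \<longrightarrow> g x = f x"
proof -
  interpret resolved K A M R by fact
  let ?Z = "Hom_cocycle_space K A R 1 N" and ?W = "Hom_coboundaries K A R 1 N"
  let ?O = "(Q 0)\<lparr>carrier := {x \<in> carrier (Q 0). aug x = \<zero>\<^bsub>M\<^esub>}\<rparr>"
  interpret N: right_module K A N by fact
  interpret Q0: right_module K A "Q 0" by (rule Q_mod)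
  have Om: "right_module K A ?O"
    by (rule Q0.right_module_sub[OF rsubmod_ker[OF aug_rlin Q_mod right_module_axioms]])
  have d0: "d 0 \<in> rlin K A (Q (Suc 0)) ?O"
    by (rule rlin_corestrict[OF d_rlin]) (use rlinD(2)[OF d_rlin] aug_d in blast)
  define g where "g = (\<lambda>x\<in>carrier (Q (Suc 0)). f (d 0 x))"
  have "g \<in> rmod_hom K A (Q (Suc 0)) N" unfolding g_def by (rule rlin_restrict[OF rlin_comp[OF d0 f] Q_mod])
  moreover have "g (d (Suc 0) x) = \<zero>\<^bsub>N\<^esub>" if "x \<in> carrier (Q (Suc (Suc 0)))" for x
    using that rlinD(2)[OF d_rlin that] rlin_group(1)[OF f Om N] by (simp add: g_def d_d)
  ultimately have gZ: "g \<in> Hom_cocycles K A R 1 N" by (simp add: Hom_cocycles_def)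
  have zW: "(\<lambda>x\<in>carrier (Q (Suc 0)). \<zero>\<^bsub>N\<^esub>) \<in> ?W"
  proof -
    have "restrict (\<lambda>_. \<zero>\<^bsub>N\<^esub>) (carrier (Q 0)) \<in> rmod_hom K A (Q 0) N"
      by (rule rlin_restrict[OF rlin_zero[OF Q_mod N] Q_mod])
    moreover have "(\<lambda>x\<in>carrier (Q (Suc 0)). \<zero>\<^bsub>N\<^esub>) =
        compose (carrier (Q (Suc 0))) (restrict (\<lambda>_. \<zero>\<^bsub>N\<^esub>) (carrier (Q 0))) (d 0)"
      using rlinD(2)[OF d_rlin] by (auto simp: compose_def intro!: restrict_ext)
    ultimately show ?thesis by (simp add: Hom_coboundaries_def)
  qed
  \<comment> \<open>The only coset is \<open>?W\<close> itself, and \<open>g\<close> lies in its own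
    coset because the zero map is a coboundary; so \<open>g\<close> is a coboundary.\<close>
  have "?W +>\<^bsub>?Z\<^esub> g \<in> carrier (Ext K A 1 M N)"
    using gZ by (auto simp: Ext_def Let_def R_def[symmetric] A_RCOSETS_def' Hom_cocycle_space_def)
  then have eq: "?W +>\<^bsub>?Z\<^esub> g = ?W" using Ext by (simp add: Ext_def Let_def R_def[symmetric])
  have "g = (\<lambda>x\<in>carrier (Q (Suc 0)). \<zero>\<^bsub>N\<^esub>) \<oplus>\<^bsub>?Z\<^esub> g"
    using rlinD(2)[OF rlin_comp[OF d0 f]] by (auto simp: Hom_cocycle_space_def g_def)
  then have "g \<in> ?W +>\<^bsub>?Z\<^esub> g" using zW unfolding a_r_coset_def' by blast
  then obtain k where k: "k \<in> rmod_hom K A (Q 0) N" "g = compose (carrier (Q (Suc 0))) k (d 0)"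
    unfolding eq by (auto simp: Hom_coboundaries_def)
  show ?thesis
  proof (intro bexI ballI impI)
    show "k \<in> rlin K A (Q 0) N" using k(1) by (simp add: rmod_hom_eq_rlin)
    fix x assume "x \<in> carrier (Q 0)" "aug x = \<zero>\<^bsub>M\<^esub>"
    then have "x \<in> d 0 ` carrier (Q (Suc 0))" by (simp add: exact_zero)
    then obtain y where y: "y \<in> carrier (Q (Suc 0))" "x = d 0 y" by auto
    show "k x = f x" using fun_cong[OF k(2), of y] y by (simp add: g_def compose_def)
  qed
qed

theorem theorem3p5:
  fixes K :: "('k, 'r) ring_scheme"
    and C :: "('k, 'c, 's) module_scheme"
    and H :: "('k, 'h, 't) module_scheme"
    and U :: "('k, 'u, 'h, 'z) rmod_scheme"
    and E :: "('k, ((nat \<Rightarrow> 'c) \<Rightarrow> 'c) set, 'c) bimod"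
    and B :: "('k, 'c \<times> ((nat \<Rightarrow> 'c) \<Rightarrow> 'c) set) module"
  assumes "algebraically_closed K"
    and "tilted_by K C H U"
    and E: "E = Ext_bimod K C 2 (dual_bimod K (reg_bimod C)) (reg_bimod C)"
    and B: "B = trivial_ext C E"
  defines "p \<equiv> fst"
    and "q \<equiv> (\<lambda>c. (c, \<zero>\<^bsub>E\<^esub>))"
    and "i \<equiv> (\<lambda>e. (\<zero>\<^bsub>C\<^esub>, e))"
  defines "EB \<equiv> restrict_bimod p E"
  shows "module K (HH1 K B EB) \<and> module K (HH1 K B (reg_bimod B)) \<and> module K (HH1 K C (reg_bimod C)) \<and>
    (\<exists>\<iota> \<in> lin_map K (HH1 K B EB) (HH1 K B (reg_bimod B)).
     \<exists>\<phi> \<in> lin_map K (HH1 K B (reg_bimod B)) (HH1 K C (reg_bimod C)).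
       (\<forall>\<delta> \<in> derivations K B EB.
          compose (carrier B) i \<delta> \<in> derivations K B (reg_bimod B) \<and>
          \<iota> (HH1_class K B EB \<delta>) = HH1_class K B (reg_bimod B) (compose (carrier B) i \<delta>)) \<and>
       (\<forall>\<delta> \<in> derivations K B (reg_bimod B).
          (\<lambda>c\<in>carrier C. p (\<delta> (q c))) \<in> derivations K C (reg_bimod C) \<and>
          \<phi> (HH1_class K B (reg_bimod B) \<delta>) = HH1_class K C (reg_bimod C) (\<lambda>c\<in>carrier C. p (\<delta> (q c)))) \<and>
       short_exact (HH1 K B EB) (HH1 K B (reg_bimod B)) (HH1 K C (reg_bimod C)) \<iota> \<phi>)"
proof -
  note tb = \<open>tilted_by K C H U\<close>[unfolded tilted_by_def tilting_def]
  have Ca: "k_algebra K C" and Ha: "k_algebra K H" and fdH: "finite_dim K H" and her: "hereditary K H"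
    and U: "right_module K H U" and fdU: "finite_dim K U"
    and Ext1: "carrier (Ext K H 1 U U) = {\<zero>\<^bsub>Ext K H 1 U U\<^esub>}"
    and "\<exists>h\<in>ring_iso C (End_algebra K H U). h \<in> lin_map K C (End_algebra K H U)"
    using tb by blast+
  then obtain h where h: "h \<in> ring_iso C (End_algebra K H U)" "h \<in> lin_map K C (End_algebra K H U)" by blast
  interpret C: k_algebra K C by (rule Ca)
  interpret H: k_algebra K H by (rule Ha)
  interpret U: right_module K H U by (rule U)
  interpret N: endo_algebra K H U C h by (rule endo_algebra_iso[OF U Ca h])
  have fU: "fin_functionals K U" by (rule finite_dim_fin_functionals[OF C.K.field_axioms U.M.module_axioms fdU])
  have fH: "fin_functionals K H" by (rule finite_dim_fin_functionals[OF C.K.field_axioms H.module_axioms fdH])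
  have fC: "fin_functionals K C" by (rule N.fin_functionals_C[OF fU])
  let ?D = "dual_bimod K (reg_bimod C)"
  define S where "S = the_resolution K H U"
  define R where "R = the_resolution K C ?D"
  have S: "proj_resolution K H U S"
    unfolding S_def the_resolution_def by (rule someI_ex[OF proj_resolution_exists[OF Ha U fH fU]])
  interpret D: bimodule K C ?D by (rule C.DA_bimodule)
  have R: "proj_resolution K C ?D R"
    unfolding R_def the_resolution_def
    by (rule someI_ex[OF proj_resolution_exists[OF Ca D.right_module_axioms fC C.DA_fin_functionals[OF fC]]])
  interpret S: resolved K H U S by unfold_locales (rule S)
  \<comment> \<open>The parameter 1 stands for degree \<open>Suc 1\<close>, the second Ext.\<close>
  interpret X: ext_bimodule K C ?D R 1 by unfold_locales (rule R)
  have EX: "E = X.E"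
    using Ext_bimod_eq[OF X.ext_bimodule_axioms[unfolded R_def], of 1] unfolding E R_def by (simp add: numeral_2_eq_2)
  have proj: "projective K C (X.Q n)" for n using R by (simp add: proj_resolution_def)
  \<comment> \<open>Presents the terms of the resolution as retracts of free modules, the form in
    which the syzygy theorem takes them. The section at \<open>Q 0\<close> serves there as an
    embedding into a free module.\<close>
  have ret: "\<exists>n s r. s \<in> rlin K C (X.Q k) (power_mod n (reg_bimod C)) \<and> r \<in> rlin K C (power_mod n (reg_bimod C)) (X.Q k) \<and>
      (\<forall>x\<in>carrier (X.Q k). r (s x) = x)" for k
    using proj[of k] unfolding projective_def in_add_def rmod_hom_eq_rlin by blast
  obtain n1 s1 r1 where 1: "s1 \<in> rlin K C (X.Q 1) (power_mod n1 (reg_bimod C))"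
    "r1 \<in> rlin K C (power_mod n1 (reg_bimod C)) (X.Q 1)" "\<And>x. x \<in> carrier (X.Q 1) \<Longrightarrow> r1 (s1 x) = x"
    using ret[of 1] by blast
  obtain n0 s0 r0 where 0: "s0 \<in> rlin K C (X.Q 0) (power_mod n0 (reg_bimod C))"
    "r0 \<in> rlin K C (power_mod n0 (reg_bimod C)) (X.Q 0)" "\<And>x. x \<in> carrier (X.Q 0) \<Longrightarrow> r0 (s0 x) = x"
    using ret[of 0] by blast
  have s0_inj: "y = \<zero>\<^bsub>X.Q 0\<^esub>" if "y \<in> carrier (X.Q 0)" "s0 y = \<zero>\<^bsub>power_mod n0 (reg_bimod C)\<^esub>" for y
    using 0(3)[OF that(1)] rlin_group(1)[OF 0(2) N.Fm X.Q_mod] unfolding that(2) by simp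
  have d0: "X.d 0 \<in> rlin K C (X.Q 1) (X.Q 0)" using X.d_rlin[of 0] by simp
  have "fg_projective K C ((X.Q 1)\<lparr>carrier := {y \<in> carrier (X.Q 1). X.d 0 y = \<zero>\<^bsub>X.Q 0\<^esub>}\<rparr>)"
    by (rule N.syzygy_projective[OF H.hereditary_ideal[OF her] fU S.Q_proj S.aug_rlin S.aug_surj
          Ext1_extension[OF S_def S.resolved_axioms U Ext1] X.Q_mod 1 X.Q_mod 0(1) s0_inj d0])
  \<comment> \<open>By exactness the kernel of \<open>d 0\<close> is the image of
    \<open>d 1\<close>, the syzygy that \<open>E_no_hom\<close> refers to for
    \<open>m = 1\<close>.\<close>
  then have \<Omega>: "fg_projective K C ((X.Q 1)\<lparr>carrier := X.d 1 ` carrier (X.Q (Suc 1))\<rparr>)"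
    using X.exact_Suc[of 0] by simp
  have bim: "bimodule K C E" unfolding EX by (rule X.E_bimodule)
  show ?thesis
    unfolding EB_def p_def q_def i_def B
  proof (rule trivial_ext_HH1_exact[OF bim])
    fix c e assume c: "c \<in> carrier C" "\<forall>x\<in>carrier C. c \<otimes>\<^bsub>C\<^esub> x = x \<otimes>\<^bsub>C\<^esub> c" and e: "e \<in> carrier E"
    have "c \<triangleright>\<^bsub>?D\<^esub> f = f \<triangleleft>\<^bsub>?D\<^esub> c" for f using c(2) by (auto intro!: restrict_ext)
    then show "c \<triangleright>\<^bsub>E\<^esub> e = e \<triangleleft>\<^bsub>E\<^esub> c"
      using c e unfolding EX by (intro X.E_central) auto
  next
    fix f e assume "f \<in> lin_map K E C" "\<forall>c\<in>carrier C. \<forall>e\<in>carrier E. f (c \<triangleright>\<^bsub>E\<^esub> e) = c \<otimes>\<^bsub>C\<^esub> f e" "e \<in> carrier E"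
    then show "f e = \<zero>\<^bsub>C\<^esub>" unfolding EX by (intro X.E_no_hom[OF \<Omega>]) auto
  next
    fix \<delta> assume \<delta>: "\<delta> \<in> derivations K C (reg_bimod C)"
    show "\<exists>D\<in>lin_map K E E. \<forall>c\<in>carrier C. \<forall>e\<in>carrier E.
        D (c \<triangleright>\<^bsub>E\<^esub> e) = (c \<triangleright>\<^bsub>E\<^esub> D e) \<oplus>\<^bsub>E\<^esub> (\<delta> c \<triangleright>\<^bsub>E\<^esub> e) \<and> D (e \<triangleleft>\<^bsub>E\<^esub> c) = (D e \<triangleleft>\<^bsub>E\<^esub> c) \<oplus>\<^bsub>E\<^esub> (e \<triangleleft>\<^bsub>E\<^esub> \<delta> c)"
      unfolding EX by (rule X.E_derivation[OF \<delta> C.DA_conn(1)[OF \<delta>] C.DA_conn(2)[OF \<delta>]])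
  qed
qed

end
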